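(* Let $(r,s,t,\rho)_\epsilon$ be a 4-tuple of integers such that $r,s,t\ge0$, and $\epsilon=\pm1$. Put $n=2r+1+s+t$ and let $\bar\rho\equiv\epsilon\rho \pmod n$ with $0\le\bar\rho<n$. If $0\le\bar\rho<n-t$, let $\beta\equiv t\pmod{\bar\rho}$ with $0\le\beta<\bar\rho$, $\alpha=\bar\rho-\beta$, $\gamma=n-\bar\rho-t$, and $\delta=s$. If $n-t\le\bar\rho<n$, let $\beta\equiv t\pmod{n-\bar\rho}$ with $0\le\beta<n-\bar\rho$, $\alpha=\bar\rho-t$, $\gamma=n-\bar\rho-\beta$, and $\delta=s$. If the component counting algorithm returns $1$ for the input $(\alpha,\beta,\gamma,\delta)$, then there exists a simple arc with ends $x,y$ on the torus $T$ which is determined by $(r,s,t,\rho)_\epsilon$.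
   Context: **Component counting algorithm.** Input: a quadruple $(\alpha,\beta,\gamma,\delta)$. (a) If at least one entry is $0$, delete one zero entry, leaving $(a,b,c)$ in order, and return $\gcd(|a-c|,b+c)$ (with $\gcd(0,k)=k$). (b) Otherwise, if $\alpha<\delta$, replace the quadruple by $(\delta,\gamma,\beta,\alpha)$. If now $\alpha=\delta$, return $\alpha+\gcd(\beta,\gamma)$. If $\alpha>\delta$, let $\bar\beta$ be the remainder of $\delta$ on division by $\alpha-\delta$, $\bar\alpha=\alpha-\delta-\bar\beta$, $\bar\gamma=\beta$, $\bar\delta=\gamma$, and restart with $(\bar\alpha,\bar\beta,\bar\gamma,\bar\delta)$. **Torus.** $T=S^1\times[0,1]/((w,1)\sim(w,0))$ with $S^1=[-4,4]/(4\sim-4)$; $x=[(1,0)]$, $y=[(-1,0)]$. **The curve determined by a 4-tuple.** Given integers $r,s,t\ge0$, $\rho\in\mathbb Z$, $\epsilon=\pm1$, put $n=2r+1+s+t$. Let $\eta>0$ be small. On each of the circles $S=\{z=\eta\}$ and $F=\{z=-\eta\equiv 1-\eta\}$ ($z$ the height coordinate) mark $n$ equally spaced positions $1,\dots,n$, position $k$ being at $w=-4+8(k-\frac12)/n$. In the rectangle $(-4,4)\times[-\eta,\eta]$ (which contains $x=(1,0)$ and $y=(-1,0)$) draw disjoint arcs as follows. If $\epsilon=+1$: the positions on $F$ are divided, in increasing order, into a block of $2r+1$ positions (the $F$-block), then a group of $s$, then a group of $t$; the positions on $S$ into a group of $s$, then a block of $2r+1$ (the $S$-block), then a group of $t$.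 If $\epsilon=-1$: $F$ is divided into a group of $s$, the $F$-block of $2r+1$, a group of $t$; $S$ into the $S$-block of $2r+1$, a group of $s$, a group of $t$. The $s$-group of $F$ is joined to the $s$-group of $S$ by $s$ disjoint order-preserving arcs, likewise for the $t$-groups. In the $F$-block the middle position is joined by an arc to the point $y$ if $\epsilon=+1$ (to $x$ if $\epsilon=-1$), and for $1\le k\le r$ the $k$-th position is joined to the $(2r+2-k)$-th by an arc, these $r$ arcs being nested around the arc ending at that point and not enclosing the other of the two points. In the $S$-block the same is done with $x$ if $\epsilon=+1$ ($y$ if $\epsilon=-1$). All these arcs are pairwise disjoint. In the remaining annulus $S^1\times[\eta,1-\eta]$ draw $n$ disjoint arcs, the one starting at position $j$ of $S$ rotating uniformly by $-8\rho/n$ in $w$ as $z$ goes from $\eta$ to $1-\eta$, so that it ends at position $j-\rho \pmod n$ of $F$. The union is the curve determined by $(r,s,t,\rho)_\epsilon$: one arc component joining $x$ to $y$ and possibly some closed components. The 4-tuple determines a simple arc with ends $x,y$ when there are no closed components. *)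

theory Defs
  imports "HOL-Analysis.Analysis" "HOL-Number_Theory.Cong"
begin

(* "component_count \<alpha> \<beta> \<gamma> \<delta> k" means that the algorithm, started on the
   quadruple (\<alpha>,\<beta>,\<gamma>,\<delta>), stops and returns k. If several entries are 0, any one of
   them may be deleted. The entries are arbitrary integers, since the quadruples to which the
   algorithm is applied may have a negative first entry. *)
inductive component_count :: "int \<Rightarrow> int \<Rightarrow> int \<Rightarrow> int \<Rightarrow> int \<Rightarrow> bool" where
  delete1: "component_count 0 \<beta> \<gamma> \<delta> (gcd \<bar>\<beta> - \<delta>\<bar> (\<gamma> + \<delta>))"
| delete2: "component_count \<alpha> 0 \<gamma> \<delta> (gcd \<bar>\<alpha> - \<delta>\<bar> (\<gamma> + \<delta>))"
| delete3: "component_count \<alpha> \<beta> 0 \<delta> (gcd \<bar>\<alpha> - \<delta>\<bar> (\<beta> + \<delta>))"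
| delete4: "component_count \<alpha> \<beta> \<gamma> 0 (gcd \<bar>\<alpha> - \<gamma>\<bar> (\<beta> + \<gamma>))"
| reverse: "0 \<notin> {\<alpha>, \<beta>, \<gamma>, \<delta>} \<Longrightarrow> \<alpha> < \<delta> \<Longrightarrow> component_count \<delta> \<gamma> \<beta> \<alpha> k
    \<Longrightarrow> component_count \<alpha> \<beta> \<gamma> \<delta> k"
| equal: "0 \<notin> {\<alpha>, \<beta>, \<gamma>, \<delta>} \<Longrightarrow> \<alpha> = \<delta> \<Longrightarrow> component_count \<alpha> \<beta> \<gamma> \<delta> (\<alpha> + gcd \<beta> \<gamma>)"
| step: "0 \<notin> {\<alpha>, \<beta>, \<gamma>, \<delta>} \<Longrightarrow> \<delta> < \<alpha> \<Longrightarrow> \<beta>' = \<delta> mod (\<alpha> - \<delta>)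
    \<Longrightarrow> component_count (\<alpha> - \<delta> - \<beta>') \<beta>' \<beta> \<gamma> k \<Longrightarrow> component_count \<alpha> \<beta> \<gamma> \<delta> k"

(* The quotient of X by the equivalence relation "f p = f q", the class of p being
   represented by f p. *)
definition quotient_by :: "'a topology \<Rightarrow> ('a \<Rightarrow> 'b) \<Rightarrow> 'b topology" where
  "quotient_by X f =
     topology (\<lambda>U. U \<subseteq> f ` topspace X \<and> openin X {p \<in> topspace X. f p \<in> U})"

lemma openin_quotient_by:
  "openin (quotient_by X f) U \<longleftrightarrow> U \<subseteq> f ` topspace X \<and> openin X {p \<in> topspace X. f p \<in> U}"
proof -
  have "istopology (\<lambda>U. U \<subseteq> f ` topspace X \<and> openin X {p \<in> topspace X. f p \<in> U})"
    unfolding istopology_def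
  proof (rule conjI; intro allI impI conjI)
    fix S T
    assume S: "S \<subseteq> f ` topspace X \<and> openin X {p \<in> topspace X. f p \<in> S}"
      and T: "T \<subseteq> f ` topspace X \<and> openin X {p \<in> topspace X. f p \<in> T}"
    show "S \<inter> T \<subseteq> f ` topspace X" using S by blast
    have "{p \<in> topspace X. f p \<in> S \<inter> T}
        = {p \<in> topspace X. f p \<in> S} \<inter> {p \<in> topspace X. f p \<in> T}" by blast
    then show "openin X {p \<in> topspace X. f p \<in> S \<inter> T}" using S T by (simp add: openin_Int)
  next
    fix K
    assume K: "\<forall>S\<in>K. S \<subseteq> f ` topspace X \<and> openin X {p \<in> topspace X. f p \<in> S}"
    show "\<Union>K \<subseteq> f ` topspace X" using K by blast
    have "{p \<in> topspace X. f p \<in> \<Union>K} = (\<Union>S\<in>K. {p \<in> topspace X. f p \<in> S})" by blast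
    then show "openin X {p \<in> topspace X. f p \<in> \<Union>K}" using K by auto
  qed
  then show ?thesis unfolding quotient_by_def by simp
qed

lemma topspace_quotient_by: "topspace (quotient_by X f) = f ` topspace X"
proof -
  have "openin (quotient_by X f) (f ` topspace X)"
  proof -
    have "{p \<in> topspace X. f p \<in> f ` topspace X} = topspace X" by blast
    then show ?thesis by (simp add: openin_quotient_by)
  qed
  moreover have "topspace (quotient_by X f) \<subseteq> f ` topspace X"
    using openin_quotient_by[of X f "topspace (quotient_by X f)"] by simp
  ultimately show ?thesis by (meson openin_subset subset_antisym)
qed

lemma quotient_map_quotient_by: "quotient_map X (quotient_by X f) f"
  by (auto simp: quotient_map_def topspace_quotient_by openin_quotient_by)

(* On [-4,4] the only identification made by circ_pt is 4 ~ -4, and on [0,1] the only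
   identification made by frac is 1 ~ 0. *)
definition circ_pt :: "real \<Rightarrow> real" where
  "circ_pt w = w - 8 * of_int \<lfloor>(w + 4) / 8\<rfloor>"

definition circle :: "real topology" where
  "circle = quotient_by (top_of_set {-4..4}) circ_pt"

definition torus :: "(real \<times> real) topology" where
  "torus = quotient_by (prod_topology circle (top_of_set {0..1})) (\<lambda>(w, z). (w, frac z))"

(* The point of the torus with coordinates (w,z), where w counts modulo 8 and the height z
   modulo 1; thus z = -\<eta> is the same height as z = 1 - \<eta>. *)
definition torus_pt :: "real \<times> real \<Rightarrow> real \<times> real" where
  "torus_pt = (\<lambda>(w, z). (circ_pt w, frac z))"

definition simple_arc_in :: "'a topology \<Rightarrow> 'a set \<Rightarrow> 'a \<Rightarrow> 'a \<Rightarrow> bool" where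
  "simple_arc_in X C a b \<longleftrightarrow>
     (\<exists>g. pathin X g \<and> inj_on g {0..1} \<and> g ` {0..1} = C \<and> g 0 = a \<and> g 1 = b)"

definition position :: "nat \<Rightarrow> nat \<Rightarrow> real" where
  "position n k = -4 + 8 * (real k - 1/2) / real n"

(* The open region cut off by a path joining two points of a horizontal edge of the rectangle. *)
definition enclosed :: "(real \<Rightarrow> real \<times> real) \<Rightarrow> (real \<times> real) set" where
  "enclosed g = inside (path_image g \<union> closed_segment (pathstart g) (pathfinish g))"

(* The arcs a 1, ..., a r, a (r+1) of a block occupying the positions o+1, ..., o+2r+1 at
   height h: a (r+1) runs from the middle position to the point p, the others are nested
   around it and do not enclose the point q. *)
definition block_arcs ::
  "nat \<Rightarrow> nat \<Rightarrow> nat \<Rightarrow> real \<Rightarrow> real \<times> real \<Rightarrow> real \<times> real \<Rightarrow> (nat \<Rightarrow> real \<Rightarrow> real \<times> real) \<Rightarrow> bool"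
  where
  "block_arcs n r o\<^sub>b h p q a \<longleftrightarrow>
     (\<forall>k\<in>{1..r}. pathstart (a k) = (position n (o\<^sub>b + k), h) \<and>
                 pathfinish (a k) = (position n (o\<^sub>b + (2*r + 2 - k)), h)) \<and>
     pathstart (a (r + 1)) = (position n (o\<^sub>b + (r + 1)), h) \<and> pathfinish (a (r + 1)) = p \<and>
     (\<forall>k\<in>{1..r}. (\<forall>m\<in>{k<..r + 1}. path_image (a m) \<inter> {v. snd v \<noteq> h} \<subseteq> enclosed (a k)) \<and>
                 q \<notin> enclosed (a k))"

(* The m arcs of a group, occupying the positions o_F+1, ..., o_F+m on F and
   o_S+1, ..., o_S+m on S. *)
definition group_arcs ::
  "nat \<Rightarrow> nat \<Rightarrow> nat \<Rightarrow> nat \<Rightarrow> real \<Rightarrow> (nat \<Rightarrow> real \<Rightarrow> real \<times> real) \<Rightarrow> bool" where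
  "group_arcs n m o\<^sub>F o\<^sub>S \<eta> a \<longleftrightarrow>
     (\<forall>i\<in>{1..m}. pathstart (a i) = (position n (o\<^sub>F + i), -\<eta>) \<and>
                 pathfinish (a i) = (position n (o\<^sub>S + i), \<eta>))"

(* A is a set of arcs drawn in the rectangle. Apart from their end points the arcs run in the
   open rectangle, i.e. off the circles F and S. *)
definition rectangle_arcs ::
  "nat \<Rightarrow> nat \<Rightarrow> nat \<Rightarrow> int \<Rightarrow> real \<Rightarrow> (real \<Rightarrow> real \<times> real) set \<Rightarrow> bool" where
  "rectangle_arcs r s t \<epsilon> \<eta> A \<longleftrightarrow>
     (\<exists>aF aS b c. let n = 2*r + 1 + s + t; x = (1, 0); y = (-1, 0) in
        A = aF ` {1..r + 1} \<union> aS ` {1..r + 1} \<union> b ` {1..s} \<union> c ` {1..t} \<and>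
        (\<forall>g\<in>A. arc g \<and>
               path_image g - {pathstart g, pathfinish g} \<subseteq> {-4<..<4} \<times> {-\<eta><..<\<eta>}) \<and>
        pairwise (\<lambda>g h. disjnt (path_image g) (path_image h)) A \<and>
        (if \<epsilon> = 1
         then block_arcs n r 0 (-\<eta>) y x aF \<and> block_arcs n r s \<eta> x y aS \<and>
              group_arcs n s (2*r + 1) 0 \<eta> b
         else block_arcs n r s (-\<eta>) x y aF \<and> block_arcs n r 0 \<eta> y x aS \<and>
              group_arcs n s 0 (2*r + 1) \<eta> b) \<and>
        group_arcs n t (2*r + 1 + s) (2*r + 1 + s) \<eta> c)"

definition annulus_arc :: "nat \<Rightarrow> int \<Rightarrow> real \<Rightarrow> nat \<Rightarrow> (real \<times> real) set" where
  "annulus_arc n \<rho> \<eta> j =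
     closed_segment (position n j, \<eta>) (position n j - 8 * of_int \<rho> / real n, 1 - \<eta>)"

(* C is a curve determined by the 4-tuple; it depends on \<eta> and on the choice of the arcs in
   the rectangle. *)
definition determined_curve ::
  "nat \<Rightarrow> nat \<Rightarrow> nat \<Rightarrow> int \<Rightarrow> int \<Rightarrow> (real \<times> real) set \<Rightarrow> bool" where
  "determined_curve r s t \<rho> \<epsilon> C \<longleftrightarrow>
     (\<exists>\<eta> A. 0 < \<eta> \<and> \<eta> < 1/2 \<and> rectangle_arcs r s t \<epsilon> \<eta> A \<and>
        C = torus_pt ` ((\<Union>g\<in>A. path_image g) \<union>
              (\<Union>j\<in>{1..2*r + 1 + s + t}. annulus_arc (2*r + 1 + s + t) \<rho> \<eta> j)))"

end

(* Label the ends of the annulus arcs by the positions on F and S. The curve alternates between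
   annulus arcs and arcs in the rectangle, so it is described by two involutions on these ends: the
   one given by the annulus is free, and the one given by the rectangle fixes exactly the two ends
   whose arcs run to x and y. The path starting at x therefore stops only at y, and it remains to
   show that it visits every end.

   The rotation of the torus by a half turn exchanges x and y and preserves the curve up to isotopy.
   In the quotient the two involutions become reflections: the annulus gives a reflection of the
   cycle of length n, the rectangle gives the reversals of three consecutive intervals of lengths
   2r+1, s and t. Cutting the cycle open, this is a reflection system: an interval divided in two
   ways into blocks, every block being reversed. The quadruple of the algorithm encodes such a
   system, and each step of the algorithm replaces it by a system whose connectedness implies the
   connectedness of the old one, so that a return value 1 makes the original system connected. *)
theory Submission
  imports Defs
begin

section \<open>Reflection systems and the component counting algorithm\<close>

text \<open>A connected quotient need not have a connected preimage: the preimage could consist of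
  two pieces exchanged by the half turn. This is excluded because the half turn sends the free end
  at \<open>x\<close> to the free end at \<open>y\<close>, and the path from \<open>x\<close> stops
  exactly there; the path is therefore mapped to itself and is the full preimage. The quadruple of
  the theorem is not the cut cycle itself. For 0 < \<rho>' < n - t the cut gives
  \<open>(\<rho>' + t, n - \<rho>' - t, s, t)\<close>, and (\<alpha>, \<beta>, \<gamma>, \<delta>)
  is its successor under one step; for larger \<rho>' a similar division with remainder is
  transported to the other end of the cycle. Exceptional inputs shape the case analysis: \<rho>' =
  0, where the remainder is taken modulo 0, and a negative \<alpha>, which the algorithm turns into
  nonnegative entries by reversing and subtracting. The drawing must be produced explicitly. The
  arcs of a block become two sides of thin triangles, because the region enclosed is then the
  interior of a triangle, and nesting and disjointness reduce to signs of affine functions.\<close>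

definition mirror_inv :: "(int \<Rightarrow> bool) \<Rightarrow> int \<Rightarrow> int \<Rightarrow> bool" where
  "mirror_inv U l u \<longleftrightarrow> (\<forall>x. l \<le> x \<and> x \<le> u \<longrightarrow> (U (l + u - x) \<longleftrightarrow> U x))"

text \<open>The system of a quadruple \<open>(a, b, c, d)\<close>: an interval starting at 1 is divided on one side into
  blocks of lengths \<open>a, b\<close> and on the other side into blocks of lengths \<open>d, c\<close>, from left to right; the
  shorter side is completed by one more block. Every block carries its reversal.\<close>

definition compatible :: "int \<Rightarrow> int \<Rightarrow> int \<Rightarrow> int \<Rightarrow> (int \<Rightarrow> bool) \<Rightarrow> bool" where
  "compatible a b c d U \<longleftrightarrow>
     mirror_inv U 1 a \<and> mirror_inv U (a + 1) (a + b) \<and>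
     mirror_inv U 1 d \<and> mirror_inv U (d + 1) (d + c) \<and>
     mirror_inv U (min (a + b) (d + c) + 1) (max (a + b) (d + c))"

text \<open>An invariant predicate \<open>U\<close> is a union of orbits of the reversals.
  Expressing connectedness by constancy of all such \<open>U\<close> avoids counting components and
  lets a system be changed by transporting or extending predicates.\<close>

definition connected_system :: "int \<Rightarrow> int \<Rightarrow> int \<Rightarrow> int \<Rightarrow> bool" where
  "connected_system a b c d \<longleftrightarrow>
     (\<forall>U. compatible a b c d U \<longrightarrow>
        (\<forall>x\<in>{1..max (a + b) (d + c)}. \<forall>y\<in>{1..max (a + b) (d + c)}. U x \<longleftrightarrow> U y))"

lemma mirror_invD: "mirror_inv U l u \<Longrightarrow> l \<le> x \<Longrightarrow> x \<le> u \<Longrightarrow> y = l + u - x \<Longrightarrow> U y \<longleftrightarrow> U x"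
  by (simp add: mirror_inv_def)

lemma mirror_inv_cong:
  assumes "\<And>x. l \<le> x \<Longrightarrow> x \<le> u \<Longrightarrow> U x \<longleftrightarrow> V x"
  shows "mirror_inv U l u \<longleftrightarrow> mirror_inv V l u"
proof -
  have "U (l + u - x) = V (l + u - x)" "U x = V x" if "l \<le> x" "x \<le> u" for x
    using assms that by auto
  then show ?thesis unfolding mirror_inv_def by blast
qed

lemma connected_system_reverse: "connected_system a b c d \<Longrightarrow> connected_system d c b a"
  unfolding connected_system_def compatible_def
  by (simp add: min.commute max.commute)

text \<open>At the right-hand end, a block of length \<open>b\<close> starting after \<open>u\<close> on one side against the completing
  block after \<open>v\<close> on the other side may be traded for a block of length \<open>b\<close> after \<open>v\<close> against a
  completing block after \<open>u\<close>: both pairs of reversals compose to the translation by \<open>u - v\<close>.\<close>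

lemma swap_end:
  assumes 1: "mirror_inv U (u + 1) (u + b)"
    and 2: "mirror_inv U (min v (u + b) + 1) (max v (u + b))" and b: "0 \<le> b"
  obtains V where "mirror_inv V (v + 1) (v + b)"
    and "mirror_inv V (min u (v + b) + 1) (max u (v + b))"
    and "\<And>x. x \<le> max v (u + b) \<Longrightarrow> V x \<longleftrightarrow> U x"
    and "\<And>x. max u (v + b) < x \<Longrightarrow> x \<le> max v (u + b) \<Longrightarrow> U (u + v + b + 1 - x) \<longleftrightarrow> U x"
proof (cases "v \<le> u")
  case True
  have s1: "U y = U x" if "u + 1 \<le> x" "x \<le> u + b" "y = 2 * u + b + 1 - x" for x y
    using mirror_invD[OF 1, of x y] that by simp
  have s2: "U y = U x" if "v + 1 \<le> x" "x \<le> u + b" "y = u + v + b + 1 - x" for x y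
    using mirror_invD[OF 2, of x y] that True b by (simp add: min_def max_def split: if_splits)
  show ?thesis
  \<comment> \<open>For \<open>v \<le> u\<close> nothing has to be extended. The block after
    \<open>v\<close> is the image of the block after \<open>u\<close> under the completing reversal,
    and the new completing block is concentric with the old one and contained in it.\<close>
  proof (rule that[of U])
    show "mirror_inv U (v + 1) (v + b)"
      unfolding mirror_inv_def
    proof (intro allI impI)
      fix x assume x: "v + 1 \<le> x \<and> x \<le> v + b"
      have "U (u + v + b + 1 - x) = U x" using s2[of x] x True by simp
      moreover have "U (u - v + x) = U (u + v + b + 1 - x)"
        using s1[of "u + v + b + 1 - x" "u - v + x"] x True by simp
      moreover have "U (v + 1 + (v + b) - x) = U (u - v + x)"
        using s2[of "u - v + x" "v + 1 + (v + b) - x"] x True by simp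
      ultimately show "U (v + 1 + (v + b) - x) = U x" by simp
    qed
    show "mirror_inv U (min u (v + b) + 1) (max u (v + b))"
      unfolding mirror_inv_def
    proof (intro allI impI)
      fix x assume x: "min u (v + b) + 1 \<le> x \<and> x \<le> max u (v + b)"
      show "U (min u (v + b) + 1 + max u (v + b) - x) = U x"
        by (rule s2) (use x True b in \<open>auto simp: min_def max_def split: if_splits\<close>)
    qed
    show "U (u + v + b + 1 - x) \<longleftrightarrow> U x" if "max u (v + b) < x" "x \<le> max v (u + b)" for x
      by (rule s2) (use that True b in \<open>auto simp: max_def split: if_splits\<close>)
  qed auto
next
  case False
  define M where "M = max v (u + b)"
  \<comment> \<open>The old interval ends at \<open>M\<close>, the new one at \<open>v + b\<close>.
    Past \<open>M\<close> the predicate is continued by the reflection of the completing block,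
    which makes \<open>[v + 1, v + b]\<close> the mirror image of
    \<open>[u + 1, u + b]\<close>.\<close>
  define V where "V = (\<lambda>x. if x \<le> M then U x else U (u + v + b + 1 - x))"
  have s1: "U y = U x" if "u + 1 \<le> x" "x \<le> u + b" "y = 2 * u + b + 1 - x" for x y
    using mirror_invD[OF 1, of x y] that by simp
  have s2: "U y = U x" if "x \<le> M" "y \<le> M" "y = u + v + b + 1 - x" for x y
    using mirror_invD[OF 2, of x y] that False b
    by (auto simp: M_def min_def max_def split: if_splits)
  have V': "V x = U (u + v + b + 1 - x)" if "v + 1 \<le> x" for x
    unfolding V_def using s2[of x "u + v + b + 1 - x"] that b by (simp add: M_def)
  show ?thesis
  proof (rule that[of V])
    show "mirror_inv V (v + 1) (v + b)"
      unfolding mirror_inv_def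
    proof (intro allI impI)
      fix x assume x: "v + 1 \<le> x \<and> x \<le> v + b"
      show "V (v + 1 + (v + b) - x) = V x"
        using x V'[of x] V'[of "v + 1 + (v + b) - x"] s1[of "u + v + b + 1 - x" "u - v + x"]
        by (simp add: algebra_simps)
    qed
    show "mirror_inv V (min u (v + b) + 1) (max u (v + b))"
      unfolding mirror_inv_def
    proof (intro allI impI)
      fix x assume x: "min u (v + b) + 1 \<le> x \<and> x \<le> max u (v + b)"
      have e: "min u (v + b) + 1 + max u (v + b) - x = u + v + b + 1 - x" using False b by simp
      show "V (min u (v + b) + 1 + max u (v + b) - x) = V x"
        unfolding e using x False b s2[of x "u + v + b + 1 - x"]
        by (auto simp: V_def M_def)
    qed
  qed (use False b in \<open>auto simp: V_def M_def\<close>)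
qed

text \<open>Transports constancy across \<open>swap_end\<close>. \<open>P\<close> collects the
  reversals of all other blocks; it depends only on values up to the old end, so it survives the
  passage from \<open>U\<close> to the possibly extended \<open>V\<close>. If the new interval is
  shorter, the points cut off are reflected back into it.\<close>

lemma connected_system_swap:
  assumes conn: "\<And>V. \<lbrakk>mirror_inv V (v + 1) (v + b);
      mirror_inv V (min u (v + b) + 1) (max u (v + b)); P V\<rbrakk> \<Longrightarrow>
      \<forall>x\<in>{1..max u (v + b)}. \<forall>y\<in>{1..max u (v + b)}. V x \<longleftrightarrow> V y"
    and P: "\<And>V. (\<And>x. x \<le> max v (u + b) \<Longrightarrow> V x \<longleftrightarrow> U x) \<Longrightarrow> P V"
    and U: "mirror_inv U (u + 1) (u + b)"
      "mirror_inv U (min v (u + b) + 1) (max v (u + b))"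
    and pos: "0 \<le> b" "0 \<le> u" "0 \<le> v"
  shows "\<forall>x\<in>{1..max v (u + b)}. \<forall>y\<in>{1..max v (u + b)}. U x \<longleftrightarrow> U y"
proof -
  obtain V where V: "mirror_inv V (v + 1) (v + b)"
     "mirror_inv V (min u (v + b) + 1) (max u (v + b))"
     and VU: "\<And>x. x \<le> max v (u + b) \<Longrightarrow> V x \<longleftrightarrow> U x"
     and U': "\<And>x. max u (v + b) < x \<Longrightarrow> x \<le> max v (u + b) \<Longrightarrow> U (u + v + b + 1 - x) \<longleftrightarrow> U x"
    using swap_end[OF U pos(1)] by metis
  from conn[OF V P[OF VU]]
  have c: "V x = V y" if "x \<in> {1..max u (v + b)}" "y \<in> {1..max u (v + b)}" for x y
    using that by blast
  have r: "\<exists>z\<in>{1..max u (v + b)}. U x = V z" if "x \<in> {1..max v (u + b)}" for x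
  proof (cases "x \<le> max u (v + b)")
    case True
    then show ?thesis using that VU by (intro bexI[of _ x]) auto
  next
    case False
    then have "U (u + v + b + 1 - x) \<longleftrightarrow> U x" using that by (intro U') auto
    moreover have "V (u + v + b + 1 - x) = U (u + v + b + 1 - x)"
      using that False pos by (intro VU) auto
    ultimately show ?thesis using that False pos
      by (intro bexI[of _ "u + v + b + 1 - x"]) auto
  qed
  show ?thesis
  proof (intro ballI)
    fix x y assume "x \<in> {1..max v (u + b)}" "y \<in> {1..max v (u + b)}"
    then obtain x' y' where "x' \<in> {1..max u (v + b)}" "U x = V x'"
      "y' \<in> {1..max u (v + b)}" "U y = V y'" using r by meson
    then show "U x = U y" using c[of x' y'] by simp
  qed
qed

lemma periodic_mod:
  fixes U :: "int \<Rightarrow> bool"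
  assumes per: "\<And>x. 1 \<le> x \<Longrightarrow> x + D \<le> a \<Longrightarrow> U (x + D) \<longleftrightarrow> U x" and D: "0 < D"
    and "x \<in> {1..a}" "y \<in> {1..a}" "x mod D = y mod D"
  shows "U x \<longleftrightarrow> U y"
proof -
  have *: "U (x + int k * D) = U x" if "1 \<le> x" "x + int k * D \<le> a" for x k
    using that
  proof (induction k)
    case (Suc k)
    have "0 \<le> int k * D" using D by simp
    then have "U (x + int k * D + D) = U (x + int k * D)"
      using Suc.prems by (intro per) (auto simp: algebra_simps)
    then show ?case using Suc D by (simp add: algebra_simps)
  qed simp
  have **: "U y = U x" if "x \<le> y" "x \<in> {1..a}" "y \<in> {1..a}" "x mod D = y mod D" for x y
  proof -
    have "D dvd y - x" using that(4) by (metis mod_eq_dvd_iff)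
    then obtain q where q: "y - x = D * q" by blast
    with that D have "0 \<le> q" by (metis diff_ge_0_iff_ge zero_le_mult_iff not_less)
    then show ?thesis using *[of x "nat q"] q that by (simp add: algebra_simps)
  qed
  show ?thesis
  proof (cases "x \<le> y")
    case True
    then show ?thesis using **[of x y] assms by blast
  next
    case False
    then show ?thesis using **[of y x] assms by auto
  qed
qed

text \<open>The reversals of \<open>[1, a]\<close> and \<open>[1, d]\<close> compose to the
  translation by \<open>a - d\<close>. This is the source of the division with remainder in the
  algorithm.\<close>

lemma mirror_inv_periodic:
  assumes "mirror_inv U 1 a" "mirror_inv U 1 d" "0 \<le> d" "d < a"
    and "x \<in> {1..a}" "y \<in> {1..a}" "x mod (a - d) = y mod (a - d)"
  shows "U x \<longleftrightarrow> U y"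
proof (rule periodic_mod[of "a - d" a U])
  fix x assume x: "1 \<le> x" "x + (a - d) \<le> a"
  show "U (x + (a - d)) \<longleftrightarrow> U x"
    using mirror_invD[OF assms(1), of "d + 1 - x" "x + (a - d)"] mirror_invD[OF assms(2), of x "d + 1 - x"]
      x assms by auto
qed (use assms in auto)

text \<open>On a predicate of period \<open>a - d\<close> a reflection stays a symmetry when the sum
  of its end points is changed by a multiple of the period. The congruence compares
  \<open>l + 1 + u\<close> with \<open>1 + a\<close>.\<close>

lemma mirror_inv_split:
  assumes "mirror_inv U 1 a" "mirror_inv U 1 d" "0 \<le> d" "d < a"
    and "d \<le> l" "u \<le> a" "(l + u - a) mod (a - d) = 0"
  shows "mirror_inv U (l + 1) u"
  unfolding mirror_inv_def
proof (intro allI impI)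
  fix x assume x: "l + 1 \<le> x \<and> x \<le> u"
  have "U (l + 1 + u - x) = U (a + 1 - x)"
  proof (rule mirror_inv_periodic[OF assms(1-4)])
    show "(l + 1 + u - x) mod (a - d) = (a + 1 - x) mod (a - d)"
      using assms(7) by (simp add: mod_eq_dvd_iff mod_0_imp_dvd algebra_simps)
  qed (use x assms in auto)
  also have "\<dots> = U x"
    using mirror_invD[OF assms(1), of x "a + 1 - x"] x assms by simp
  finally show "U (l + 1 + u - x) = U x" .
qed

lemma mirror_inv_shift: "mirror_inv (\<lambda>x. U (x + k)) l u \<longleftrightarrow> mirror_inv U (l + k) (u + k)"
  unfolding mirror_inv_def
proof (rule iffI; intro allI impI)
  fix x assume *: "\<forall>x. l \<le> x \<and> x \<le> u \<longrightarrow> U (l + u - x + k) = U (x + k)" "l + k \<le> x \<and> x \<le> u + k"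
  then show "U (l + k + (u + k) - x) = U x" using *(1)[rule_format, of "x - k"] by (simp add: algebra_simps)
next
  fix x assume *: "\<forall>x. l + k \<le> x \<and> x \<le> u + k \<longrightarrow> U (l + k + (u + k) - x) = U x" "l \<le> x \<and> x \<le> u"
  then show "U (l + u - x + k) = U (x + k)" using *(1)[rule_format, of "x + k"] by (simp add: algebra_simps)
qed

text \<open>The end swap first moves the block \<open>b\<close> behind \<open>c\<close>. Then
  \<open>[1, d]\<close> is redundant, as periodicity carries its points into the fundamental domain
  \<open>[d + 1, a]\<close>. On that domain the long blocks induce reversals of two pieces of
  lengths \<open>a - d - b'\<close> and \<open>b'\<close>, and what remains, shifted by
  \<open>d\<close>, is the system of the successor quadruple.\<close>

lemma connected_system_step:
  assumes conn: "connected_system (a - d - b') b' b c" and b': "b' = d mod (a - d)"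
    and nonneg: "0 \<le> b" "0 \<le> c" "0 \<le> d" "d < a"
  shows "connected_system a b c d"
  unfolding connected_system_def
proof (intro allI impI)
  fix U assume U: "compatible a b c d U"
  have b'le: "0 \<le> b'" "b' < a - d" using b' nonneg by auto
  \<comment> \<open>This is where the remainder comes from: \<open>[d + 1, a - b']\<close> has the
    end-point sum of \<open>[1, a]\<close> modulo the period exactly when \<open>b'\<close> is
    congruent to \<open>d\<close>.\<close>
  have m1: "(d + (a - b') - a) mod (a - d) = 0"
  proof -
    have "d + (a - b') - a = d - d mod (a - d)" using b' by simp
    then show ?thesis by (simp only: dvd_minus_mod dvd_imp_mod_0)
  qed
  have m2: "(a - b' + a - a) mod (a - d) = 0"
  proof -
    have "a - b' + a - a = (d - b') + (a - d)" "d + (a - b') - a = d - b'" by simp_all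
    then show ?thesis using m1 by (simp only: mod_add_self2)
  qed
  have C: "V x = V y"
    if V: "mirror_inv V 1 a" "mirror_inv V (d + c + 1) (d + c + b)"
      "mirror_inv V (min a (d + c + b) + 1) (max a (d + c + b))"
      "mirror_inv V 1 d" "mirror_inv V (d + 1) (d + c)"
      and xy: "x \<in> {1..max a (d + c + b)}" "y \<in> {1..max a (d + c + b)}" for V x y
  proof -
    have e: "min (a - d - b' + b') (c + b) + 1 + d = min a (d + c + b) + 1"
      "max (a - d - b' + b') (c + b) + d = max a (d + c + b)" by auto
    have "mirror_inv V (d + 1) (a - b')"
      by (rule mirror_inv_split[OF V(1,4)]) (use nonneg b'le m1 in auto)
    moreover have "mirror_inv V (a - b' + 1) a"
      by (rule mirror_inv_split[OF V(1,4)]) (use nonneg b'le m2 in auto)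
    ultimately have comp: "compatible (a - d - b') b' b c (\<lambda>x. V (x + d))"
      using V unfolding compatible_def mirror_inv_shift e by (simp add: ac_simps)
    then have c: "V x = V y" if "x \<in> {d + 1..max a (d + c + b)}" "y \<in> {d + 1..max a (d + c + b)}" for x y
    proof -
      have "x - d \<in> {1..max (a - d - b' + b') (c + b)}" "y - d \<in> {1..max (a - d - b' + b') (c + b)}"
        using that by auto
      then have "V (x - d + d) = V (y - d + d)"
        using conn[unfolded connected_system_def, rule_format, OF comp] by blast
      then show ?thesis by simp
    qed
    have "\<exists>z\<in>{d + 1..max a (d + c + b)}. V x = V z" if "x \<in> {1..max a (d + c + b)}" for x
    proof (cases "x \<le> d")
      case True
      define z where "z = d + 1 + (x - d - 1) mod (a - d)"
      have "0 \<le> (x - d - 1) mod (a - d)" "(x - d - 1) mod (a - d) < a - d" using nonneg by simp_all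
      then have z: "d + 1 \<le> z" "z \<le> a" unfolding z_def by linarith+
      have "x mod (a - d) = z mod (a - d)" unfolding z_def by (simp only: mod_add_right_eq) simp
      then have "V x = V z"
        using True that z nonneg by (intro mirror_inv_periodic[OF V(1,4)]) auto
      then show ?thesis using z by auto
    qed (use that in auto)
    then obtain x' y' where "x' \<in> {d + 1..max a (d + c + b)}" "V x = V x'"
      "y' \<in> {d + 1..max a (d + c + b)}" "V y = V y'" using xy by meson
    then show ?thesis using c[of x' y'] by simp
  qed
  have U': "mirror_inv U (a + 1) (a + b)"
    "mirror_inv U (min (d + c) (a + b) + 1) (max (d + c) (a + b))"
    using U unfolding compatible_def min.commute[of "d + c"] max.commute[of "d + c"] by blast+
  have "\<forall>x\<in>{1..max (d + c) (a + b)}. \<forall>y\<in>{1..max (d + c) (a + b)}. U x \<longleftrightarrow> U y"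
  proof (rule connected_system_swap
      [where P = "\<lambda>V. mirror_inv V 1 a \<and> mirror_inv V 1 d \<and> mirror_inv V (d + 1) (d + c)"])
    show "mirror_inv V 1 a \<and> mirror_inv V 1 d \<and> mirror_inv V (d + 1) (d + c)"
      if "\<And>x. x \<le> max (d + c) (a + b) \<Longrightarrow> V x = U x" for V
    proof -
      have "mirror_inv V 1 a = mirror_inv U 1 a" "mirror_inv V 1 d = mirror_inv U 1 d"
        "mirror_inv V (d + 1) (d + c) = mirror_inv U (d + 1) (d + c)"
        using nonneg by (auto intro!: mirror_inv_cong that)
      then show ?thesis using U by (simp add: compatible_def)
    qed
    show "\<forall>x\<in>{1..max a (d + c + b)}. \<forall>y\<in>{1..max a (d + c + b)}. V x = V y"
      if "mirror_inv V (d + c + 1) (d + c + b)"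
        "mirror_inv V (min a (d + c + b) + 1) (max a (d + c + b))"
        "mirror_inv V 1 a \<and> mirror_inv V 1 d \<and> mirror_inv V (d + 1) (d + c)" for V
      by (intro ballI C) (use that in auto)
  qed (rule U' | use nonneg in linarith)+
  then show "\<forall>x\<in>{1..max (a + b) (d + c)}. \<forall>y\<in>{1..max (a + b) (d + c)}. U x \<longleftrightarrow> U y"
    unfolding max.commute[of "a + b"] .
qed

section \<open>Zero entries: pairs of reflections of a cycle\<close>

text \<open>Two reflections of the cycle of length \<open>N\<close> compose to the rotation by \<open>a - c\<close>.\<close>

lemma dihedral_constant:
  assumes U: "mirror_inv U 1 a" "mirror_inv U (a + 1) N" "mirror_inv U 1 c" "mirror_inv U (c + 1) N"
    and nonneg: "0 \<le> a" "a \<le> N" "0 \<le> c" "c \<le> N" and g: "gcd (a - c) N = 1"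
    and xy: "x \<in> {1..N}" "y \<in> {1..N}"
  shows "U x \<longleftrightarrow> U y"
proof -
  have N: "0 < N" using xy by simp
  define W where "W = (\<lambda>x. U (1 + (x - 1) mod N))"
  have W: "W x = U x" if "x \<in> {1..N}" for x
    using that by (simp add: W_def)
  have Wmod: "W x = W y" if "N dvd x - y" for x y
  proof -
    have "(x - 1) mod N = (y - 1) mod N" using that by (simp add: mod_eq_dvd_iff)
    then show ?thesis by (simp add: W_def)
  qed
  \<comment> \<open>Modulo \<open>N\<close> the reversals of \<open>[1, k]\<close> and of
    \<open>[k + 1, N]\<close> are given by one formula, so a division into two blocks is a single
    reflection of the cycle.\<close>
  have refl: "W (k + 1 - x) = W x"
    if k: "mirror_inv U 1 k" "mirror_inv U (k + 1) N" "0 \<le> k" "k \<le> N" for x k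
  proof -
    define z where "z = 1 + (x - 1) mod N"
    have z: "z \<in> {1..N}" 
      using pos_mod_bound[OF N, of "x - 1"] pos_mod_sign[OF N, of "x - 1"]
      unfolding z_def atLeastAtMost_iff by linarith
    have zx: "N dvd z - x"
      using dvd_minus_mod[of N "x - 1"] by (auto simp: z_def dvd_diff_commute algebra_simps)
    have "W x = W z" using zx by (intro Wmod) (simp add: dvd_diff_commute)
    moreover have "W (k + 1 - x) = W (k + 1 - z)" using zx by (intro Wmod) (simp add: algebra_simps)
    moreover have "W (k + 1 - z) = W z"
    proof (cases "z \<le> k")
      case True
      then show ?thesis
        using z k mirror_invD[OF k(1), of z "k + 1 - z"] W[of z] W[of "k + 1 - z"] by simp
    next
      case False
      have "W (k + 1 - z) = W (k + 1 + N - z)" by (intro Wmod) simp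
      then show ?thesis
        using False z k mirror_invD[OF k(2), of z "k + 1 + N - z"] W[of z] W[of "k + 1 + N - z"] by simp
    qed
    ultimately show ?thesis by simp
  qed
  have rot: "W (x + (a - c)) = W x" for x
    using refl[OF U(1,2) nonneg(1,2), of "c + 1 - x"] refl[OF U(3,4) nonneg(3,4), of x]
    by (simp add: algebra_simps)
  have rotn: "W (x + int k * (a - c)) = W x" for x k
  proof (induction k)
    case (Suc k)
    then show ?case using rot[of "x + int k * (a - c)"] by (simp add: algebra_simps)
  qed simp
  obtain m where m: "[(a - c) * m = 1] (mod N)"
    using g cong_solve_coprime_int[of "a - c" N] by (auto simp: coprime_iff_gcd_eq_1)
  have one: "W (x + 1) = W x" for x
  proof -
    define k where "k = nat (m mod N)"
    have "[int k * (a - c) = 1] (mod N)"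
      using m N by (simp add: k_def cong_def mod_mult_right_eq mult.commute)
    then have "N dvd x + 1 - (x + int k * (a - c))"
      by (auto simp: cong_iff_dvd_diff dvd_diff_commute)
    then show ?thesis using Wmod rotn by metis
  qed
  have all: "W (x + int k) = W x" for x k
  proof (induction k)
    case (Suc k)
    then show ?case using one[of "x + int k"] by (simp add: algebra_simps)
  qed simp
  have "W x = W y"
    using all[of x "nat (y - x)"] all[of y "nat (x - y)"] by (cases "x \<le> y") auto
  then show ?thesis using W xy by simp
qed

text \<open>If \<open>c \<le> a + b\<close>, both sides cut \<open>[1, a + b]\<close> into two
  blocks, so the cycle lemma applies with \<open>gcd (a - c) (a + b)\<close>, which equals the
  returned gcd because \<open>a + b = (a - c) + (b + c)\<close>. Otherwise an end swap puts
  \<open>b\<close> behind \<open>c\<close>, and the cycle has length \<open>b + c\<close>.\<close>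

lemma delete_constant:
  assumes "0 \<le> a" "0 \<le> b" "0 \<le> c" and g: "gcd \<bar>a - c\<bar> (b + c) = 1"
    and U: "mirror_inv U 1 a" "mirror_inv U (a + 1) (a + b)" "mirror_inv U 1 c"
      "mirror_inv U (min (a + b) c + 1) (max (a + b) c)"
  shows "\<forall>x\<in>{1..max (a + b) c}. \<forall>y\<in>{1..max (a + b) c}. U x \<longleftrightarrow> U y"
proof (cases "c \<le> a + b")
  case True
  have "gcd (a - c) (a + b) = 1"
  proof -
    have "a + b = (a - c) + (b + c)" by simp
    then show ?thesis using g by (simp only: gcd_add2 gcd_abs1_int)
  qed
  moreover have "max (a + b) c = a + b" "min (a + b) c = c" using True by auto
  ultimately show ?thesis
    by (intro ballI dihedral_constant[of U a "a + b" c]) (use U assms True in auto)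
next
  case False
  have U': "mirror_inv U (a + 1) (a + b)"
    "mirror_inv U (min c (a + b) + 1) (max c (a + b))"
    using U unfolding min.commute[of c] max.commute[of c] by blast+
  have "\<forall>x\<in>{1..max c (a + b)}. \<forall>y\<in>{1..max c (a + b)}. U x \<longleftrightarrow> U y"
  proof (rule connected_system_swap[where P = "\<lambda>V. mirror_inv V 1 a \<and> mirror_inv V 1 c"])
    fix V assume V: "mirror_inv V (c + 1) (c + b)"
      "mirror_inv V (min a (c + b) + 1) (max a (c + b))" "mirror_inv V 1 a \<and> mirror_inv V 1 c"
    have "gcd (a - c) (c + b) = 1" using g by (simp add: add.commute)
    then show "\<forall>x\<in>{1..max a (c + b)}. \<forall>y\<in>{1..max a (c + b)}. V x = V y"
    proof (intro ballI)
      fix x y assume xy: "x \<in> {1..max a (c + b)}" "y \<in> {1..max a (c + b)}"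
      have e: "max a (c + b) = c + b" "min a (c + b) = a" using False assms by auto
      show "V x = V y"
        by (rule dihedral_constant[of V a "c + b" c])
          (use V(1,3) V(2)[unfolded e] xy[unfolded e] False assms \<open>gcd (a - c) (c + b) = 1\<close> in auto)
    qed
  next
    fix V assume "\<And>x. x \<le> max c (a + b) \<Longrightarrow> V x = U x"
    then show "mirror_inv V 1 a \<and> mirror_inv V 1 c"
      using U(1,3) assms mirror_inv_cong[of 1 c V U] mirror_inv_cong[of 1 a V U] by simp
  qed (rule U' | use assms in linarith)+
  then show ?thesis unfolding max.commute[of "a + b"] .
qed

lemma connected_system_delete:
  assumes "0 \<le> a" "0 \<le> b" "0 \<le> c" and "gcd \<bar>a - c\<bar> (b + c) = 1"
  shows "connected_system a b c 0" and "connected_system a b 0 c"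
  unfolding connected_system_def compatible_def add_0_left add_0_right
  using delete_constant[OF assms] by blast+

text \<open>Induction along the run of the algorithm, keeping all entries nonnegative. Only one
  direction is proved: a return value 1 yields connectedness.\<close>

lemma component_count_connected:
  assumes "component_count a b c d k" "k = 1" "0 \<le> a" "0 \<le> b" "0 \<le> c" "0 \<le> d"
  shows "connected_system a b c d"
  using assms
proof induction
  case (delete1 b c d)
  \<comment> \<open>The reversed triple \<open>(d, c, b)\<close> calls for the gcd with
    \<open>c + b\<close> instead of \<open>c + d\<close>; the two sums differ by the other argument
    of the gcd.\<close>
  have e: "c + d = (d - b) + (c + b)" by simp
  from delete1(1) have "gcd \<bar>d - b\<bar> (c + b) = 1"
    unfolding e by (simp only: gcd_add2 gcd_abs1_int abs_minus_commute[of b d])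
  then show ?case
    using connected_system_reverse[OF connected_system_delete(1)[of d c b]] delete1 by simp
next
  case (delete2 a c d)
  have e: "c + d = (d - a) + (c + a)" by simp
  from delete2(1) have "gcd \<bar>d - a\<bar> (c + a) = 1"
    unfolding e by (simp only: gcd_add2 gcd_abs1_int abs_minus_commute[of a d])
  then show ?case
    using connected_system_reverse[OF connected_system_delete(2)[of d c a]] delete2 by simp
next
  case (delete3 a b d)
  then show ?case by (intro connected_system_delete) simp_all
next
  case (delete4 a b c)
  then show ?case by (intro connected_system_delete) simp_all
next
  case (reverse a b c d k)
  then have "connected_system d c b a" by blast
  then show ?case by (rule connected_system_reverse)
next
  case (equal a b c d)
  \<comment> \<open>With positive \<open>a\<close> and a positive gcd this branch returns at least
    2, so it cannot occur.\<close>
  then have "0 < gcd b c" "0 < a" by auto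
  then show ?case using equal by linarith
next
  case (step a b c d b' k)
  then have "0 \<le> d mod (a - d)" "d mod (a - d) < a - d" by simp_all
  then have "connected_system (a - d - b') b' b c"
    using step.IH step.prems step.hyps(3) by (metis diff_ge_0_iff_ge less_imp_le)
  then show ?case
    by (rule connected_system_step[OF _ step.hyps(3)]) (use step in auto)
qed

section \<open>Alternating walks\<close>

definition walk :: "('v \<Rightarrow> 'v) \<Rightarrow> ('v \<Rightarrow> 'v) \<Rightarrow> 'v \<Rightarrow> nat \<Rightarrow> 'v" where
  "walk A P v i = ((\<lambda>x. P (A x)) ^^ i) v"

lemma walk_0 [simp]: "walk A P v 0 = v"
  and walk_Suc [simp]: "walk A P v (Suc i) = P (A (walk A P v i))"
  by (simp_all add: walk_def)

text \<open>Since \<open>A\<close> is free and \<open>P\<close> fixes only \<open>v0\<close> and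
  \<open>v1\<close>, the orbit of \<open>v0\<close> is a path that can stop only at
  \<open>v1\<close>. The map \<open>\<sigma>\<close> commutes with both involutions and sends the
  start to the end, so the orbit is closed under \<open>\<sigma>\<close> as well; this is why
  \<open>conn\<close> may be restricted to sets closed under all three maps.\<close>

lemma alternating_walk:
  fixes A P \<sigma> :: "'v \<Rightarrow> 'v"
  defines "u \<equiv> walk A P"
  assumes fin: "finite V"
    and A: "\<And>v. v \<in> V \<Longrightarrow> A v \<in> V \<and> A (A v) = v \<and> A v \<noteq> v"
    and P: "\<And>v. v \<in> V \<Longrightarrow> P v \<in> V \<and> P (P v) = v"
    and fixed: "\<And>v. v \<in> V \<Longrightarrow> P v = v \<longleftrightarrow> v = v0 \<or> v = v1"
    and v0: "v0 \<in> V"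
    and \<sigma>: "\<And>v. v \<in> V \<Longrightarrow> \<sigma> (A v) = A (\<sigma> v) \<and> \<sigma> (P v) = P (\<sigma> v)" "\<sigma> v0 = v1"
    and conn: "\<And>K. \<lbrakk>K \<subseteq> V; v0 \<in> K; \<And>v. v \<in> K \<Longrightarrow> A v \<in> K \<and> P v \<in> K \<and> \<sigma> v \<in> K\<rbrakk> \<Longrightarrow> K = V"
  obtains l where "A (u v0 l) = v1" "inj_on (u v0) {..l}"
    "\<And>i j. i \<le> l \<Longrightarrow> j \<le> l \<Longrightarrow> u v0 i \<noteq> A (u v0 j)"
    "V = u v0 ` {..l} \<union> (A \<circ> u v0) ` {..l}"
proof -
  let ?u = "u v0"
  have u0: "?u 0 = v0" and uS: "?u (Suc i) = P (A (?u i))" for i by (simp_all add: u_def)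
  have uV: "?u i \<in> V" for i
    by (induction i) (use v0 A P u0 uS in auto)
  have distinct: "inj_on ?u {..l} \<and> (\<forall>i\<le>l. \<forall>j\<le>l. ?u i \<noteq> A (?u j))"
    if "\<forall>i<l. P (A (?u i)) \<noteq> A (?u i)" for l
    using that
  proof (induction l)
    case 0
    then show ?case using A[OF uV[of 0]] by auto
  next
    case (Suc l)
    then have inj: "inj_on ?u {..l}" by auto
    have ne: "?u i \<noteq> A (?u j)" if "i \<le> l" "j \<le> l" for i j
      using Suc that by auto
    \<comment> \<open>A repetition could be traced back by one step on both sides, contradicting
      injectivity so far. At \<open>i = 0\<close> there is no earlier step, but there
      \<open>P\<close> fixes \<open>v0\<close>, so \<open>A (?u l)\<close> would already be
      \<open>v0\<close>.\<close>
    have new: "?u (Suc l) \<noteq> ?u i" if "i \<le> l" for i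
    proof
      assume eq: "?u (Suc l) = ?u i"
      then have w: "A (?u l) = P (?u i)" using P A uV uS by metis
      show False
      proof (cases i)
        case 0
        then show False using w fixed[OF v0] u0 ne[of 0 l] by simp
      next
        case (Suc k)
        then have "A (?u l) = A (?u k)" using w P A uV uS by metis
        then have "?u l = ?u k" using A uV by metis
        then show False using inj_onD[OF inj, of l k] that Suc by simp
      qed
    qed
    have newA: "?u (Suc l) \<noteq> A (?u j)" if "j \<le> l" for j
    proof
      assume eq: "?u (Suc l) = A (?u j)"
      show False
      proof (cases "j = l")
        case True
        then show False using eq Suc.prems uS by auto
      next
        case False
        have "?u (Suc j) = A (?u l)" using eq P A uV uS by metis
        then show False using ne[of "Suc j" l] that False by simp
      qed
    qed
    have newA': "?u i \<noteq> A (?u (Suc l))" if "i \<le> Suc l" for i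
    proof (cases "i = Suc l")
      case True
      then show ?thesis using A uV by metis
    next
      case False
      then show ?thesis using newA[of i] A uV that by (metis le_SucE)
    qed
    have "?u (Suc l) \<notin> ?u ` {..l}" using new by auto
    then have "inj_on ?u {..Suc l}" using inj by (simp add: atMost_Suc inj_on_insert)
    then show ?case using ne newA newA' by (metis le_SucE)
  qed
  have "\<exists>l. P (A (?u l)) = A (?u l)"
  proof (rule ccontr)
    assume no: "\<nexists>l. P (A (?u l)) = A (?u l)"
    have "inj ?u"
    proof (rule injI)
      fix i j assume "?u i = ?u j"
      then show "i = j" using distinct[of "max i j"] no by (auto simp: inj_on_def)
    qed
    then have "infinite (range ?u)" by (simp add: finite_image_iff)
    then show False using fin uV finite_subset[of "range ?u" V] by auto
  qed
  then obtain l where l: "P (A (?u l)) = A (?u l)" "\<forall>i<l. P (A (?u i)) \<noteq> A (?u i)"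
    using exists_least_iff[of "\<lambda>l. P (A (?u l)) = A (?u l)"] by auto
  note d = distinct[OF l(2)]
  \<comment> \<open>The walk stops at a fixed point of \<open>P\<close>; it is not
    \<open>v0 = ?u 0\<close>, since no \<open>?u i\<close> equals any
    \<open>A (?u j)\<close>.\<close>
  have Al: "A (?u l) = v1"
    using fixed[of "A (?u l)"] l(1) A[OF uV] d u0 by (metis le0 order_refl)
  define K where "K = ?u ` {..l} \<union> (A \<circ> ?u) ` {..l}"
  have inK: "?u i \<in> K" "A (?u i) \<in> K" if "i \<le> l" for i using that by (auto simp: K_def)
  have KV: "K \<subseteq> V" using uV A by (auto simp: K_def)
  have KA: "A v \<in> K" if "v \<in> K" for v
    using that A[OF uV] by (auto simp: K_def)
  have KP: "P v \<in> K" if v: "v \<in> K" for v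
  proof -
    consider i where "i \<le> l" "v = ?u i" | i where "i \<le> l" "v = A (?u i)"
      using v by (auto simp: K_def)
    then show ?thesis
    proof cases
      case 1
      show ?thesis
      proof (cases i)
        case 0
        then show ?thesis using 1 fixed[OF v0] u0 inK by metis
      next
        case (Suc k)
        then have "P v = A (?u k)" using 1 P A uV uS by metis
        then show ?thesis using 1 Suc inK by simp
      qed
    next
      case 2
      show ?thesis
      proof (cases "i = l")
        case True
        then show ?thesis using 2 l inK by simp
      next
        case False
        then show ?thesis using 2 uS[of i] inK(1)[of "Suc i"] by simp
      qed
    qed
  qed
  \<comment> \<open>The image of the walk is the walk from \<open>v1\<close>. It starts in
    \<open>K\<close> because \<open>v1\<close> is the last vertex reached, and \<open>K\<close> is
    closed under \<open>A\<close> and \<open>P\<close>.\<close>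
  have \<sigma>K: "\<sigma> (?u i) \<in> K \<and> \<sigma> (A (?u i)) \<in> K" for i
  proof (induction i)
    case 0
    have "v1 \<in> K" using Al inK(2)[of l] by simp
    then show ?case using \<sigma>(1)[OF uV[of 0]] \<sigma>(2) u0 KA by simp
  next
    case (Suc i)
    then have "\<sigma> (?u (Suc i)) \<in> K" using \<sigma>(1)[of "A (?u i)"] A[OF uV] uS KP by simp
    then show ?case using \<sigma>(1)[OF uV[of "Suc i"]] KA by simp
  qed
  have "K = V"
  proof (rule conn[OF KV])
    show "v0 \<in> K" using u0 inK(1)[of 0] by simp
    show "A v \<in> K \<and> P v \<in> K \<and> \<sigma> v \<in> K" if "v \<in> K" for v
      using that KA KP \<sigma>K by (auto simp: K_def)
  qed
  then show ?thesis using that[of l] Al d by (auto simp: K_def)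
qed

section \<open>From the cut cycle to the quadruple of the theorem\<close>

lemma connected_systemD:
  "connected_system a b c d \<Longrightarrow> compatible a b c d U \<Longrightarrow>
    1 \<le> x \<Longrightarrow> x \<le> max (a + b) (d + c) \<Longrightarrow> 1 \<le> y \<Longrightarrow> y \<le> max (a + b) (d + c) \<Longrightarrow> U x \<longleftrightarrow> U y"
  unfolding connected_system_def by (meson atLeastAtMost_iff)

text \<open>A negative first entry leaves few rules: deletion of a zero \<open>b\<close> or
  \<open>s\<close>, where the gcd is rewritten into that of the asserted system, or reversal
  followed by one step, which arrives at \<open>(p, s, c, b)\<close> with all entries
  nonnegative.\<close>

lemma component_count_negative:
  assumes "component_count (- p) b c s 1" "0 < p" "0 \<le> b" "0 < c" "0 \<le> s"
  shows "connected_system p s c b"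
  using assms(1)
proof cases
  case delete2
  have "p - c = (p + s) - (c + s)" by simp
  then have "gcd (p - c) (s + c) = gcd (p + s) (c + s)"
    by (simp only: gcd_diff1 add.commute[of s c])
  also have "\<dots> = gcd (- (p + s)) (c + s)" by (simp only: gcd_neg1_int)
  also have "\<dots> = 1" using delete2 by (simp add: algebra_simps)
  finally show ?thesis
    using connected_system_delete(1)[of p s c] assms delete2 by (simp only: gcd_abs1_int less_imp_le)
next
  case delete4
  have "b - p = (b + c) - (c + p)" by simp
  then have "gcd (b - p) (c + p) = gcd (b + c) (c + p)" by (simp only: gcd_diff1)
  also have "\<dots> = gcd (- p - c) (b + c)" by (metis add.commute gcd.commute gcd_neg1_int minus_diff_eq diff_minus_eq_add)
  also have "\<dots> = 1" using delete4 by simp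
  finally show ?thesis
    using connected_system_reverse[OF connected_system_delete(2)[of b c p]] assms delete4
    by (simp only: gcd_abs1_int less_imp_le)
next
  case reverse
  \<comment> \<open>After the reversal to \<open>(s, c, b, - p)\<close> the difference is
    \<open>s + p\<close>, and the remainder of the negative last entry is \<open>s\<close>; hence
    the first new entry is \<open>s + p - s = p\<close>.\<close>
  have [simp]: "- p mod (s + p) = s"
    using mod_add_self2[of "- p" "s + p"] assms by simp
  from reverse(3) show ?thesis
  proof cases
    case (step d')
    then have "component_count p s c b 1" by simp
    then show ?thesis using component_count_connected assms by simp
  qed (use assms reverse in auto)
qed (use assms in auto)

text \<open>\<open>per\<close> and \<open>rot\<close> describe the annulus reflection on the cycle,
  the three mirror assumptions the rectangle. The cycle is cut in front of the block of length
  \<open>t\<close>; whether the fixed point sum \<open>\<rho> + t\<close> stays below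
  \<open>n\<close> decides between the two definitions of the quadruple.\<close>

lemma dihedral_system_constant:
  fixes U :: "int \<Rightarrow> bool" and n s t \<rho> \<alpha> \<beta> \<gamma> \<delta> :: int
  assumes n: "s + t < n" "0 \<le> s" "0 \<le> t" and \<rho>: "0 \<le> \<rho>" "\<rho> < n"
    and low: "\<rho> < n - t \<Longrightarrow> \<beta> = t mod \<rho> \<and> \<alpha> = \<rho> - \<beta> \<and> \<gamma> = n - \<rho> - t \<and> \<delta> = s"
    and high: "n - t \<le> \<rho> \<Longrightarrow> \<beta> = t mod (n - \<rho>) \<and> \<alpha> = \<rho> - t \<and> \<gamma> = n - \<rho> - \<beta> \<and> \<delta> = s"
    and count: "component_count \<alpha> \<beta> \<gamma> \<delta> 1"
    and per: "\<And>x. U (x + n) \<longleftrightarrow> U x" and rot: "\<And>x. U (\<rho> + t + 1 - x) \<longleftrightarrow> U x"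
    and mt: "mirror_inv U 1 t" and ms: "mirror_inv U (t + 1) (t + s)"
    and me: "mirror_inv U (t + s + 1) n"
    and xy: "x \<in> {1..n}" "y \<in> {1..n}"
  shows "U x \<longleftrightarrow> U y"
proof (cases "\<rho> < n - t")
  case True
  have m1: "mirror_inv U 1 (\<rho> + t)"
    using rot by (simp add: mirror_inv_def algebra_simps)
  have "U (\<rho> + t + 1 + n - x) \<longleftrightarrow> U x" for x
    using per[of "\<rho> + t + 1 - x"] rot[of x] by (simp add: algebra_simps)
  then have m2: "mirror_inv U (\<rho> + t + 1) n" by (simp add: mirror_inv_def)
  have comp: "compatible (\<rho> + t) (n - \<rho> - t) s t U"
    using m1 m2 mt ms me n by (simp add: compatible_def)
  \<comment> \<open>If \<open>\<rho>\<close> is nonzero, the given quadruple is the successor of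
    this one: the difference is \<open>(\<rho> + t) - t = \<rho>\<close> and the remainder is
    \<open>t mod \<rho>\<close>.\<close>
  have "connected_system (\<rho> + t) (n - \<rho> - t) s t"
  proof (cases "\<rho> = 0")
    case False
    then have "0 < \<rho>" using \<rho> by simp
    with low[OF True] n True have v: "\<alpha> = \<rho> + t - t - \<beta>" "\<beta> = t mod (\<rho> + t - t)" "\<gamma> = n - \<rho> - t"
      "\<delta> = s" "0 \<le> \<beta>" "\<beta> < \<rho>" by simp_all
    then have "connected_system \<alpha> \<beta> \<gamma> \<delta>"
      using component_count_connected[OF count refl] n True by simp
    then show ?thesis
      unfolding v(1,3,4) by (rule connected_system_step) (use v(2) n True \<open>0 < \<rho>\<close> in auto)
  next
    \<comment> \<open>No step leads to the given quadruple here: with \<open>t mod 0 = t\<close> it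
      is \<open>(- t, t, n - t, s)\<close>.\<close>
    case \<rho>0: True
    show ?thesis
    proof (cases "t = 0")
      case t0: True
      have mm: "min s n = s" "max s n = n" "min n s = s" "max n s = n" using n by auto
      \<comment> \<open>For \<open>t = 0\<close> the given system and the required one,
        \<open>(0, n, s, 0)\<close>, differ by moving the block \<open>n\<close> in front of
        \<open>s\<close>, an end swap.\<close>
      have conn0: "connected_system 0 0 n s"
        using component_count_connected[OF count refl] low[OF True] \<rho>0 t0 n by simp
      have triv: "mirror_inv V 1 0" for V by (auto simp: mirror_inv_def)
      have old: "V x = V y" if "mirror_inv V (s + 1) (s + n)"
        "mirror_inv V 1 (s + n)" "mirror_inv V 1 s" "x \<in> {1..s + n}" "y \<in> {1..s + n}" for V x y
        by (rule connected_systemD[OF conn0])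
          (use that n triv in \<open>simp_all add: compatible_def\<close>)
      have "connected_system 0 n s 0"
        unfolding connected_system_def
      proof (intro allI impI)
        fix V assume V: "compatible 0 n s 0 V"
        have "\<forall>x\<in>{1..max s (0 + n)}. \<forall>y\<in>{1..max s (0 + n)}. V x \<longleftrightarrow> V y"
        proof (rule connected_system_swap[where P = "\<lambda>V. mirror_inv V 1 s"])
          fix W assume W: "mirror_inv W (s + 1) (s + n)"
            "mirror_inv W (min 0 (s + n) + 1) (max 0 (s + n))" "mirror_inv W 1 s"
          then have "mirror_inv W 1 (s + n)" using n by simp
          then show "\<forall>x\<in>{1..max 0 (s + n)}. \<forall>y\<in>{1..max 0 (s + n)}. W x \<longleftrightarrow> W y"
            using W n by (intro ballI old) auto
        next
          fix W assume "\<And>x. x \<le> max s (0 + n) \<Longrightarrow> W x \<longleftrightarrow> V x"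
          then show "mirror_inv W 1 s"
            using V mirror_inv_cong[of 1 s W V] mm by (simp add: compatible_def)
        qed (use V n mm in \<open>simp_all add: compatible_def\<close>)
        then show "\<forall>x\<in>{1..max (0 + n) (0 + s)}. \<forall>y\<in>{1..max (0 + n) (0 + s)}. V x \<longleftrightarrow> V y"
          unfolding add_0_left mm .
      qed
      then show ?thesis using \<rho>0 t0 by simp
    next
      case False
      \<comment> \<open>This case is contradictory: a return value 1 would make a system connected
        in which the predicate \<open>x \<le> t\<close> is invariant.\<close>
      then have "connected_system t s (n - t) t"
        using low[OF True] \<rho>0 n count by (intro component_count_negative) auto
      moreover have "compatible t s (n - t) t (\<lambda>x. x \<le> t)"
        using n False by (auto simp: compatible_def mirror_inv_def)
      ultimately have "1 \<le> t \<longleftrightarrow> t + 1 \<le> t"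
        by (rule connected_systemD) (use n False in auto)
      then show ?thesis using False n by simp
    qed
  qed
  then show ?thesis using comp by (rule connected_systemD) (use xy n in auto)
next
  case False
  \<comment> \<open>Modulo \<open>n\<close> the annulus reflection sends \<open>x\<close> to
    \<open>b + 1 - x\<close>, so it reverses \<open>[1, b]\<close> and \<open>[b + 1, n]\<close>.
    Together with the reversal of \<open>[1, t]\<close> this gives the period
    \<open>D = t - b\<close> on \<open>[1, t]\<close>.\<close>
  define D where "D = n - \<rho>"
  define b where "b = \<rho> + t - n"
  have D: "0 < D" "D = t - b" and b: "0 \<le> b" "b < t" using False \<rho> unfolding D_def b_def by linarith+
  have \<beta>: "\<beta> = t mod D" "0 \<le> \<beta>" "\<beta> < D" and \<alpha>: "\<alpha> = \<rho> - t" and \<gamma>: "\<gamma> = D - \<beta>" and \<delta>: "\<delta> = s"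
    using high[OF leI[OF False]] pos_mod_sign[OF D(1), of t] pos_mod_bound[OF D(1), of t]
    unfolding D_def by metis+
  have R: "U z = U x" if "z + x = b + 1 + n \<or> z + x = b + 1" for x z
  proof -
    have "\<rho> + t + 1 - x = z \<or> \<rho> + t + 1 - x = z + n" using that by (auto simp: b_def)
    then show ?thesis using rot[of x] per[of z] by metis
  qed
  have m1: "mirror_inv U 1 b" unfolding mirror_inv_def by (intro allI impI R) simp
  \<comment> \<open>Conjugation with the reversal of \<open>[b + 1, n]\<close> carries
    \<open>[b + 1, t]\<close> onto \<open>[\<rho> + 1, n]\<close>; the two pieces of one period
    reappear at the right-hand end in opposite order.\<close>
  have conj: "mirror_inv U (b + n + 1 - u) (b + n + 1 - l)" if "mirror_inv U l u" for l u
    unfolding mirror_inv_def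
  proof (intro allI impI)
    fix x assume x: "b + n + 1 - u \<le> x \<and> x \<le> b + n + 1 - l"
    have "U (b + n + 1 - u + (b + n + 1 - l) - x) = U (l + u - (b + n + 1 - x))" by (rule R) simp
    also have "\<dots> = U (b + n + 1 - x)" by (rule mirror_invD[OF that]) (use x in auto)
    also have "\<dots> = U x" by (rule R) simp
    finally show "U (b + n + 1 - u + (b + n + 1 - l) - x) = U x" .
  qed
  have d1: "D dvd t - \<beta>" by (simp add: \<beta>(1) dvd_minus_mod)
  have "b - \<beta> = (t - \<beta>) - D" using D by simp
  then have d2: "D dvd b - \<beta>" using d1 by (metis dvd_diff dvd_refl)
  have "mirror_inv U (b + 1) (b + (D - \<beta>))"
    by (rule mirror_inv_split[OF mt m1]) (use b D(2) \<beta>(2,3) d2 in auto)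
  then have g1: "mirror_inv U (\<rho> + \<beta> + 1) n"
    using conj[of "b + 1" "b + (D - \<beta>)"] by (simp add: D_def algebra_simps)
  have "mirror_inv U (b + (D - \<beta>) + 1) t"
    by (rule mirror_inv_split[OF mt m1]) (use b D(2) \<beta>(2,3) d1 in auto)
  then have g2: "mirror_inv U (\<rho> + 1) (\<rho> + \<beta>)"
    using conj[of "b + (D - \<beta>) + 1" t] by (simp add: D_def b_def algebra_simps)
  have g3: "mirror_inv U (min t \<rho> + 1) (max t \<rho>)"
    unfolding mirror_inv_def by (intro allI impI R) (simp add: b_def min_def max_def)
  \<comment> \<open>Beyond \<open>min t \<rho>\<close> the reversals form a complete system. For
    \<open>t \<le> \<rho>\<close> it is the given one up to an end swap of the block
    \<open>\<gamma>\<close>; for \<open>\<rho> < t\<close> the entry \<open>\<alpha>\<close> is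
    negative and the system is the one produced by \<open>component_count_negative\<close>.\<close>
  have last: "U x = U y" if xy: "x \<in> {min t \<rho> + 1..n}" "y \<in> {min t \<rho> + 1..n}" for x y
  proof (cases "t \<le> \<rho>")
    case True
    define W where "W = (\<lambda>x. U (x + t))"
    have eqs: "max s (\<alpha> + \<beta> + \<gamma>) = \<alpha> + \<beta> + \<gamma>" "min s (\<alpha> + \<beta> + \<gamma>) = s"
      "\<alpha> + t = \<rho>" "\<alpha> + 1 + t = \<rho> + 1" "\<alpha> + \<beta> + t = \<rho> + \<beta>" "\<alpha> + \<beta> + 1 + t = \<rho> + \<beta> + 1"
      "\<alpha> + \<beta> + \<gamma> + t = n" "1 + t = t + 1" "s + t = t + s" "s + 1 + t = t + s + 1"
      using \<alpha> \<gamma> n by (auto simp: D_def)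
    have "connected_system \<alpha> \<beta> \<gamma> s"
      using component_count_connected[OF count refl] \<alpha> \<beta> \<gamma> \<delta> True n by simp
    have "\<forall>x\<in>{1..max s (\<alpha> + \<beta> + \<gamma>)}. \<forall>y\<in>{1..max s (\<alpha> + \<beta> + \<gamma>)}. W x \<longleftrightarrow> W y"
    proof (rule connected_system_swap
        [where P = "\<lambda>V. mirror_inv V 1 \<alpha> \<and> mirror_inv V (\<alpha> + 1) (\<alpha> + \<beta>) \<and> mirror_inv V 1 s"])
      fix V assume V: "mirror_inv V (s + 1) (s + \<gamma>)"
        "mirror_inv V (min (\<alpha> + \<beta>) (s + \<gamma>) + 1) (max (\<alpha> + \<beta>) (s + \<gamma>))"
        "mirror_inv V 1 \<alpha> \<and> mirror_inv V (\<alpha> + 1) (\<alpha> + \<beta>) \<and> mirror_inv V 1 s"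
      then have "compatible \<alpha> \<beta> \<gamma> s V" by (simp add: compatible_def)
      with \<open>connected_system \<alpha> \<beta> \<gamma> s\<close>
      show "\<forall>x\<in>{1..max (\<alpha> + \<beta>) (s + \<gamma>)}. \<forall>y\<in>{1..max (\<alpha> + \<beta>) (s + \<gamma>)}. V x \<longleftrightarrow> V y"
        unfolding connected_system_def by blast
    next
      fix V assume VW: "\<And>x. x \<le> max s (\<alpha> + \<beta> + \<gamma>) \<Longrightarrow> V x \<longleftrightarrow> W x"
      have "mirror_inv W 1 \<alpha>" "mirror_inv W (\<alpha> + 1) (\<alpha> + \<beta>)" "mirror_inv W 1 s"
        unfolding W_def mirror_inv_shift eqs using g2 g3 ms True by simp_all
      moreover have "mirror_inv V 1 \<alpha> = mirror_inv W 1 \<alpha>"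
        "mirror_inv V (\<alpha> + 1) (\<alpha> + \<beta>) = mirror_inv W (\<alpha> + 1) (\<alpha> + \<beta>)" "mirror_inv V 1 s = mirror_inv W 1 s"
        by (rule mirror_inv_cong, rule VW, use \<beta> \<gamma> in simp)+
      ultimately show "mirror_inv V 1 \<alpha> \<and> mirror_inv V (\<alpha> + 1) (\<alpha> + \<beta>) \<and> mirror_inv V 1 s" by simp
    next
      show "mirror_inv W (\<alpha> + \<beta> + 1) (\<alpha> + \<beta> + \<gamma>)"
        unfolding W_def mirror_inv_shift eqs by (rule g1)
      show "mirror_inv W (min s (\<alpha> + \<beta> + \<gamma>) + 1) (max s (\<alpha> + \<beta> + \<gamma>))"
        unfolding W_def mirror_inv_shift eqs by (rule me)
    qed (use \<alpha> \<beta> \<gamma> True n in auto)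
    moreover have "x - t \<in> {1..max s (\<alpha> + \<beta> + \<gamma>)}" "y - t \<in> {1..max s (\<alpha> + \<beta> + \<gamma>)}"
      using xy True \<alpha> \<gamma> by (auto simp: D_def)
    ultimately have "W (x - t) = W (y - t)" by blast
    then show ?thesis by (simp add: W_def)
  next
    case neg: False
    have "connected_system (t - \<rho>) s (D - \<beta>) \<beta>"
      using count \<beta> \<alpha> \<gamma> \<delta> n neg by (intro component_count_negative) auto
    moreover have "compatible (t - \<rho>) s (D - \<beta>) \<beta> (\<lambda>x. U (x + \<rho>))"
    proof -
      have eqs: "min (t - \<rho> + s) (\<beta> + (D - \<beta>)) = t - \<rho> + s" "max (t - \<rho> + s) (\<beta> + (D - \<beta>)) = D"
        "1 + \<rho> = \<rho> + 1" "t - \<rho> + \<rho> = t" "t - \<rho> + 1 + \<rho> = t + 1" "t - \<rho> + s + \<rho> = t + s"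
        "\<beta> + \<rho> = \<rho> + \<beta>" "\<beta> + 1 + \<rho> = \<rho> + \<beta> + 1" "\<beta> + (D - \<beta>) + \<rho> = n"
        "t - \<rho> + s + 1 + \<rho> = t + s + 1" "D + \<rho> = n" "min t \<rho> = \<rho>" "max t \<rho> = t"
        using n neg by (auto simp: D_def)
      show ?thesis
        using g1 g2 g3 ms me unfolding compatible_def mirror_inv_shift eqs by blast
    qed
    ultimately have "U (x - \<rho> + \<rho>) = U (y - \<rho> + \<rho>)"
      by (rule connected_systemD) (use xy neg n in \<open>auto simp: D_def\<close>)
    then show ?thesis by simp
  qed
  \<comment> \<open>A point up to \<open>t\<close> is moved by the period into
    \<open>[b + 1, t]\<close>, then by the annulus reflection into
    \<open>[\<rho> + 1, n]\<close>.\<close>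
  have "\<exists>z\<in>{min t \<rho> + 1..n}. U x = U z" if x: "x \<in> {1..n}" for x
  proof (cases "x \<le> t")
    case True
    define z where "z = b + 1 + (x - b - 1) mod D"
    have "0 \<le> (x - b - 1) mod D" "(x - b - 1) mod D < D" using D by simp_all
    then have z: "b + 1 \<le> z" "z \<le> t" unfolding z_def using D by linarith+
    have "x mod D = z mod D" unfolding z_def by (simp only: mod_add_right_eq) simp
    then have "U x = U z"
      using mirror_inv_periodic[OF mt m1 b, of x z] True x z b D by auto
    also have "\<dots> = U (b + 1 + n - z)" by (rule R) simp
    finally show ?thesis
      using z by (intro bexI[of _ "b + 1 + n - z"]) (auto simp: b_def)
  qed (use x in auto)
  then obtain x' y' where "x' \<in> {min t \<rho> + 1..n}" "U x = U x'" "y' \<in> {min t \<rho> + 1..n}" "U y = U y'"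
    using xy by meson
  then show ?thesis using last[of x' y'] by simp
qed

section \<open>The pieces of the curve\<close>

definition wrap :: "int \<Rightarrow> int \<Rightarrow> int" where
  "wrap n x = 1 + (x - 1) mod n"

text \<open>The vertex \<open>(k, False)\<close> is the position \<open>k\<close> on the circle whose order is block, \<open>s\<close>-group,
  \<open>t\<close>-group (this is \<open>F\<close> if \<open>\<epsilon> = 1\<close> and \<open>S\<close> if \<open>\<epsilon> = -1\<close>), and \<open>(k, True)\<close> is the position \<open>k\<close> on the
  other circle. In both cases the arc at the middle of the block runs to \<open>y\<close> on the first circle and to
  \<open>x\<close> on the second.\<close>

definition annulus_map :: "int \<Rightarrow> int \<Rightarrow> int \<times> bool \<Rightarrow> int \<times> bool" where
  "annulus_map n \<rho> = (\<lambda>(k, b). (wrap n (if b then k - \<rho> else k + \<rho>), \<not> b))"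

definition rect_map :: "int \<Rightarrow> int \<Rightarrow> int \<times> bool \<Rightarrow> int \<times> bool" where
  "rect_map e s = (\<lambda>(k, b).
     if b then (if k \<le> s then (k + e, False) else if k \<le> s + e then (2 * s + e + 1 - k, True) else (k, False))
     else (if k \<le> e then (e + 1 - k, False) else if k \<le> e + s then (k - e, True) else (k, True)))"

text \<open>The symmetry of the picture under the rotation of the torus by a half turn.\<close>

definition deck_map :: "int \<Rightarrow> int \<Rightarrow> int \<Rightarrow> int \<times> bool \<Rightarrow> int \<times> bool" where
  "deck_map n e s = (\<lambda>(k, b). (wrap n (s + e + 1 - k), \<not> b))"

lemma wrap_range: "0 < n \<Longrightarrow> 1 \<le> wrap n x \<and> wrap n x \<le> n"
  using pos_mod_sign[of n "x - 1"] pos_mod_bound[of n "x - 1"] unfolding wrap_def by linarith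

lemma wrap_id: "1 \<le> x \<Longrightarrow> x \<le> n \<Longrightarrow> wrap n x = x"
  by (simp add: wrap_def)

lemma wrap_eq_iff: "wrap n x = wrap n y \<longleftrightarrow> n dvd x - y"
  by (simp add: wrap_def mod_eq_dvd_iff)

lemma wrap_dvd: "n dvd wrap n x - x"
proof -
  have "n dvd (x - 1) - (x - 1) mod n" by (rule dvd_minus_mod)
  then show ?thesis by (simp add: wrap_def dvd_diff_commute algebra_simps)
qed

lemma wrap_wrap: "wrap n (wrap n x + y) = wrap n (x + y)" "wrap n (wrap n x - y) = wrap n (x - y)"
  "wrap n (y + wrap n x) = wrap n (y + x)" "wrap n (y - wrap n x) = wrap n (y - x)"
  using wrap_dvd[of n x] by (simp_all add: wrap_eq_iff dvd_diff_commute)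

text \<open>A set closed under the half turn is determined by its trace \<open>W\<close> on one
  circle. On this trace, the annulus followed by the half turn is a reflection of the cycle, and the
  arcs of the two groups, which cross to the other circle, turn into reversals of intervals.\<close>

lemma rect_annulus_connected:
  fixes K :: "(int \<times> bool) set" and r s t \<rho> \<alpha> \<beta> \<gamma> \<delta> :: int
  defines "e \<equiv> 2 * r + 1" and "n \<equiv> 2 * r + 1 + s + t"
  defines "V \<equiv> {1..n} \<times> (UNIV :: bool set)"
  assumes nonneg: "0 \<le> r" "0 \<le> s" "0 \<le> t" and \<rho>: "0 \<le> \<rho>" "\<rho> < n"
    and low: "\<rho> < n - t \<Longrightarrow> \<beta> = t mod \<rho> \<and> \<alpha> = \<rho> - \<beta> \<and> \<gamma> = n - \<rho> - t \<and> \<delta> = s"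
    and high: "n - t \<le> \<rho> \<Longrightarrow> \<beta> = t mod (n - \<rho>) \<and> \<alpha> = \<rho> - t \<and> \<gamma> = n - \<rho> - \<beta> \<and> \<delta> = s"
    and count: "component_count \<alpha> \<beta> \<gamma> \<delta> 1"
    and K: "K \<subseteq> V" "K \<noteq> {}"
      "\<And>v. v \<in> K \<Longrightarrow> annulus_map n \<rho> v \<in> K \<and> rect_map e s v \<in> K \<and> deck_map n e s v \<in> K"
  shows "K = V"
proof -
  have n: "0 < n" using nonneg by (simp add: n_def)
  define W where "W k \<longleftrightarrow> (wrap n k, False) \<in> K" for k
  have W_wrap: "W k \<longleftrightarrow> W l" if "n dvd k - l" for k l
    using that by (simp add: W_def wrap_eq_iff[symmetric])
  have deck: "(wrap n k, True) \<in> K \<longleftrightarrow> W (s + e + 1 - k)" for k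
    using K(3)[of "(wrap n k, True)"] K(3)[of "(wrap n (s + e + 1 - k), False)"]
    by (auto simp: deck_map_def W_def wrap_wrap)
  have ann: "W k \<longleftrightarrow> (wrap n (k + \<rho>), True) \<in> K" for k
    using K(3)[of "(wrap n k, False)"] K(3)[of "(wrap n (k + \<rho>), True)"]
    by (auto simp: annulus_map_def W_def wrap_wrap)
  have rot: "W k \<longleftrightarrow> W (s + e + 1 - \<rho> - k)" for k
    using ann[of k] deck[of "k + \<rho>"] by (simp add: algebra_simps)
  have We: "W k \<longleftrightarrow> W (e + 1 - k)" if "1 \<le> k" "k \<le> e" for k
    using K(3)[of "(k, False)"] K(3)[of "(e + 1 - k, False)"] that nonneg
    by (auto simp: rect_map_def W_def wrap_id e_def n_def)
  have Ws: "W k \<longleftrightarrow> W (2 * e + s + 1 - k)" if "e + 1 \<le> k" "k \<le> e + s" for k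
  proof -
    have "W k \<longleftrightarrow> (wrap n (k - e), True) \<in> K"
      using K(3)[of "(k, False)"] K(3)[of "(k - e, True)"] that nonneg
      by (auto simp: rect_map_def W_def wrap_id e_def n_def)
    then show ?thesis using deck[of "k - e"] by (simp add: algebra_simps)
  qed
  have Wt: "W k \<longleftrightarrow> W (s + e + 1 + n - k)" if "e + s + 1 \<le> k" "k \<le> n" for k
  proof -
    have "W k \<longleftrightarrow> (wrap n k, True) \<in> K"
      using K(3)[of "(k, False)"] K(3)[of "(k, True)"] that nonneg
      by (auto simp: rect_map_def W_def wrap_id e_def n_def)
    also have "\<dots> \<longleftrightarrow> W (s + e + 1 + n - k)" unfolding deck by (rule W_wrap) simp
    finally show ?thesis .
  qed
  \<comment> \<open>The cycle is read backwards, because the blocks are expected in the order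
    \<open>t\<close>, \<open>s\<close>, \<open>2 * r + 1\<close>.\<close>
  have const: "W (n + 1 - x) \<longleftrightarrow> W (n + 1 - y)" if "x \<in> {1..n}" "y \<in> {1..n}" for x y
  proof (rule dihedral_system_constant[where U = "\<lambda>x. W (n + 1 - x)", OF _ nonneg(2,3) \<rho> low high count])
    show "s + t < n" using nonneg by (simp add: n_def)
    show "W (n + 1 - (x + n)) \<longleftrightarrow> W (n + 1 - x)" for x by (rule W_wrap) simp
    show "W (n + 1 - (\<rho> + t + 1 - x)) \<longleftrightarrow> W (n + 1 - x)" for x
    proof -
      have 1: "W (n + 1 - (\<rho> + t + 1 - x)) \<longleftrightarrow> W (s + e + 1 - \<rho> - (n + 1 - (\<rho> + t + 1 - x)))" by (rule rot)
      have "s + e + 1 - \<rho> - (n + 1 - (\<rho> + t + 1 - x)) - (n + 1 - x) = - n"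
        by (simp add: e_def n_def)
      then have "W (s + e + 1 - \<rho> - (n + 1 - (\<rho> + t + 1 - x))) \<longleftrightarrow> W (n + 1 - x)"
        by (intro W_wrap) simp
      with 1 show ?thesis by blast
    qed
    show "mirror_inv (\<lambda>x. W (n + 1 - x)) 1 t"
      unfolding mirror_inv_def
    proof (intro allI impI)
      fix x assume x: "1 \<le> x \<and> x \<le> t"
      have eq: "s + e + 1 + n - (n + 1 - x) = n + 1 - (1 + t - x)" by (simp add: e_def n_def)
      have "W (n + 1 - x) \<longleftrightarrow> W (s + e + 1 + n - (n + 1 - x))"
        by (rule Wt) (use x nonneg in \<open>auto simp: e_def n_def\<close>)
      then show "W (n + 1 - (1 + t - x)) = W (n + 1 - x)" unfolding eq by simp
    qed
    show "mirror_inv (\<lambda>x. W (n + 1 - x)) (t + 1) (t + s)"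
      unfolding mirror_inv_def
    proof (intro allI impI)
      fix x assume x: "t + 1 \<le> x \<and> x \<le> t + s"
      have eq: "2 * e + s + 1 - (n + 1 - x) = n + 1 - (t + 1 + (t + s) - x)" by (simp add: e_def n_def)
      have "W (n + 1 - x) \<longleftrightarrow> W (2 * e + s + 1 - (n + 1 - x))"
        by (rule Ws) (use x nonneg in \<open>auto simp: e_def n_def\<close>)
      then show "W (n + 1 - (t + 1 + (t + s) - x)) = W (n + 1 - x)" unfolding eq by simp
    qed
    show "mirror_inv (\<lambda>x. W (n + 1 - x)) (t + s + 1) n"
      unfolding mirror_inv_def
    proof (intro allI impI)
      fix x assume x: "t + s + 1 \<le> x \<and> x \<le> n"
      have eq: "e + 1 - (n + 1 - x) = n + 1 - (t + s + 1 + n - x)" by (simp add: e_def n_def)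
      have "W (n + 1 - x) \<longleftrightarrow> W (e + 1 - (n + 1 - x))"
        by (rule We) (use x nonneg in \<open>auto simp: e_def n_def\<close>)
      then show "W (n + 1 - (t + s + 1 + n - x)) = W (n + 1 - x)" unfolding eq by simp
    qed
  qed (use that in auto)
  have const': "W x \<longleftrightarrow> W y" for x y
  proof -
    have 1: "W z \<longleftrightarrow> W (n + 1 - (n + 1 - wrap n z))" for z
      using W_wrap[of z "wrap n z"] wrap_dvd[of n z] by (simp add: dvd_diff_commute)
    show ?thesis
      using const[of "n + 1 - wrap n x" "n + 1 - wrap n y"] 1[of x] 1[of y]
        wrap_range[OF n, of x] wrap_range[OF n, of y] by auto
  qed
  obtain k b where kb: "(k, b) \<in> K" using K(2) by fastforce
  then have "1 \<le> k" "k \<le> n" using K(1) by (auto simp: V_def)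
  then have "\<exists>x. W x" using deck[of k] W_def[of k] kb by (cases b) (auto simp: wrap_id)
  then have "W x" for x using const' by blast
  then have "(k, b) \<in> K" if "1 \<le> k" "k \<le> n" for k b
    using that deck[of k] W_def[of k] by (cases b) (auto simp: wrap_id)
  then show ?thesis using K(1) by (auto simp: V_def)
qed

lemma annulus_map_props:
  assumes "0 < n" "v \<in> {1..n} \<times> UNIV"
  shows "annulus_map n \<rho> v \<in> {1..n} \<times> UNIV" and "annulus_map n \<rho> (annulus_map n \<rho> v) = v"
proof -
  obtain k b where kb: "v = (k, b)" "1 \<le> k" "k \<le> n" using assms(2) by (metis SigmaE atLeastAtMost_iff)
  then show "annulus_map n \<rho> v \<in> {1..n} \<times> UNIV" "annulus_map n \<rho> (annulus_map n \<rho> v) = v"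
    using wrap_range[OF assms(1)] by (simp_all add: annulus_map_def wrap_wrap wrap_id)
qed

text \<open>The block length \<open>2 * r + 1\<close> is odd, so each block reversal fixes exactly
  its middle position; the groups change the circle and contribute no fixed point.\<close>

lemma rect_map_props:
  fixes r s t :: int
  defines "P \<equiv> rect_map (2 * r + 1) s" and "V \<equiv> {1..2 * r + 1 + s + t} \<times> (UNIV :: bool set)"
  assumes nonneg: "0 \<le> r" "0 \<le> s" "0 \<le> t" and v: "v \<in> V"
  shows "P v \<in> V" and "P (P v) = v" and "P v = v \<longleftrightarrow> v = (s + r + 1, True) \<or> v = (r + 1, False)"
proof -
  define e where "e = 2 * r + 1"
  obtain k b where kb: "v = (k, b)" "1 \<le> k" "k \<le> e + s + t"
    using v unfolding V_def e_def by (metis SigmaE atLeastAtMost_iff)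
  have V: "V = {1..e + s + t} \<times> UNIV" and P: "P = rect_map e s" by (simp_all add: V_def P_def e_def)
  have e: "1 \<le> e" using nonneg by (simp add: e_def)
  consider "b" "k \<le> s" | "b" "s < k" "k \<le> s + e" | "b" "s + e < k"
    | "\<not> b" "k \<le> e" | "\<not> b" "e < k" "k \<le> e + s" | "\<not> b" "e + s < k" by linarith
  then have "P v \<in> V \<and> P (P v) = v" unfolding P V
    by cases (use kb e nonneg in \<open>simp_all add: rect_map_def\<close>)
  then show "P v \<in> V" "P (P v) = v" by auto
  have "2 * s + e + 1 - k = k \<longleftrightarrow> k = s + r + 1" "e + 1 - k = k \<longleftrightarrow> k = r + 1"
    by (auto simp: e_def)
  moreover have "s < s + r + 1" "s + r + 1 \<le> s + e" "r + 1 \<le> e" using nonneg by (auto simp: e_def)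
  ultimately show "P v = v \<longleftrightarrow> v = (s + r + 1, True) \<or> v = (r + 1, False)"
    unfolding P kb rect_map_def by auto
qed

lemma curve_walk:
  fixes r s t \<rho> \<alpha> \<beta> \<gamma> \<delta> :: int
  defines "e \<equiv> 2 * r + 1" and "n \<equiv> 2 * r + 1 + s + t"
  defines "u \<equiv> walk (annulus_map n \<rho>) (rect_map e s) (s + r + 1, True)"
  assumes nonneg: "0 \<le> r" "0 \<le> s" "0 \<le> t" and \<rho>: "0 \<le> \<rho>" "\<rho> < n"
    and low: "\<rho> < n - t \<Longrightarrow> \<beta> = t mod \<rho> \<and> \<alpha> = \<rho> - \<beta> \<and> \<gamma> = n - \<rho> - t \<and> \<delta> = s"
    and high: "n - t \<le> \<rho> \<Longrightarrow> \<beta> = t mod (n - \<rho>) \<and> \<alpha> = \<rho> - t \<and> \<gamma> = n - \<rho> - \<beta> \<and> \<delta> = s"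
    and count: "component_count \<alpha> \<beta> \<gamma> \<delta> 1"
  obtains l where "annulus_map n \<rho> (u l) = (r + 1, False)" "inj_on u {..l}"
    "\<And>i j. i \<le> l \<Longrightarrow> j \<le> l \<Longrightarrow> u i \<noteq> annulus_map n \<rho> (u j)"
    "{1..n} \<times> UNIV = u ` {..l} \<union> (annulus_map n \<rho> \<circ> u) ` {..l}"
proof -
  have n: "0 < n" and es: "1 \<le> e" "0 \<le> s" "s + e \<le> n" using nonneg by (simp_all add: n_def e_def)
  let ?V = "{1..n} \<times> (UNIV :: bool set)"
  show ?thesis
  proof (rule alternating_walk[of ?V "annulus_map n \<rho>" "rect_map e s" "(s + r + 1, True)"
        "(r + 1, False)" "deck_map n e s"])
    show "finite ?V" by simp
    show "annulus_map n \<rho> v \<in> ?V \<and> annulus_map n \<rho> (annulus_map n \<rho> v) = v \<and> annulus_map n \<rho> v \<noteq> v"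
      if "v \<in> ?V" for v
      using annulus_map_props[OF n that] by (cases v) (simp add: annulus_map_def)
    show "rect_map e s v \<in> ?V \<and> rect_map e s (rect_map e s v) = v" if "v \<in> ?V" for v
      using rect_map_props(1,2)[OF nonneg that[unfolded n_def]] unfolding e_def n_def by blast
    show "rect_map e s v = v \<longleftrightarrow> v = (s + r + 1, True) \<or> v = (r + 1, False)" if "v \<in> ?V" for v
      using rect_map_props(3)[OF nonneg that[unfolded n_def]] unfolding e_def .
    show "(s + r + 1, True) \<in> ?V" using nonneg by (simp add: n_def)
    show "deck_map n e s (annulus_map n \<rho> v) = annulus_map n \<rho> (deck_map n e s v) \<and>
      deck_map n e s (rect_map e s v) = rect_map e s (deck_map n e s v)" if v: "v \<in> ?V" for v
    proof
      obtain k b where kb: "v = (k, b)" "1 \<le> k" "k \<le> n" using v by (metis SigmaE atLeastAtMost_iff)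
      show "deck_map n e s (annulus_map n \<rho> v) = annulus_map n \<rho> (deck_map n e s v)"
        by (simp add: kb deck_map_def annulus_map_def wrap_wrap algebra_simps)
      have w1: "wrap n (s + e + 1 - k) = s + e + 1 - k" if "k \<le> s + e"
        using that kb nonneg by (intro wrap_id) (auto simp: e_def n_def)
      \<comment> \<open>A position of the \<open>t\<close>-group is reflected to a number below 1
        and re-enters from above, again in the \<open>t\<close>-group.\<close>
      have w2: "wrap n (s + e + 1 - k) = s + e + 1 + n - k" if "s + e < k"
      proof -
        have "wrap n (s + e + 1 - k) = wrap n (s + e + 1 + n - k)"
          by (simp add: wrap_eq_iff)
        also have "\<dots> = s + e + 1 + n - k"
          using that kb nonneg by (intro wrap_id) (auto simp: e_def n_def)
        finally show ?thesis .
      qed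
      have w3: "wrap n x = x" if "1 \<le> x" "x \<le> s + e" for x
        using that nonneg by (intro wrap_id) (auto simp: e_def n_def)
      consider "k \<le> s + e" "b" "k \<le> s" | "k \<le> s + e" "b" "s < k" | "k \<le> s + e" "\<not> b" "k \<le> e"
        | "k \<le> s + e" "\<not> b" "e < k" | "s + e < k" by linarith
      then show "deck_map n e s (rect_map e s v) = rect_map e s (deck_map n e s v)"
      proof cases
        case 5
        then show ?thesis using kb es w2 by (simp add: deck_map_def rect_map_def)
      qed (use kb es in \<open>simp_all add: deck_map_def rect_map_def w1 w3\<close>)
    qed
    show "deck_map n e s (s + r + 1, True) = (r + 1, False)"
      using nonneg by (simp add: deck_map_def e_def wrap_id n_def)
    show "K = ?V" if "K \<subseteq> ?V" "(s + r + 1, True) \<in> K"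
      "\<And>v. v \<in> K \<Longrightarrow> annulus_map n \<rho> v \<in> K \<and> rect_map e s v \<in> K \<and> deck_map n e s v \<in> K" for K
      unfolding n_def
      by (rule rect_annulus_connected[OF nonneg \<rho>[unfolded n_def] low[unfolded n_def] high[unfolded n_def] count])
        (use that in \<open>auto simp: n_def e_def\<close>)
  qed (use that in \<open>auto simp: u_def\<close>)
qed

section \<open>Simple arcs on the torus\<close>

lemma simple_arc_in_join:
  assumes C: "simple_arc_in X C a b" and D: "simple_arc_in X D b c" and CD: "C \<inter> D \<subseteq> {b}"
  shows "simple_arc_in X (C \<union> D) a c"
proof -
  let ?T01 = "top_of_set {0..1::real}"
  obtain g1 where g1: "continuous_map ?T01 X g1" "inj_on g1 {0..1}" "g1 ` {0..1} = C" "g1 0 = a" "g1 1 = b"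
    using C by (auto simp: simple_arc_in_def pathin_def)
  obtain g2 where g2: "continuous_map ?T01 X g2" "inj_on g2 {0..1}" "g2 ` {0..1} = D" "g2 0 = b" "g2 1 = c"
    using D by (auto simp: simple_arc_in_def pathin_def)
  define h where "h = (\<lambda>x. if x \<le> 1/2 then (g1 \<circ> (\<lambda>t. 2 * t)) x else (g2 \<circ> (\<lambda>t. 2 * t - 1)) x)"
  have "continuous_map (subtopology euclideanreal {0..1}) X h"
    unfolding h_def
  proof (intro continuous_map_cases_le continuous_map_compose, force, force)
    show "continuous_map (subtopology ?T01 {x \<in> topspace ?T01. x \<le> 1/2}) ?T01 ((*) 2)"
      by (auto simp: continuous_map_in_subtopology continuous_map_from_subtopology)
    have "continuous_map
           (subtopology (top_of_set {0..1}) {x. 0 \<le> x \<and> x \<le> 1 \<and> 1 \<le> x * 2})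
           euclideanreal (\<lambda>t. 2 * t - 1)"
      by (intro continuous_intros) (force intro: continuous_map_from_subtopology)
    then show "continuous_map (subtopology ?T01 {x \<in> topspace ?T01. 1/2 \<le> x}) ?T01 (\<lambda>t. 2 * t - 1)"
      by (force simp: continuous_map_in_subtopology)
    show "(g1 \<circ> (*) 2) x = (g2 \<circ> (\<lambda>t. 2 * t - 1)) x" if "x = 1/2" for x
      by (simp only: that comp_apply) (simp add: g1 g2)
  qed (auto simp: g1 g2)
  moreover have "inj_on h {0..1}"
  proof (rule linorder_inj_onI)
    fix x y :: real assume xy: "x < y" "x \<in> {0..1}" "y \<in> {0..1}"
    show "h x \<noteq> h y"
    proof
      assume eq: "h x = h y"
      consider "y \<le> 1/2" | "1/2 < x" | "x \<le> 1/2" "1/2 < y" by linarith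
      then show False
      proof cases
        case 1
        then have "g1 (2 * x) = g1 (2 * y)" using eq xy by (simp add: h_def)
        then show False using inj_onD[OF g1(2), of "2 * x" "2 * y"] xy 1 by auto
      next
        case 2
        then have "g2 (2 * x - 1) = g2 (2 * y - 1)" using eq xy by (simp add: h_def)
        then show False using inj_onD[OF g2(2), of "2 * x - 1" "2 * y - 1"] xy 2 by auto
      next
        case 3
        then have e: "g1 (2 * x) = g2 (2 * y - 1)" using eq xy by (simp add: h_def)
        moreover have "g1 (2 * x) \<in> C" "g2 (2 * y - 1) \<in> D"
          using 3 xy unfolding g1(3)[symmetric] g2(3)[symmetric] by auto
        ultimately have "g2 (2 * y - 1) = g2 0" using CD g2(4) by auto
        then show False using inj_onD[OF g2(2), of "2 * y - 1" 0] 3 xy by auto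
      qed
    qed
  qed auto
  moreover have "h ` {0..1} = C \<union> D"
  proof -
    have "h ` {0..1} = h ` {0..1/2} \<union> h ` {1/2..1}"
      by (metis image_Un ivl_disj_un_two_touch(4) atLeastAtMost_iff half_bounded_equal zero_le_divide_1_iff
          zero_le_numeral divide_le_eq_1_pos one_le_numeral zero_less_numeral)
    also have "h ` {0..1/2} = g1 ` (\<lambda>t. 2 * t) ` {0..1/2}"
      unfolding image_comp by (rule image_cong) (auto simp: h_def)
    also have "(\<lambda>t. 2 * t) ` {0..1/2} = {0..1::real}" by simp
    also have "h ` {1/2..1} = g2 ` (\<lambda>t. 2 * t - 1) ` {1/2..1}"
      unfolding image_comp
    proof (rule image_cong[OF refl])
      fix x :: real assume "x \<in> {1/2..1}"
      then show "h x = (g2 \<circ> (\<lambda>t. 2 * t - 1)) x"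
      proof (cases "x = 1/2")
        case True
        show ?thesis unfolding True by (simp add: h_def g1 g2)
      qed (auto simp: h_def)
    qed
    also have "(\<lambda>t. 2 * t - 1) ` {1/2..1} = {0..1::real}"
      using image_affinity_atLeastAtMost_diff[of 2 1 "1/2" "1::real"] by simp
    finally show ?thesis using g1 g2 by simp
  qed
  moreover have "h 0 = a" "h 1 = c" by (simp_all add: h_def g1 g2)
  ultimately show ?thesis unfolding simple_arc_in_def pathin_def by blast
qed

lemma simple_arc_in_sym:
  assumes "simple_arc_in X C a b"
  shows "simple_arc_in X C b a"
proof -
  obtain g where g: "pathin X g" "inj_on g {0..1}" "g ` {0..1} = C" "g 0 = a" "g 1 = b"
    using assms by (auto simp: simple_arc_in_def)
  have im: "(\<lambda>t. 1 - t) ` {0..1} = {0..1::real}" by simp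
  have "pathin X (g \<circ> (\<lambda>t. 1 - t))"
    unfolding pathin_def
  proof (rule continuous_map_compose)
    show "continuous_map (top_of_set {0..1}) (top_of_set {0..1::real}) (\<lambda>t. 1 - t)"
      by (auto simp: continuous_on_op_minus)
  qed (use g in \<open>simp add: pathin_def\<close>)
  moreover have "inj_on (g \<circ> (\<lambda>t. 1 - t)) {0..1}"
  proof (rule comp_inj_on)
    show "inj_on g ((\<lambda>t. 1 - t) ` {0..1})" unfolding im by (rule g(2))
  qed (simp add: inj_on_def)
  moreover have "(g \<circ> (\<lambda>t. 1 - t)) ` {0..1} = C"
    by (simp only: image_comp[symmetric] im g)
  ultimately show ?thesis
    unfolding simple_arc_in_def using g by (intro exI[of _ "g \<circ> (\<lambda>t. 1 - t)"]) auto
qed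

lemma simple_arc_in_chain:
  assumes arcs: "\<And>i. i \<le> N \<Longrightarrow> simple_arc_in X (E i) (p i) (p (Suc i))"
    and disj: "\<And>i. i < N \<Longrightarrow> E i \<inter> E (Suc i) \<subseteq> {p (Suc i)}"
    and disj': "\<And>i j. j \<le> N \<Longrightarrow> Suc i < j \<Longrightarrow> E i \<inter> E j = {}"
  shows "simple_arc_in X (\<Union>i\<le>N. E i) (p 0) (p (Suc N))"
  using assms
proof (induction N)
  case 0
  then show ?case by simp
next
  case (Suc N)
  have "simple_arc_in X ((\<Union>i\<le>N. E i) \<union> E (Suc N)) (p 0) (p (Suc (Suc N)))"
  proof (rule simple_arc_in_join)
    show "simple_arc_in X (\<Union>i\<le>N. E i) (p 0) (p (Suc N))" using Suc by simp
    show "simple_arc_in X (E (Suc N)) (p (Suc N)) (p (Suc (Suc N)))" using Suc.prems(1) by simp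
    show "(\<Union>i\<le>N. E i) \<inter> E (Suc N) \<subseteq> {p (Suc N)}"
    proof -
      have "E i \<inter> E (Suc N) \<subseteq> {p (Suc N)}" if "i \<le> N" for i
        using Suc.prems(2)[of N] Suc.prems(3)[of "Suc N" i] that by (cases "i = N") auto
      then show ?thesis by blast
    qed
  qed
  then show ?case by (simp add: atMost_Suc Un_commute)
qed

section \<open>The projection of the plane to the torus\<close>

lemma circ_pt_id: "-4 \<le> w \<Longrightarrow> w < 4 \<Longrightarrow> circ_pt w = w"
proof -
  assume "-4 \<le> w" "w < 4"
  then have "\<lfloor>(w + 4) / 8\<rfloor> = 0" by (simp add: floor_eq_iff)
  then show ?thesis by (simp add: circ_pt_def)
qed

lemma circ_pt_shift: "circ_pt (w + 8 * of_int k) = circ_pt w"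
proof -
  have "(w + 8 * of_int k + 4) / 8 = (w + 4) / 8 + of_int k" by (simp add: field_simps)
  then have "\<lfloor>(w + 8 * of_int k + 4) / 8\<rfloor> = \<lfloor>(w + 4) / 8\<rfloor> + k"
    by (simp only: floor_add_int)
  then show ?thesis by (simp add: circ_pt_def algebra_simps)
qed

lemma circ_pt_range: "-4 \<le> circ_pt w" "circ_pt w < 4"
proof -
  show "-4 \<le> circ_pt w"
    using of_int_floor_le[of "(w + 4) / 8"] by (simp add: circ_pt_def field_simps)
  show "circ_pt w < 4"
    using floor_correct[of "(w + 4) / 8"] by (simp add: circ_pt_def field_simps)
qed

lemma circ_pt_eq_iff: "circ_pt v = circ_pt w \<longleftrightarrow> (\<exists>k. v - w = 8 * of_int k)"
proof
  assume "circ_pt v = circ_pt w"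
  then have "v - w = 8 * of_int (\<lfloor>(v + 4) / 8\<rfloor> - \<lfloor>(w + 4) / 8\<rfloor>)" by (simp add: circ_pt_def)
  then show "\<exists>k. v - w = 8 * of_int k" by blast
next
  assume "\<exists>k. v - w = 8 * of_int k"
  then obtain k where "v = w + 8 * of_int k" by (auto simp: algebra_simps)
  then show "circ_pt v = circ_pt w" by (simp only: circ_pt_shift)
qed

lemma circ_pt_decomp: obtains k where "w = circ_pt w + 8 * of_int k"
  by (rule that[of "\<lfloor>(w + 4) / 8\<rfloor>"]) (simp add: circ_pt_def)

text \<open>The topology of the circle is given only through \<open>[-4, 4]\<close>. By periodicity
  it suffices to look at \<open>-4 \<le> w < 4\<close>, and only \<open>w = -4\<close> is delicate:
  a neighbourhood there is pasted from one-sided neighbourhoods of -4 and of 4.\<close>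

lemma continuous_map_circ_pt: "continuous_map euclideanreal circle circ_pt"
  unfolding continuous_map_def
proof (intro conjI allI impI)
  show "circ_pt \<in> topspace euclideanreal \<rightarrow> topspace circle"
  proof
    fix w :: real
    have "circ_pt (circ_pt w) = circ_pt w" using circ_pt_range circ_pt_id by blast
    then show "circ_pt w \<in> topspace circle"
      using circ_pt_range[of w] by (auto simp: circle_def topspace_quotient_by intro!: image_eqI[of _ _ "circ_pt w"])
  qed
  fix U assume "openin circle U"
  then have "openin (top_of_set {-4..4}) {p \<in> {-4..4}. circ_pt p \<in> U}"
    by (simp add: circle_def openin_quotient_by)
  then obtain T where T: "open T" "{p \<in> {-4..4}. circ_pt p \<in> U} = {-4..4} \<inter> T"
    by (auto simp: openin_open)
  have T': "p \<in> T \<longleftrightarrow> circ_pt p \<in> U" if "-4 \<le> p" "p \<le> 4" for p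
    using T(2) that by (metis (mono_tags, lifting) IntE IntI atLeastAtMost_iff mem_Collect_eq)
  have near: "\<exists>e>0. \<forall>x. \<bar>x - w\<bar> < e \<longrightarrow> circ_pt x \<in> U"
    if w: "-4 \<le> w" "w < 4" "circ_pt w \<in> U" for w
  proof -
    have "w \<in> T" using T' w by simp
    then obtain e1 where e1: "e1 > 0" "\<And>x. \<bar>x - w\<bar> < e1 \<Longrightarrow> x \<in> T"
      using T(1) unfolding open_dist by (auto simp: dist_real_def)
    show ?thesis
    proof (cases "w = -4")
      case False
      have "circ_pt x \<in> U" if "\<bar>x - w\<bar> < min e1 (min (w + 4) (4 - w))" for x
      proof -
        have "x \<in> T" "-4 \<le> x" "x \<le> 4" using that e1 by auto
        then show ?thesis using T' by blast
      qed
      then show ?thesis using e1 w False by (intro exI[of _ "min e1 (min (w + 4) (4 - w))"]) auto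
    next
      case True
      have "circ_pt 4 = circ_pt (-4)" using circ_pt_shift[of "-4" 1] by simp
      then have "4 \<in> T" using T' w True by simp
      then obtain e2 where e2: "e2 > 0" "\<And>x. \<bar>x - 4\<bar> < e2 \<Longrightarrow> x \<in> T"
        using T(1) unfolding open_dist by (auto simp: dist_real_def)
      have "circ_pt x \<in> U" if "\<bar>x - w\<bar> < min e1 (min e2 1)" for x
      proof (cases "-4 \<le> x")
        case True
        then have "x \<in> T" "-4 \<le> x" "x \<le> 4" using that e1 w \<open>w = -4\<close> by auto
        then show ?thesis using T' by blast
      next
        case False
        then have "x + 8 \<in> T" "-4 \<le> x + 8" "x + 8 \<le> 4" using that e2 w \<open>w = -4\<close> by auto
        then have "circ_pt (x + 8) \<in> U" using T' by blast
        then show ?thesis using circ_pt_shift[of x 1] by simp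
      qed
      then show ?thesis using e1 e2 by (intro exI[of _ "min e1 (min e2 1)"]) auto
    qed
  qed
  have "open {x. circ_pt x \<in> U}"
    unfolding open_dist
  proof
    fix w assume "w \<in> {x. circ_pt x \<in> U}"
    obtain k where k: "w = circ_pt w + 8 * of_int k" by (rule circ_pt_decomp)
    have "circ_pt (circ_pt w) = circ_pt w" using circ_pt_range circ_pt_id by blast
    then obtain e where e: "e > 0" "\<And>x. \<bar>x - circ_pt w\<bar> < e \<Longrightarrow> circ_pt x \<in> U"
      using near[of "circ_pt w"] circ_pt_range[of w] \<open>w \<in> _\<close> by auto
    have "circ_pt x \<in> U" if "\<bar>x - w\<bar> < e" for x
    proof -
      have "circ_pt (x + 8 * of_int (- k)) \<in> U" using that k by (intro e(2)) (simp add: algebra_simps)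
      then show ?thesis by (simp only: circ_pt_shift)
    qed
    then show "\<exists>e>0. \<forall>y. dist y w < e \<longrightarrow> y \<in> {x. circ_pt x \<in> U}"
      using e(1) by (auto simp: dist_real_def)
  qed
  then show "openin euclideanreal {x \<in> topspace euclideanreal. circ_pt x \<in> U}" by simp
qed

text \<open>Although \<open>frac\<close> jumps at integers, on a closed strip of height 1 the map is
  a vertical translation into \<open>[0, 1]\<close> followed by the quotient map, which identifies
  the top with the bottom.\<close>

lemma continuous_map_torus_pt_strip:
  "continuous_map (top_of_set (UNIV \<times> {of_int k..of_int k + 1})) torus torus_pt"
proof -
  let ?S = "UNIV \<times> {of_int k..of_int k + 1} :: (real \<times> real) set"
  have "continuous_map (top_of_set ?S) (prod_topology circle (top_of_set {0..1}))
      (\<lambda>p. ((circ_pt \<circ> fst) p, snd p - of_int k))"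
  proof (intro continuous_map_pairedI continuous_map_compose)
    show "continuous_map (top_of_set ?S) euclideanreal fst" by (simp add: continuous_on_fst)
    show "continuous_map (top_of_set ?S) (top_of_set {0..1}) (\<lambda>p. snd p - of_int k)"
      by (auto intro!: continuous_intros)
  qed (rule continuous_map_circ_pt)
  then have "continuous_map (top_of_set ?S) torus
      ((\<lambda>(w, z). (w, frac z)) \<circ> (\<lambda>p. ((circ_pt \<circ> fst) p, snd p - of_int k)))"
    unfolding torus_def
    by (rule continuous_map_compose) (rule quotient_imp_continuous_map[OF quotient_map_quotient_by])
  moreover have "(\<lambda>(w, z). (w, frac z)) \<circ> (\<lambda>p. ((circ_pt \<circ> fst) p, snd p - of_int k)) = torus_pt"
    by (auto simp: torus_pt_def frac_def fun_eq_iff)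
  ultimately show ?thesis by simp
qed

text \<open>Arcs of the rectangle cross height 0, where two strips meet. The conditional with equal
  branches serves to glue the parts of the path below and above that height.\<close>

lemma pathin_torus:
  assumes g: "path g" "path_image g \<subseteq> UNIV \<times> {-1..1}"
  shows "pathin torus (torus_pt \<circ> g)"
proof -
  have cont: "continuous_map (top_of_set {0..1}) euclidean g" using g by (simp add: path_def)
  have "continuous_map (top_of_set {0..1}) torus
     (\<lambda>t. if snd (g t) \<le> 0 then (torus_pt \<circ> g) t else (torus_pt \<circ> g) t)"
  proof (rule continuous_map_cases_le)
    show "continuous_map (top_of_set {0..1}) euclideanreal (\<lambda>t. snd (g t))"
      using g by (simp add: path_def continuous_on_snd)
    show "continuous_map (subtopology (top_of_set {0..1}) {t \<in> topspace (top_of_set {0..1}). snd (g t) \<le> 0})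
       torus (torus_pt \<circ> g)"
    proof (rule continuous_map_compose[OF _ continuous_map_torus_pt_strip[of "-1"]])
      show "continuous_map (subtopology (top_of_set {0..1}) {t \<in> topspace (top_of_set {0..1}). snd (g t) \<le> 0})
        (top_of_set (UNIV \<times> {of_int (-1)..of_int (-1) + 1})) g"
        using g cont by (fastforce simp: continuous_map_in_subtopology path_image_def mem_Times_iff
            intro: continuous_map_from_subtopology)
    qed
    show "continuous_map (subtopology (top_of_set {0..1}) {t \<in> topspace (top_of_set {0..1}). 0 \<le> snd (g t)})
       torus (torus_pt \<circ> g)"
    proof (rule continuous_map_compose[OF _ continuous_map_torus_pt_strip[of 0]])
      show "continuous_map (subtopology (top_of_set {0..1}) {t \<in> topspace (top_of_set {0..1}). 0 \<le> snd (g t)})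
        (top_of_set (UNIV \<times> {of_int 0..of_int 0 + 1})) g"
        using g cont by (fastforce simp: continuous_map_in_subtopology path_image_def mem_Times_iff
            intro: continuous_map_from_subtopology)
    qed
  qed auto
  then show ?thesis by (simp add: pathin_def comp_def)
qed

lemma simple_arc_in_torus:
  assumes "arc g" "path_image g \<subseteq> UNIV \<times> {-1..1}" "inj_on torus_pt (path_image g)"
  shows "simple_arc_in torus (torus_pt ` path_image g) (torus_pt (pathstart g)) (torus_pt (pathfinish g))"
  unfolding simple_arc_in_def
proof (intro exI conjI)
  show "pathin torus (torus_pt \<circ> g)" using assms by (intro pathin_torus) (auto simp: arc_def)
  show "inj_on (torus_pt \<circ> g) {0..1}"
    using assms by (intro comp_inj_on) (auto simp: arc_def path_image_def)
qed (auto simp: path_image_def pathstart_def pathfinish_def)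

section \<open>Drawing the arcs in the rectangle\<close>

lemma closed_segmentE:
  fixes v x y :: "real \<times> real"
  assumes "v \<in> closed_segment x y"
  obtains t where "0 \<le> t" "t \<le> 1" "fst v = (1 - t) * fst x + t * fst y" "snd v = (1 - t) * snd x + t * snd y"
  using assms by (auto simp: closed_segment_def)

lemma convex_comb_pos:
  fixes a b t :: real
  assumes "0 \<le> t" "t \<le> 1" "0 < a" "0 < b"
  shows "0 < (1 - t) * a + t * b"
proof (cases "t = 0")
  case False
  then have "0 < t * b" "0 \<le> (1 - t) * a" using assms by simp_all
  then show ?thesis by linarith
qed (use assms in simp)

lemma comb_pos:
  fixes x y z t :: real
  shows "x = (1 - t) * y + t * z \<Longrightarrow> 0 \<le> t \<Longrightarrow> t \<le> 1 \<Longrightarrow> 0 < y \<Longrightarrow> 0 < z \<Longrightarrow> 0 < x"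
  using convex_comb_pos by blast

lemma comb_scale:
  fixes x y z t k :: real
  assumes "x = (1 - t) * y + t * z"
  shows "k * x = (1 - t) * (k * y) + t * (k * z)"
  unfolding assms by (simp only: distrib_left mult.left_commute)

lemma neg_mult_diff: "- s * ((w - a) * k) = (s * (a - w)) * k" for s w a k :: real
  by (simp add: algebra_simps)

text \<open>The height \<open>\<eta>\<close> is taken to be \<open>1/4\<close>. The slanted line \<open>z = - \<epsilon> w / 128\<close> separates \<open>x\<close> from
  \<open>y\<close>, hence also the arcs of the two blocks when these are drawn as thin triangles. With \<open>h = -1\<close> for the
  circle \<open>F\<close> and \<open>h = 1\<close> for \<open>S\<close>, the block at height \<open>h/4\<close> is joined to \<open>(h \<epsilon>, 0)\<close>. The zero set of
  \<open>sep \<epsilon> h a b\<close> is the line through \<open>(a, h/4)\<close> and the point of the slanted line over \<open>b\<close>.\<close>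

definition side :: "real \<Rightarrow> real \<Rightarrow> real \<times> real \<Rightarrow> real" where
  "side \<epsilon> h v = h * (snd v + \<epsilon> * fst v / 128)"

definition sep :: "real \<Rightarrow> real \<Rightarrow> real \<Rightarrow> real \<Rightarrow> real \<times> real \<Rightarrow> real" where
  "sep \<epsilon> h a b v = (fst v - a) * (1/4 + h * \<epsilon> * b / 128) + (b - a) * (h * snd v - 1/4)"

lemma side_segment:
  assumes "fst v = (1 - t) * fst x + t * fst y" "snd v = (1 - t) * snd x + t * snd y"
  shows "side \<epsilon> h v = (1 - t) * side \<epsilon> h x + t * side \<epsilon> h y"
  unfolding side_def assms by (simp add: field_simps)

lemma sep_segment:
  assumes "fst v = (1 - t) * fst x + t * fst y" "snd v = (1 - t) * snd x + t * snd y"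
  shows "sep \<epsilon> h a b v = (1 - t) * sep \<epsilon> h a b x + t * sep \<epsilon> h a b y"
  unfolding sep_def assms by (simp add: field_simps)

locale signs =
  fixes \<epsilon> h :: real
  assumes \<epsilon>: "\<epsilon> = 1 \<or> \<epsilon> = -1" and h: "h = 1 \<or> h = -1"
begin

lemma square_signs [simp]: "h * h = 1" "\<epsilon> * \<epsilon> = 1" "h * (h * x) = x" "\<epsilon> * (\<epsilon> * x) = x"
  "h * (x * h) = x" "h * (\<epsilon> * (h * x)) = \<epsilon> * x" "\<epsilon> * (h * (\<epsilon> * x)) = h * x"
  using \<epsilon> h by auto

lemma abs_bound: "\<bar>x\<bar> < b \<Longrightarrow> h * \<epsilon> * x < b \<and> - b < h * \<epsilon> * x"
  using \<epsilon> h by (auto simp: abs_if split: if_splits)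

lemma side_base: "\<bar>a\<bar> < 4 \<Longrightarrow> 7/32 < side \<epsilon> h (a, h/4) \<and> side \<epsilon> h (a, h/4) < 9/32"
  using \<epsilon> h by (auto simp: side_def abs_if split: if_splits)

lemma side_line: "side \<epsilon> h' (b, - \<epsilon> * b / 128) = 0"
  by (simp add: side_def)

lemma sep_base: "sep \<epsilon> h a b (w, h/4) = (w - a) * (1/4 + h * \<epsilon> * b / 128)"
  by (simp add: sep_def)

lemma sep_line: "sep \<epsilon> h a b (w, - \<epsilon> * w / 128) = (w - b) * (1/4 + h * \<epsilon> * a / 128)"
  unfolding sep_def by (simp add: field_simps)

lemma sep_coeff: "\<bar>b\<bar> < 4 \<Longrightarrow> 7/32 < 1/4 + h * \<epsilon> * b / 128 \<and> 1/4 + h * \<epsilon> * b / 128 < 9/32"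
  using abs_bound[of b 4] by linarith

text \<open>One half of a group arc, from position \<open>a\<close> at height \<open>h/4\<close> to
  its crossing point with the slanted line.\<close>

definition "half a b = closed_segment (a, h/4) (b, - \<epsilon> * b / 128)"

lemma half_side:
  assumes "v \<in> half a b" "\<bar>a\<bar> < 4" "\<bar>b\<bar> < 4"
  shows "0 \<le> side \<epsilon> h v" and "side \<epsilon> h v = 0 \<Longrightarrow> v = (b, - \<epsilon> * b / 128)"
    and "\<bar>fst v\<bar> < 4" and "\<bar>snd v\<bar> \<le> 1/4" and "\<bar>snd v\<bar> = 1/4 \<Longrightarrow> v = (a, h/4)"
proof -
  obtain t where t: "0 \<le> t" "t \<le> 1" "fst v = (1 - t) * a + t * b"
      "snd v = (1 - t) * (h/4) + t * (- \<epsilon> * b / 128)"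
    using assms(1) unfolding half_def by (rule closed_segmentE) auto
  have s: "side \<epsilon> h v = (1 - t) * side \<epsilon> h (a, h/4)"
    using side_segment[of v t "(a, h/4)" "(b, - \<epsilon> * b / 128)"] t side_line by simp
  show "0 \<le> side \<epsilon> h v" using s t side_base[OF assms(2)] by simp
  show "v = (b, - \<epsilon> * b / 128)" if "side \<epsilon> h v = 0"
  proof -
    have "t = 1" using that s side_base[OF assms(2)] by auto
    then show ?thesis using t by (simp add: prod_eq_iff)
  qed
  have "0 < (1 - t) * (4 - a) + t * (4 - b)" "0 < (1 - t) * (4 + a) + t * (4 + b)"
    using t assms by (auto intro!: convex_comb_pos)
  then show "\<bar>fst v\<bar> < 4" using t by (simp add: algebra_simps abs_less_iff)
  have hb: "- (1/32) < - \<epsilon> * b / 128" "- \<epsilon> * b / 128 < 1/32" using assms(3) \<epsilon> by auto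
  have z: "1/4 - h * snd v = t * (1/4 - h * (- \<epsilon> * b / 128))"
    "1/4 + h * snd v = (1 - t) * (1/2) + t * (1/4 + h * (- \<epsilon> * b / 128))"
    unfolding t(4) by (simp_all add: field_simps)
  have hb': "0 < 1/4 - h * (- \<epsilon> * b / 128)" "0 < 1/4 + h * (- \<epsilon> * b / 128)" using hb h by auto
  have "0 \<le> 1/4 - h * snd v" unfolding z using t hb' by simp
  moreover have p: "0 < 1/4 + h * snd v" unfolding z using t hb' by (intro convex_comb_pos) auto
  ultimately show "\<bar>snd v\<bar> \<le> 1/4" using h by auto
  show "v = (a, h/4)" if "\<bar>snd v\<bar> = 1/4"
  proof -
    have "1/4 - h * snd v = 0" using that p h by (auto simp: abs_if split: if_splits)
    then have "t = 0" using z(1) hb' by auto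
    then show ?thesis using t by (simp add: prod_eq_iff)
  qed
qed

lemma half_sep_zero: "v \<in> half a b \<Longrightarrow> sep \<epsilon> h a b v = 0"
  unfolding half_def
  by (erule closed_segmentE)
    (use sep_segment[of v _ "(a, h/4)" "(b, - \<epsilon> * b / 128)"] sep_base sep_line in simp)

text \<open>The affine function \<open>sep \<epsilon> h a' b'\<close> vanishes on one segment and is
  negative at both ends of the other.\<close>

lemma half_disjoint:
  assumes "a < a'" "b < b'" "\<bar>a'\<bar> < 4" "\<bar>b'\<bar> < 4"
  shows "half a b \<inter> half a' b' = {}"
proof -
  have "0 < - sep \<epsilon> h a' b' v" if v: "v \<in> half a b" for v
  proof -
    obtain t where t: "0 \<le> t" "t \<le> 1" "fst v = (1 - t) * a + t * b"
      "snd v = (1 - t) * (h/4) + t * (- \<epsilon> * b / 128)"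
      using v unfolding half_def by (rule closed_segmentE) auto
    have "sep \<epsilon> h a' b' v = (1 - t) * sep \<epsilon> h a' b' (a, h/4) + t * sep \<epsilon> h a' b' (b, - \<epsilon> * b / 128)"
      using sep_segment[of v t "(a, h/4)" "(b, - \<epsilon> * b / 128)"] t by simp
    moreover have "sep \<epsilon> h a' b' (a, h/4) < 0" "sep \<epsilon> h a' b' (b, - \<epsilon> * b / 128) < 0"
      unfolding sep_base sep_line
      by (rule mult_neg_pos; use assms sep_coeff[of a'] sep_coeff[of b'] in linarith)+
    ultimately show ?thesis
      using convex_comb_pos[OF t(1,2), of "- sep \<epsilon> h a' b' (a, h/4)" "- sep \<epsilon> h a' b' (b, - \<epsilon> * b / 128)"]
      by simp
  qed
  then show ?thesis using half_sep_zero[of _ a' b'] by fastforce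
qed

text \<open>The point \<open>(h * \<epsilon>, 0)\<close> is overshot by the factor
  \<open>\<tau>\<close> on the ray from \<open>(c, h/4)\<close>, so that with
  \<open>1 < \<tau>\<close> the core, which stops at that point, ends strictly inside the
  triangle.\<close>

definition "apex c \<tau> = ((1 - \<tau>) * c + \<tau> * (h * \<epsilon>), (1 - \<tau>) * (h/4))"

definition "tent c D \<tau> = linepath (c - D, h/4) (apex c \<tau>) +++ linepath (apex c \<tau>) (c + D, h/4)"

definition "core c = linepath (c, h/4) (h * \<epsilon>, 0)"

text \<open>\<open>vert\<close> and \<open>horiz\<close> are sheared coordinates with the core as
  axis: \<open>vert\<close> is 0 on the base and 1 at the end of the core, \<open>horiz\<close> is
  the horizontal deviation from the line of the core.\<close>

definition "vert v = 1 - 4 * h * snd v"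

definition "horiz c v = fst v - c - vert v * (h * \<epsilon> - c)"

text \<open>From the base onwards the tent is the level set 1 of this function, and smaller values
  lie inside. Nesting of tents with common centre becomes monotonicity in \<open>D\<close> and
  \<open>\<tau>\<close>.\<close>

definition "tent_gauge c D \<tau> v = \<bar>horiz c v\<bar> / D + vert v / \<tau>"

text \<open>The slope 1/128 is justified here. Let \<open>x\<close> be the distance by which the
  crossing point misses \<open>h * \<epsilon>\<close>. A horizontal dividing line would give the
  value \<open>x / 4\<close>; the slant changes it by \<open>q / 128\<close> with
  \<open>q \<le> 5 * (x + 1)\<close>, and for \<open>x \<ge> 1/2\<close> more than 1/16
  remains.\<close>

lemma sep_point:
  assumes s: "s = 1 \<or> s = (-1 :: real)" and b: "1/2 \<le> s * (b - h * \<epsilon>)" "\<bar>b\<bar> < 4" and a: "\<bar>a\<bar> < 4"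
  shows "1/16 < - s * sep \<epsilon> h a b (h * \<epsilon>, 0)"
proof -
  define p where "p = h * \<epsilon>"
  have p: "p = 1 \<or> p = -1" and bp: "1/2 \<le> s * (b - p)" using \<epsilon> h b by (auto simp: p_def)
  define x where "x = s * (b - p)"
  define q where "q = s * ((p - a) * p * b)"
  have "\<bar>q\<bar> \<le> 5 * (x + 1)"
  proof -
    have "\<bar>p - a\<bar> \<le> 5" using p a by auto
    moreover have "\<bar>b\<bar> \<le> s * (b - p) + 1" using s p bp by auto
    ultimately have "\<bar>p - a\<bar> * \<bar>b\<bar> \<le> 5 * (s * (b - p) + 1)" by (intro mult_mono) auto
    then show ?thesis using s p by (auto simp: q_def x_def abs_mult)
  qed
  then have "q \<le> 5 * (x + 1)" by (rule abs_le_D1)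
  then have "1/16 < x / 4 - q / 128" using bp[folded x_def] by (simp add: field_simps)
  moreover have "- s * sep \<epsilon> h a b (p, 0) = x / 4 - q / 128"
    unfolding sep_def q_def x_def p_def[symmetric] by (simp add: field_simps)
  ultimately show ?thesis unfolding p_def[symmetric] by simp
qed

lemma core_props:
  assumes v: "v \<in> path_image (core c)" and c: "\<bar>c\<bar> < 4"
  shows "0 \<le> vert v" and "vert v \<le> 1" and "horiz c v = 0" and "0 < side \<epsilon> h v"
    and "\<bar>fst v\<bar> < 4" and "\<bar>snd v\<bar> \<le> 1/4" and "\<bar>snd v\<bar> = 1/4 \<Longrightarrow> v = (c, h/4)"
proof -
  obtain t where t: "0 \<le> t" "t \<le> 1" "fst v = (1 - t) * c + t * (h * \<epsilon>)" "snd v = (1 - t) * (h/4)"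
    using v unfolding core_def path_image_linepath by (rule closed_segmentE) auto
  have "4 * h * ((1 - t) * (h/4)) = (h * h) * (1 - t)" by simp
  then have vv: "vert v = t" unfolding vert_def t(4) by simp
  then show "0 \<le> vert v" "vert v \<le> 1" using t by auto
  show "horiz c v = 0" unfolding horiz_def vv t(3) by (simp add: algebra_simps)
  have eq: "side \<epsilon> h v = (1 - t) * side \<epsilon> h (c, h/4) + t * side \<epsilon> h (h * \<epsilon>, 0)"
    by (rule side_segment) (use t in auto)
  have pos: "0 < side \<epsilon> h (h * \<epsilon>, 0)" by (simp add: side_def)
  show "0 < side \<epsilon> h v"
    by (rule comb_pos[OF eq t(1,2) _ pos]) (use side_base[OF c] in linarith)
  have he: "\<bar>h * \<epsilon>\<bar> = 1" using \<epsilon> h by auto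
  then have "0 < (1 - t) * (4 - c) + t * (4 - h * \<epsilon>)" "0 < (1 - t) * (4 + c) + t * (4 + h * \<epsilon>)"
    using t c by (auto intro!: convex_comb_pos)
  then show "\<bar>fst v\<bar> < 4" unfolding abs_less_iff t(3) by (simp add: algebra_simps)
  show "\<bar>snd v\<bar> \<le> 1/4" unfolding t(4) using t h by (auto simp: abs_mult)
  show "v = (c, h/4)" if "\<bar>snd v\<bar> = 1/4"
  proof -
    have "t = 0" using that t h by (auto simp: abs_mult)
    then show ?thesis using t by (simp add: prod_eq_iff)
  qed
qed

text \<open>Both ends of the core are strictly on one side of the line through the group half: the
  base by the order of the positions, the other end by \<open>sep_point\<close>. The sign
  \<open>s\<close> is 1 for a group on the right.\<close>

lemma core_sep:
  assumes v: "v \<in> path_image (core c)" and c: "\<bar>c\<bar> < 4"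
    and s: "s = 1 \<or> s = (-1 :: real)" and b: "1/2 \<le> s * (b - h * \<epsilon>)" "\<bar>b\<bar> < 4"
    and a: "\<bar>a\<bar> < 4" "0 < s * (a - c)"
  shows "v \<notin> half a b"
proof -
  obtain t where t: "0 \<le> t" "t \<le> 1" "fst v = (1 - t) * c + t * (h * \<epsilon>)" "snd v = (1 - t) * (h/4)"
    using v unfolding core_def path_image_linepath by (rule closed_segmentE) auto
  have "sep \<epsilon> h a b v = (1 - t) * sep \<epsilon> h a b (c, h/4) + t * sep \<epsilon> h a b (h * \<epsilon>, 0)"
    by (rule sep_segment) (use t in auto)
  then have eq: "- s * sep \<epsilon> h a b v = (1 - t) * (- s * sep \<epsilon> h a b (c, h/4)) + t * (- s * sep \<epsilon> h a b (h * \<epsilon>, 0))"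
    by (rule comb_scale)
  have pos: "0 < - s * sep \<epsilon> h a b (c, h/4)"
  proof -
    have "- s * sep \<epsilon> h a b (c, h/4) = (s * (a - c)) * (1/4 + h * \<epsilon> * b / 128)"
      unfolding sep_base by (rule neg_mult_diff)
    also have "0 < \<dots>" by (rule mult_pos_pos) (use a(2) sep_coeff[OF b(2)] in linarith)+
    finally show ?thesis .
  qed
  have "0 < - s * sep \<epsilon> h a b v"
    by (rule comb_pos[OF eq t(1,2) pos]) (use sep_point[OF s b a(1)] in linarith)
  then show ?thesis using half_sep_zero[of v a b] by auto
qed

end

text \<open>An overshoot of at most 1/64 lets the apex inherit the strict inequalities of
  \<open>(h * \<epsilon>, 0)\<close>: the margin 1/128 for \<open>side\<close> exceeds
  \<open>1/64 * (9/32)\<close>, and the margin 1/16 for \<open>sep\<close> exceeds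
  \<open>1/64 * (8 * (9/32))\<close>.\<close>

locale tent_shape = signs +
  fixes c D \<tau> :: real
  assumes D: "0 < D" "- 4 < c - D" "c + D < 4" and \<tau>: "1 < \<tau>" "\<tau> \<le> 1 + 1/64"
begin

lemma c_bound: "\<bar>c\<bar> < 4" using D by auto

lemma apex_bound: "\<bar>fst (apex c \<tau>)\<bar> < 4" "\<bar>snd (apex c \<tau>)\<bar> < 1/4"
proof -
  have "\<bar>(1 - \<tau>) * c\<bar> \<le> 1/64 * 4" unfolding abs_mult using \<tau> c_bound by (intro mult_mono) auto
  moreover have "\<bar>\<tau> * (h * \<epsilon>)\<bar> \<le> 65/64" using \<epsilon> h \<tau> by (auto simp: abs_mult)
  ultimately show "\<bar>fst (apex c \<tau>)\<bar> < 4" unfolding apex_def fst_conv by linarith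
  show "\<bar>snd (apex c \<tau>)\<bar> < 1/4" using \<tau> h by (auto simp: apex_def abs_mult)
qed

lemma side_apex: "0 < side \<epsilon> h (apex c \<tau>)"
proof -
  have "side \<epsilon> h (apex c \<tau>) = \<tau> / 128 - (\<tau> - 1) * side \<epsilon> h (c, h/4)"
    by (simp add: side_def apex_def field_simps)
  moreover have "(\<tau> - 1) * side \<epsilon> h (c, h/4) \<le> 1/64 * (9/32)"
    using \<tau> side_base[OF c_bound] by (intro mult_mono) auto
  ultimately show ?thesis using \<tau> by linarith
qed

lemma sep_apex:
  assumes s: "s = 1 \<or> s = (-1 :: real)" and b: "1/2 \<le> s * (b - h * \<epsilon>)" "\<bar>b\<bar> < 4" and a: "\<bar>a\<bar> < 4"
  shows "0 < - s * sep \<epsilon> h a b (apex c \<tau>)"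
proof -
  have "sep \<epsilon> h a b (apex c \<tau>) = (1 - \<tau>) * sep \<epsilon> h a b (c, h/4) + \<tau> * sep \<epsilon> h a b (h * \<epsilon>, 0)"
    by (rule sep_segment) (simp_all add: apex_def)
  then have e: "- s * sep \<epsilon> h a b (apex c \<tau>)
      = (\<tau> - 1) * (s * sep \<epsilon> h a b (c, h/4)) + \<tau> * (- s * sep \<epsilon> h a b (h * \<epsilon>, 0))"
    by (simp only:) (simp add: algebra_simps)
  have "\<bar>s * sep \<epsilon> h a b (c, h/4)\<bar> \<le> 8 * (9/32)"
  proof -
    have "\<bar>c - a\<bar> * \<bar>1/4 + h * \<epsilon> * b / 128\<bar> \<le> 8 * (9/32)"
      using c_bound a sep_coeff[OF b(2)] by (intro mult_mono) linarith+
    then show ?thesis using s by (auto simp: sep_base abs_mult)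
  qed
  then have "(\<tau> - 1) * \<bar>s * sep \<epsilon> h a b (c, h/4)\<bar> \<le> 1/64 * (8 * (9/32))"
    using \<tau> by (intro mult_mono) auto
  moreover have "(\<tau> - 1) * (- \<bar>s * sep \<epsilon> h a b (c, h/4)\<bar>) \<le> (\<tau> - 1) * (s * sep \<epsilon> h a b (c, h/4))"
    using \<tau> by (intro mult_left_mono) auto
  moreover have "1 * (1/16) < \<tau> * (- s * sep \<epsilon> h a b (h * \<epsilon>, 0))"
    using \<tau> sep_point[OF s b a] by (intro mult_strict_mono) auto
  ultimately show ?thesis unfolding e by linarith
qed

lemma tent_image:
  "path_image (tent c D \<tau>) = closed_segment (c - D, h/4) (apex c \<tau>) \<union> closed_segment (c + D, h/4) (apex c \<tau>)"
  by (simp add: tent_def path_image_join closed_segment_commute)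

lemma tent_imageE:
  assumes "v \<in> path_image (tent c D \<tau>)"
  obtains s t where "s = 1 \<or> s = (-1 :: real)" "0 \<le> t" "t \<le> 1"
    "fst v = (1 - t) * (c + s * D) + t * fst (apex c \<tau>)" "snd v = (1 - t) * (h/4) + t * snd (apex c \<tau>)"
  using assms unfolding tent_image
proof
  assume "v \<in> closed_segment (c - D, h/4) (apex c \<tau>)"
  then show ?thesis by (rule closed_segmentE) (use that[of "-1"] in auto)
next
  assume "v \<in> closed_segment (c + D, h/4) (apex c \<tau>)"
  then show ?thesis by (rule closed_segmentE) (use that[of 1] in auto)
qed

lemma tent_props:
  assumes v: "v \<in> path_image (tent c D \<tau>)"
  shows "0 \<le> vert v" and "tent_gauge c D \<tau> v = 1" and "0 < side \<epsilon> h v"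
    and "\<bar>fst v\<bar> < 4" and "\<bar>snd v\<bar> \<le> 1/4" and "\<bar>snd v\<bar> = 1/4 \<Longrightarrow> v = (c - D, h/4) \<or> v = (c + D, h/4)"
proof -
  obtain s t where t: "s = 1 \<or> s = (-1 :: real)" "0 \<le> t" "t \<le> 1"
    "fst v = (1 - t) * (c + s * D) + t * fst (apex c \<tau>)" "snd v = (1 - t) * (h/4) + t * snd (apex c \<tau>)"
    using tent_imageE[OF v] by blast
  have vv: "vert v = t * \<tau>" unfolding vert_def t(5) apex_def by (simp add: field_simps)
  then show "0 \<le> vert v" using t \<tau> by simp
  have hv: "horiz c v = (1 - t) * (s * D)" unfolding horiz_def vv t(4) apex_def by (simp add: field_simps)
  show "tent_gauge c D \<tau> v = 1" using t D \<tau> unfolding tent_gauge_def vv hv by (auto simp: abs_mult)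
  have cs: "\<bar>c + s * D\<bar> < 4" using t D by auto
  have "side \<epsilon> h v = (1 - t) * side \<epsilon> h (c + s * D, h/4) + t * side \<epsilon> h (apex c \<tau>)"
    using side_segment[of v t "(c + s * D, h/4)" "apex c \<tau>"] t by simp
  then show "0 < side \<epsilon> h v" using side_base[OF cs] side_apex t by (auto intro!: convex_comb_pos)
  have "0 < (1 - t) * (4 - (c + s * D)) + t * (4 - fst (apex c \<tau>))"
    "0 < (1 - t) * (4 + (c + s * D)) + t * (4 + fst (apex c \<tau>))"
    using t cs apex_bound by (auto intro!: convex_comb_pos)
  then show "\<bar>fst v\<bar> < 4" unfolding abs_less_iff t(4) by (simp add: algebra_simps)
  have z: "4 * h * snd v = 1 - t * \<tau>" using vv by (simp add: vert_def)
  have "0 \<le> t * \<tau>" "t * \<tau> < 2" using t \<tau> mult_mono[of t 1 \<tau> "65/64"] by auto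
  then show "\<bar>snd v\<bar> \<le> 1/4" using z h by (auto simp: abs_if)
  show "v = (c - D, h/4) \<or> v = (c + D, h/4)" if "\<bar>snd v\<bar> = 1/4"
  proof -
    have "snd v = 1/4 \<or> snd v = - (1/4)" using that by linarith
    then have "4 * h * snd v = 1 \<or> 4 * h * snd v = -1" using h by auto
    then have "t * \<tau> = 0 \<or> t * \<tau> = 2" unfolding z by linarith
    moreover have "t * \<tau> \<noteq> 2" "\<tau> \<noteq> 0" using \<open>t * \<tau> < 2\<close> \<tau> by linarith+
    ultimately have "t = 0" by simp
    then show ?thesis using t by (auto simp: prod_eq_iff)
  qed
qed

lemma tent_sep:
  assumes v: "v \<in> path_image (tent c D \<tau>)"
    and s: "s = 1 \<or> s = (-1 :: real)" and b: "1/2 \<le> s * (b - h * \<epsilon>)" "\<bar>b\<bar> < 4"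
    and a: "\<bar>a\<bar> < 4" "0 < s * (a - (c - D))" "0 < s * (a - (c + D))"
  shows "v \<notin> half a b"
proof -
  obtain s' t where t: "s' = 1 \<or> s' = (-1 :: real)" "0 \<le> t" "t \<le> 1"
    "fst v = (1 - t) * (c + s' * D) + t * fst (apex c \<tau>)" "snd v = (1 - t) * (h/4) + t * snd (apex c \<tau>)"
    using tent_imageE[OF v] by blast
  have "sep \<epsilon> h a b v = (1 - t) * sep \<epsilon> h a b (c + s' * D, h/4) + t * sep \<epsilon> h a b (apex c \<tau>)"
    by (rule sep_segment) (use t in auto)
  then have eq: "- s * sep \<epsilon> h a b v = (1 - t) * (- s * sep \<epsilon> h a b (c + s' * D, h/4)) + t * (- s * sep \<epsilon> h a b (apex c \<tau>))"
    by (rule comb_scale)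
  have pos: "0 < - s * sep \<epsilon> h a b (c + s' * D, h/4)"
  proof -
    have "- s * sep \<epsilon> h a b (c + s' * D, h/4) = (s * (a - (c + s' * D))) * (1/4 + h * \<epsilon> * b / 128)"
      unfolding sep_base by (rule neg_mult_diff)
    also have "0 < \<dots>"
    proof (rule mult_pos_pos)
      show "0 < s * (a - (c + s' * D))" using a t(1) by auto
    qed (use sep_coeff[OF b(2)] in linarith)
    finally show ?thesis .
  qed
  have "0 < - s * sep \<epsilon> h a b v"
    by (rule comb_pos[OF eq t(2,3) pos sep_apex[OF s b a(1)]])
  then show ?thesis using half_sep_zero[of v a b] by auto
qed

lemma arc_tent: "arc (tent c D \<tau>)"
proof -
  have "snd (apex c \<tau>) \<noteq> h/4" using apex_bound(2) h by auto
  then have ne: "(c - D, h/4) \<noteq> apex c \<tau>" "apex c \<tau> \<noteq> (c + D, h/4)" by (metis snd_conv)+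
  have "v = apex c \<tau>"
    if v: "v \<in> closed_segment (c - D, h/4) (apex c \<tau>)" "v \<in> closed_segment (apex c \<tau>) (c + D, h/4)" for v
  proof -
    obtain t where t: "0 \<le> t" "t \<le> 1" "fst v = (1 - t) * (c - D) + t * fst (apex c \<tau>)"
      "snd v = (1 - t) * (h/4) + t * snd (apex c \<tau>)"
      using v(1) by (rule closed_segmentE) auto
    obtain u where u: "0 \<le> u" "u \<le> 1" "fst v = (1 - u) * fst (apex c \<tau>) + u * (c + D)"
      "snd v = (1 - u) * snd (apex c \<tau>) + u * (h/4)"
      using v(2) by (rule closed_segmentE) auto
    have v1: "vert v = t * \<tau>" unfolding vert_def t(4) apex_def by (simp add: field_simps)
    have 1: "horiz c v = - (1 - t) * D" unfolding horiz_def v1 t(3) apex_def by (simp add: field_simps)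
    have v2: "vert v = (1 - u) * \<tau>" unfolding vert_def u(4) apex_def by (simp add: field_simps)
    have 2: "horiz c v = u * D" unfolding horiz_def v2 u(3) apex_def by (simp add: field_simps)
    \<comment> \<open>The left leg has \<open>horiz \<le> 0\<close> and the right leg
      \<open>horiz \<ge> 0\<close>, so only the apex is common.\<close>
    have "- (1 - t) = u" using 1 2 D by (metis mult_right_cancel less_irrefl)
    then have "t = 1" using t u by linarith
    then show ?thesis using t by (simp add: prod_eq_iff)
  qed
  then show ?thesis unfolding tent_def by (intro arc_join arc_linepath ne) auto
qed

lemma enclosed_tent:
  "enclosed (tent c D \<tau>) = interior (convex hull {(c - D, h/4), apex c \<tau>, (c + D, h/4)})"
proof -
  have "path_image (tent c D \<tau>) \<union> closed_segment (pathstart (tent c D \<tau>)) (pathfinish (tent c D \<tau>))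
    = closed_segment (c - D, h/4) (apex c \<tau>) \<union> closed_segment (apex c \<tau>) (c + D, h/4)
      \<union> closed_segment (c + D, h/4) (c - D, h/4)"
    by (simp add: tent_def path_image_join closed_segment_commute)
  then show ?thesis unfolding enclosed_def by (simp add: inside_of_triangle)
qed

text \<open>The corners lie in an open half plane, hence so does the triangle. The point
  \<open>(- (h * \<epsilon>), 0)\<close> lies outside it, which keeps the other end of the curve out
  of every tent.\<close>

lemma enclosed_side:
  assumes "v \<in> enclosed (tent c D \<tau>)"
  shows "0 < side \<epsilon> h v"
proof -
  have "convex {v. 0 < side \<epsilon> h v}"
    unfolding convex_alt
  proof (intro ballI allI impI)
    fix x y and u :: real assume "x \<in> {v. 0 < side \<epsilon> h v}" "y \<in> {v. 0 < side \<epsilon> h v}" "0 \<le> u \<and> u \<le> 1"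
    then show "(1 - u) *\<^sub>R x + u *\<^sub>R y \<in> {v. 0 < side \<epsilon> h v}"
      using side_segment[of "(1 - u) *\<^sub>R x + u *\<^sub>R y" u x y] convex_comb_pos[of u "side \<epsilon> h x" "side \<epsilon> h y"]
      by simp
  qed
  moreover have "{(c - D, h/4), apex c \<tau>, (c + D, h/4)} \<subseteq> {v. 0 < side \<epsilon> h v}"
  proof -
    have "\<bar>c - D\<bar> < 4" "\<bar>c + D\<bar> < 4" using D by auto
    then have "0 < side \<epsilon> h (c - D, h/4)" "0 < side \<epsilon> h (c + D, h/4)" using side_base by fastforce+
    then show ?thesis using side_apex by simp
  qed
  ultimately have "convex hull {(c - D, h/4), apex c \<tau>, (c + D, h/4)} \<subseteq> {v. 0 < side \<epsilon> h v}"
    by (intro hull_minimal)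
  then show ?thesis using assms interior_subset unfolding enclosed_tent by blast
qed

text \<open>In the proof \<open>x\<close>, \<open>z\<close>, \<open>y\<close> are the barycentric
  coordinates of \<open>v\<close> for the left corner, the apex and the right corner. The two
  hypotheses say that all three are positive.\<close>

lemma enclosed_tentI:
  assumes V: "0 < vert v" and G: "tent_gauge c D \<tau> v < 1"
  shows "v \<in> enclosed (tent c D \<tau>)"
proof -
  define z where "z = vert v / \<tau>"
  define H where "H = horiz c v / D"
  define y where "y = (1 - z + H) / 2"
  define x where "x = (1 - z - H) / 2"
  have z: "0 < z" using V \<tau> by (simp add: z_def)
  have "\<bar>H\<bar> < 1 - z" using G D by (simp add: tent_gauge_def z_def H_def abs_divide abs_of_pos)
  then have xy: "0 < x" "0 < y" by (auto simp: x_def y_def)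
  have sum: "x + z + y = 1" by (simp add: x_def y_def field_simps)
  have zt: "z * \<tau> = vert v" using \<tau> by (simp add: z_def)
  have "y - x = H" by (simp add: x_def y_def field_simps)
  then have yx: "(y - x) * D = horiz c v" using D by (simp add: H_def)
  have f: "fst v = x * (c - D) + z * ((1 - \<tau>) * c + \<tau> * (h * \<epsilon>)) + y * (c + D)"
  proof -
    have "x * (c - D) + z * ((1 - \<tau>) * c + \<tau> * (h * \<epsilon>)) + y * (c + D)
      = (x + z + y) * c + (y - x) * D + z * \<tau> * (h * \<epsilon> - c)" by (simp add: algebra_simps)
    then show ?thesis unfolding sum zt yx by (simp add: horiz_def)
  qed
  have g: "snd v = x * (h/4) + z * ((1 - \<tau>) * (h/4)) + y * (h/4)"
  proof -
    have "x * k + z * ((1 - \<tau>) * k) + y * k = (x + z + y - z * \<tau>) * k" for k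
      by (simp add: algebra_simps)
    from this[of "h/4"] have "x * (h/4) + z * ((1 - \<tau>) * (h/4)) + y * (h/4) = 4 * h * snd v * (h/4)"
      unfolding sum zt vert_def by simp
    also have "\<dots> = snd v" by simp
    finally show ?thesis by simp
  qed
  have v: "v = x *\<^sub>R (c - D, h/4) + z *\<^sub>R apex c \<tau> + y *\<^sub>R (c + D, h/4)"
    using f g by (simp add: prod_eq_iff apex_def)
  have "\<not> collinear {(c - D, h/4), apex c \<tau>, (c + D, h/4)}"
  proof
    assume "collinear {(c - D, h/4), apex c \<tau>, (c + D, h/4)}"
    then obtain u where u: "\<exists>k. (c - D, h/4) - (c + D, h/4) = k *\<^sub>R u"
        "\<exists>k. apex c \<tau> - (c + D, h/4) = k *\<^sub>R u"
      unfolding collinear_def by blast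
    from u(1) obtain k where "(c - D, h/4) - (c + D, h/4) = k *\<^sub>R u" by blast
    then have "k * fst u = - (2 * D)" "k * snd u = 0" by (auto simp: prod_eq_iff)
    then have "snd u = 0" using D by auto
    then have "snd (apex c \<tau>) = h/4" using u(2) by (auto simp: prod_eq_iff)
    then show False using apex_bound(2) h by auto
  qed
  then show ?thesis
    unfolding enclosed_tent by (subst interior_convex_hull_3_minimal) (use v xy z sum in auto)
qed

end

section \<open>Blocks drawn as nested triangles\<close>

lemma position_less: "0 < n \<Longrightarrow> j < k \<Longrightarrow> position n j < position n k"
  by (simp add: position_def divide_strict_right_mono)

lemma position_bounds: "1 \<le> k \<Longrightarrow> k \<le> n \<Longrightarrow> \<bar>position n k\<bar> < 4"
  by (simp add: position_def abs_less_iff field_simps)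

lemma position_add: "0 < n \<Longrightarrow> position n (k + j) = position n k + real j * (8 / real n)"
  by (simp add: position_def field_simps)

definition "width n r k = real (r + 1 - k) * (8 / real n)"

text \<open>Strictly decreasing in \<open>k\<close>, so inner tents have a smaller overshoot, and
  normalised to stay in the interval from 1 to 1 + 1/64 allowed by
  \<open>tent_shape\<close>.\<close>

definition "tilt r k = 1 + real (r + 1 - k) / (64 * real (r + 1))"

definition "centre n r o\<^sub>b = position n (o\<^sub>b + (r + 1))"

context signs
begin

definition block_arc :: "nat \<Rightarrow> nat \<Rightarrow> nat \<Rightarrow> nat \<Rightarrow> real \<Rightarrow> real \<times> real" where
  "block_arc n r o\<^sub>b k =
     (if k \<le> r then tent (centre n r o\<^sub>b) (width n r k) (tilt r k)
      else core (centre n r o\<^sub>b))"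

lemma block_tent:
  assumes "0 < n" "o\<^sub>b + (2 * r + 1) \<le> n" "1 \<le> k" "k \<le> r"
  shows "tent_shape \<epsilon> h (centre n r o\<^sub>b) (width n r k)
      (tilt r k)"
    and "centre n r o\<^sub>b - width n r k = position n (o\<^sub>b + k)"
    and "centre n r o\<^sub>b + width n r k = position n (o\<^sub>b + (2 * r + 2 - k))"
proof -
  have "o\<^sub>b + (r + 1) = (o\<^sub>b + k) + (r + 1 - k)" using assms by simp
  then show 1: "centre n r o\<^sub>b - width n r k = position n (o\<^sub>b + k)"
    using position_add[OF assms(1), of "o\<^sub>b + k" "r + 1 - k"]
    by (simp add: width_def centre_def)
  have "o\<^sub>b + (2 * r + 2 - k) = (o\<^sub>b + (r + 1)) + (r + 1 - k)" using assms by simp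
  then show 2: "centre n r o\<^sub>b + width n r k = position n (o\<^sub>b + (2 * r + 2 - k))"
    using position_add[OF assms(1), of "o\<^sub>b + (r + 1)" "r + 1 - k"]
    by (simp only: width_def centre_def)
  show "tent_shape \<epsilon> h (centre n r o\<^sub>b) (width n r k)
      (tilt r k)"
  proof unfold_locales
    show "- 4 < centre n r o\<^sub>b - width n r k"
      unfolding 1 using position_bounds[of "o\<^sub>b + k" n] assms by simp
    show "centre n r o\<^sub>b + width n r k < 4"
    proof -
      have "1 \<le> o\<^sub>b + (2 * r + 2 - k)" "o\<^sub>b + (2 * r + 2 - k) \<le> n" using assms by linarith+
      from position_bounds[OF this] show ?thesis unfolding 2 by linarith
    qed
    show "0 < width n r k" using assms by (simp add: width_def)
    show "1 < tilt r k" using assms by (simp add: tilt_def)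
    show "tilt r k \<le> 1 + 1 / 64" by (simp add: tilt_def field_simps)
  qed
qed

lemma vert_zero_iff: "vert v = 0 \<longleftrightarrow> snd v = h/4"
  using h by (auto simp: vert_def)

lemma block_arc_props:
  assumes n: "0 < n" "o\<^sub>b + (2 * r + 1) \<le> n" and k: "k \<in> {1..r + 1}"
  shows "arc (block_arc n r o\<^sub>b k)"
    and "pathstart (block_arc n r o\<^sub>b k) = (position n (o\<^sub>b + k), h/4)"
    and "pathfinish (block_arc n r o\<^sub>b k) =
      (if k \<le> r then (position n (o\<^sub>b + (2 * r + 2 - k)), h/4) else (h * \<epsilon>, 0))"
    and "v \<in> path_image (block_arc n r o\<^sub>b k) \<Longrightarrow>
      0 \<le> vert v \<and> 0 < side \<epsilon> h v \<and> \<bar>fst v\<bar> < 4 \<and> \<bar>snd v\<bar> \<le> 1/4 \<and>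
      (\<bar>snd v\<bar> = 1/4 \<longrightarrow> v \<in> {(position n (o\<^sub>b + k), h/4), (position n (o\<^sub>b + (2 * r + 2 - k)), h/4)})"
proof -
  have c: "\<bar>centre n r o\<^sub>b\<bar> < 4" unfolding centre_def using n by (intro position_bounds) auto
  note bt = block_tent[OF n]
  show "arc (block_arc n r o\<^sub>b k)"
  proof (cases "k \<le> r")
    case True
    then show ?thesis using tent_shape.arc_tent[OF bt(1)] k by (simp add: block_arc_def)
  next
    case False
    then show ?thesis using h by (auto simp: block_arc_def core_def)
  qed
  show "pathstart (block_arc n r o\<^sub>b k) = (position n (o\<^sub>b + k), h/4)"
  proof (cases "k \<le> r")
    case False
    then have "k = r + 1" using k by simp
    then show ?thesis by (simp add: block_arc_def core_def centre_def)
  qed (use k bt(2)[of k] in \<open>simp add: block_arc_def tent_def\<close>)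
  show "pathfinish (block_arc n r o\<^sub>b k) =
      (if k \<le> r then (position n (o\<^sub>b + (2 * r + 2 - k)), h/4) else (h * \<epsilon>, 0))"
    using k bt(3)[of k] by (auto simp: block_arc_def core_def tent_def)
  show "0 \<le> vert v \<and> 0 < side \<epsilon> h v \<and> \<bar>fst v\<bar> < 4 \<and> \<bar>snd v\<bar> \<le> 1/4 \<and>
      (\<bar>snd v\<bar> = 1/4 \<longrightarrow> v \<in> {(position n (o\<^sub>b + k), h/4), (position n (o\<^sub>b + (2 * r + 2 - k)), h/4)})"
    if v: "v \<in> path_image (block_arc n r o\<^sub>b k)"
  proof (cases "k \<le> r")
    case True
    then show ?thesis
      using tent_shape.tent_props[OF bt(1), of k v] v bt(2,3)[of k] k by (simp add: block_arc_def)
  next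
    case False
    then have "k = r + 1" using k by auto
    moreover have "v \<in> path_image (core (centre n r o\<^sub>b))" using v False by (simp add: block_arc_def)
    ultimately show ?thesis using core_props[OF _ c, of v] by (auto simp: centre_def)
  qed
qed

text \<open>Passing from \<open>m\<close> to a tent further out enlarges both width and tilt, so the
  gauge drops below 1; the tilt makes this strict even where \<open>horiz\<close> vanishes. On the
  core \<open>horiz = 0\<close> and \<open>vert \<le> 1\<close>, which is less than every tilt of a
  tent.\<close>

lemma block_nested:
  assumes n: "0 < n" "o\<^sub>b + (2 * r + 1) \<le> n" and k: "1 \<le> k" "k < m" "m \<le> r + 1"
    and v: "v \<in> path_image (block_arc n r o\<^sub>b m)" "snd v \<noteq> h/4"
  shows "0 < vert v" and "tent_gauge (centre n r o\<^sub>b) (width n r k)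
      (tilt r k) v < 1"
proof -
  let ?c = "centre n r o\<^sub>b" and ?D = "\<lambda>k. width n r k"
    and ?\<tau> = "\<lambda>k. tilt r k"
  have c: "\<bar>?c\<bar> < 4" unfolding centre_def using n by (intro position_bounds) auto
  show V: "0 < vert v"
    using block_arc_props(4)[OF n, of m v] v vert_zero_iff[of v] k by auto
  have \<tau>: "1 < ?\<tau> k" using k by (simp add: tilt_def)
  show "tent_gauge ?c (?D k) (?\<tau> k) v < 1"
  proof (cases "m \<le> r")
    case True
    interpret m: tent_shape \<epsilon> h ?c "?D m" "?\<tau> m" by (rule block_tent(1)) (use n k True in auto)
    have g: "tent_gauge ?c (?D m) (?\<tau> m) v = 1"
      using m.tent_props(2) v True by (simp add: block_arc_def)
    have "?D m \<le> ?D k" "0 < ?D k" using k n by (auto simp: width_def intro!: divide_right_mono)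
    then have "\<bar>horiz ?c v\<bar> / ?D k \<le> \<bar>horiz ?c v\<bar> / ?D m" using m.D by (intro divide_left_mono) auto
    moreover have "?\<tau> m < ?\<tau> k" using k by (simp add: tilt_def divide_strict_right_mono)
    then have "vert v / ?\<tau> k < vert v / ?\<tau> m" using m.\<tau> V \<tau> by (intro divide_strict_left_mono) auto
    ultimately show ?thesis using g unfolding tent_gauge_def by linarith
  next
    case False
    then have "v \<in> path_image (core ?c)" using v by (simp add: block_arc_def)
    from core_props(2,3)[OF this c] have "vert v \<le> 1" "horiz ?c v = 0" .
    moreover have "vert v / ?\<tau> k < 1" using \<tau> \<open>vert v \<le> 1\<close> by (subst divide_less_eq_1_pos) linarith+
    ultimately show ?thesis by (simp add: tent_gauge_def)
  qed
qed

lemma block_disjoint: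
  assumes n: "0 < n" "o\<^sub>b + (2 * r + 1) \<le> n" and k: "1 \<le> k" "k < m" "m \<le> r + 1"
  shows "path_image (block_arc n r o\<^sub>b k) \<inter> path_image (block_arc n r o\<^sub>b m) = {}"
proof (rule ccontr)
  assume "\<not> ?thesis"
  then obtain v where v: "v \<in> path_image (block_arc n r o\<^sub>b k)" "v \<in> path_image (block_arc n r o\<^sub>b m)" by blast
  show False
  proof (cases "snd v = h/4")
    case True
    then have "\<bar>snd v\<bar> = 1/4" using h by auto
    then have "v \<in> {(position n (o\<^sub>b + k), h/4), (position n (o\<^sub>b + (2 * r + 2 - k)), h/4)}"
      "v \<in> {(position n (o\<^sub>b + m), h/4), (position n (o\<^sub>b + (2 * r + 2 - m)), h/4)}"
      using block_arc_props(4)[OF n _ v(1)] block_arc_props(4)[OF n _ v(2)] k by simp_all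
    then have "fst v \<in> {position n (o\<^sub>b + k), position n (o\<^sub>b + (2 * r + 2 - k))}"
      "fst v \<in> {position n (o\<^sub>b + m), position n (o\<^sub>b + (2 * r + 2 - m))}"
      by auto
    moreover have "position n (o\<^sub>b + k) < position n (o\<^sub>b + m)"
      "position n (o\<^sub>b + m) < position n (o\<^sub>b + (2 * r + 2 - k))"
      "position n (o\<^sub>b + k) < position n (o\<^sub>b + (2 * r + 2 - m))"
      "position n (o\<^sub>b + (2 * r + 2 - m)) < position n (o\<^sub>b + (2 * r + 2 - k))"
      by (rule position_less[OF n(1)]; use k in linarith)+
    ultimately show False by auto
  next
    case False
    note nest = block_nested[OF n k v(2) False]
    interpret tent_shape \<epsilon> h "centre n r o\<^sub>b" "width n r k"
      "tilt r k"
      by (rule block_tent(1)) (use n k in auto)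
    show False using tent_props(2)[of v] nest v(1) k by (simp add: block_arc_def)
  qed
qed

lemma block_arcs_block_arc:
  assumes n: "0 < n" "o\<^sub>b + (2 * r + 1) \<le> n"
  shows "block_arcs n r o\<^sub>b (h/4) (h * \<epsilon>, 0) (- (h * \<epsilon>), 0) (block_arc n r o\<^sub>b)"
  unfolding block_arcs_def
proof (intro conjI ballI)
  fix k assume k: "k \<in> {1..r}"
  show "pathstart (block_arc n r o\<^sub>b k) = (position n (o\<^sub>b + k), h/4)"
    "pathfinish (block_arc n r o\<^sub>b k) = (position n (o\<^sub>b + (2 * r + 2 - k)), h/4)"
    using block_arc_props(2,3)[OF n, of k] k by auto
  interpret tent_shape \<epsilon> h "centre n r o\<^sub>b" "width n r k"
    "tilt r k"
    by (rule block_tent(1)) (use n k in auto)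
  have a: "block_arc n r o\<^sub>b k = tent (centre n r o\<^sub>b) (width n r k)
    (tilt r k)" using k by (simp add: block_arc_def)
  show "path_image (block_arc n r o\<^sub>b m) \<inter> {v. snd v \<noteq> h/4} \<subseteq> enclosed (block_arc n r o\<^sub>b k)"
    if m: "m \<in> {k<..r + 1}" for m
    unfolding a
  proof
    fix v assume v: "v \<in> path_image (block_arc n r o\<^sub>b m) \<inter> {v. snd v \<noteq> h/4}"
    show "v \<in> enclosed (tent (centre n r o\<^sub>b) (width n r k) (tilt r k))"
      by (rule enclosed_tentI; rule block_nested[OF n, of k m]) (use k m v in auto)
  qed
  show "(- (h * \<epsilon>), 0) \<notin> enclosed (block_arc n r o\<^sub>b k)"
    unfolding a using enclosed_side[of "(- (h * \<epsilon>), 0)"] by (auto simp: side_def)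
qed (use block_arc_props(2,3)[OF n, of "r + 1"] in auto)

text \<open>The sign \<open>s\<close> is 1 if the group passes to the right of the block and -1 if
  it passes to the left. All corners of a block arc then lie strictly on the other side of the line
  of \<open>half a b\<close>.\<close>

lemma block_half_disjoint:
  assumes n: "0 < n" "o\<^sub>b + (2 * r + 1) \<le> n" and k: "k \<in> {1..r + 1}"
    and s: "s = 1 \<or> s = (-1 :: real)" and b: "1/2 \<le> s * (b - h * \<epsilon>)" "\<bar>b\<bar> < 4"
    and a: "\<bar>a\<bar> < 4" "0 < s * (a - position n (o\<^sub>b + 1))" "0 < s * (a - position n (o\<^sub>b + (2 * r + 1)))"
  shows "path_image (block_arc n r o\<^sub>b k) \<inter> half a b = {}"
proof -
  have between: "0 < s * (a - position n (o\<^sub>b + j))" if "1 \<le> j" "j \<le> 2 * r + 1" for j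
  proof -
    have "position n (o\<^sub>b + 1) \<le> position n (o\<^sub>b + j)" "position n (o\<^sub>b + j) \<le> position n (o\<^sub>b + (2 * r + 1))"
      using that n position_less[of n "o\<^sub>b + 1" "o\<^sub>b + j"] position_less[of n "o\<^sub>b + j" "o\<^sub>b + (2 * r + 1)"]
      by (auto simp: le_less)
    then show ?thesis using s a by auto
  qed
  have c: "\<bar>centre n r o\<^sub>b\<bar> < 4" unfolding centre_def using n by (intro position_bounds) auto
  show ?thesis
  proof (cases "k \<le> r")
    case True
    interpret tent_shape \<epsilon> h "centre n r o\<^sub>b" "width n r k"
      "tilt r k"
      by (rule block_tent(1)) (use n k True in auto)
    have "0 < s * (a - position n (o\<^sub>b + k))" "0 < s * (a - position n (o\<^sub>b + (2 * r + 2 - k)))"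
      using between[of k] between[of "2 * r + 2 - k"] k True by auto
    then show ?thesis
      using tent_sep[OF _ s b a(1)] True k block_tent(2,3)[OF n, of k] by (auto simp: block_arc_def)
  next
    case False
    then show ?thesis
      using core_sep[OF _ c s b a(1)] between[of "r + 1", folded centre_def] by (auto simp: block_arc_def)
  qed
qed

end

text \<open>The bend lies on the slanted line, so each half stays on its own side and can come near
  only what is drawn there.\<close>

definition group_arc :: "real \<Rightarrow> real \<Rightarrow> real \<Rightarrow> real \<Rightarrow> real \<Rightarrow> real \<times> real" where
  "group_arc \<epsilon> f b g = linepath (f, - (1/4)) (b, - \<epsilon> * b / 128) +++ linepath (b, - \<epsilon> * b / 128) (g, 1/4)"

lemma group_arc_image:
  "path_image (group_arc \<epsilon> f b g) = signs.half \<epsilon> (-1) f b \<union> signs.half \<epsilon> 1 g b"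
  if "\<epsilon> = 1 \<or> \<epsilon> = -1"
proof -
  interpret L: signs \<epsilon> "-1" using that by unfold_locales auto
  interpret U: signs \<epsilon> 1 using that by unfold_locales auto
  show ?thesis
    by (simp add: group_arc_def path_image_join L.half_def U.half_def closed_segment_commute)
qed

lemma side_minus: "side \<epsilon> (-1) v = - side \<epsilon> 1 v"
  by (simp add: side_def)

lemma group_arc_props:
  assumes \<epsilon>: "\<epsilon> = 1 \<or> \<epsilon> = -1" and fbg: "\<bar>f\<bar> < 4" "\<bar>b\<bar> < 4" "\<bar>g\<bar> < 4"
  shows "arc (group_arc \<epsilon> f b g)"
    and "pathstart (group_arc \<epsilon> f b g) = (f, - (1/4))" and "pathfinish (group_arc \<epsilon> f b g) = (g, 1/4)"
    and "v \<in> path_image (group_arc \<epsilon> f b g) \<Longrightarrow>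
      \<bar>fst v\<bar> < 4 \<and> \<bar>snd v\<bar> \<le> 1/4 \<and> (\<bar>snd v\<bar> = 1/4 \<longrightarrow> v \<in> {(f, - (1/4)), (g, 1/4)})"
proof -
  interpret L: signs \<epsilon> "-1" using \<epsilon> by unfold_locales auto
  interpret U: signs \<epsilon> 1 using \<epsilon> by unfold_locales auto
  have "\<bar>- \<epsilon> * b / 128\<bar> < 1/4" using \<epsilon> fbg by auto
  then have ne: "(f, - (1/4)) \<noteq> (b, - \<epsilon> * b / 128)" "(b, - \<epsilon> * b / 128) \<noteq> (g, 1/4)" by auto
  show "arc (group_arc \<epsilon> f b g)"
    unfolding group_arc_def
  proof (rule arc_join)
    have "L.half f b \<inter> U.half g b \<subseteq> {(b, - \<epsilon> * b / 128)}"
    proof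
      fix v assume v: "v \<in> L.half f b \<inter> U.half g b"
      then have "side \<epsilon> 1 v = 0" using L.half_side(1)[of v f b] U.half_side(1)[of v g b] fbg side_minus[of \<epsilon> v] by auto
      then show "v \<in> {(b, - \<epsilon> * b / 128)}" using U.half_side(2)[of v g b] v fbg by auto
    qed
    then show "path_image (linepath (f, - (1/4)) (b, - \<epsilon> * b / 128)) \<inter>
      path_image (linepath (b, - \<epsilon> * b / 128) (g, 1/4)) \<subseteq> {pathstart (linepath (b, - \<epsilon> * b / 128) (g, 1/4))}"
      by (simp add: L.half_def U.half_def closed_segment_commute)
  qed (use ne in auto)
  show "pathstart (group_arc \<epsilon> f b g) = (f, - (1/4))" "pathfinish (group_arc \<epsilon> f b g) = (g, 1/4)"
    by (simp_all add: group_arc_def)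
  show "\<bar>fst v\<bar> < 4 \<and> \<bar>snd v\<bar> \<le> 1/4 \<and> (\<bar>snd v\<bar> = 1/4 \<longrightarrow> v \<in> {(f, - (1/4)), (g, 1/4)})"
    if "v \<in> path_image (group_arc \<epsilon> f b g)"
    using that L.half_side(3-5)[of v f b] U.half_side(3-5)[of v g b] fbg
    unfolding group_arc_image[OF \<epsilon>] by auto
qed

lemma group_arc_disjoint:
  assumes \<epsilon>: "\<epsilon> = 1 \<or> \<epsilon> = -1" and less: "f < f'" "b < b'" "g < g'"
    and bounds: "\<bar>f\<bar> < 4" "\<bar>b\<bar> < 4" "\<bar>g\<bar> < 4" "\<bar>f'\<bar> < 4" "\<bar>b'\<bar> < 4" "\<bar>g'\<bar> < 4"
  shows "path_image (group_arc \<epsilon> f b g) \<inter> path_image (group_arc \<epsilon> f' b' g') = {}"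
proof -
  interpret L: signs \<epsilon> "-1" using \<epsilon> by unfold_locales auto
  interpret U: signs \<epsilon> 1 using \<epsilon> by unfold_locales auto
  have cross: "L.half p q \<inter> U.half p' q' = {}"
    if "q \<noteq> q'" "\<bar>p\<bar> < 4" "\<bar>q\<bar> < 4" "\<bar>p'\<bar> < 4" "\<bar>q'\<bar> < 4" for p q p' q'
  proof (rule ccontr)
    assume "L.half p q \<inter> U.half p' q' \<noteq> {}"
    then obtain v where v: "v \<in> L.half p q" "v \<in> U.half p' q'" by blast
    then have "side \<epsilon> 1 v = 0" "side \<epsilon> (-1) v = 0"
      using L.half_side(1)[of v p q] U.half_side(1)[of v p' q'] that side_minus[of \<epsilon> v] by auto
    then have "v = (q, - \<epsilon> * q / 128)" "v = (q', - \<epsilon> * q' / 128)"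
      using L.half_side(2)[of v p q] U.half_side(2)[of v p' q'] v that by auto
    then show False using that by simp
  qed
  show ?thesis
    using L.half_disjoint[of f f' b b'] U.half_disjoint[of g g' b b'] cross[of b b' f g'] cross[of b' b f' g]
      less bounds unfolding group_arc_image[OF \<epsilon>] by auto
qed

text \<open>Group arc \<open>i\<close> crosses the line at height \<open>- \<epsilon> w / 128\<close> at \<open>w = mark s t i\<close>: the \<open>s\<close>-group
  between \<open>y\<close> and \<open>x\<close>, the \<open>t\<close>-group to the right of both.\<close>

definition mark :: "nat \<Rightarrow> nat \<Rightarrow> nat \<Rightarrow> real" where
  "mark s t i = (if i \<le> s then - 1/2 + real i / real (s + 1) else 2 + real (i - s) / real (t + 1))"

text \<open>\<open>low\<close> means that the \<open>s\<close>-group precedes the block on the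
  circle in question. This happens when the block leads to \<open>x\<close>, that is for
  \<open>h * \<epsilon> = 1\<close>.\<close>

definition slot :: "nat \<Rightarrow> nat \<Rightarrow> bool \<Rightarrow> nat \<Rightarrow> nat" where
  "slot r s low i = (if low \<and> i \<le> s then i else 2 * r + 1 + i)"

text \<open>Every mark keeps distance at least 1/2 from the abscissas -1 and 1 of \<open>y\<close>
  and \<open>x\<close>, the margin demanded by \<open>sep_point\<close>.\<close>

lemma mark_bounds:
  "i \<le> s \<Longrightarrow> - 1/2 \<le> mark s t i \<and> mark s t i \<le> 1/2"
  "s < i \<Longrightarrow> i \<le> s + t \<Longrightarrow> 2 \<le> mark s t i \<and> mark s t i \<le> 3"
  by (simp_all add: mark_def field_simps)

lemma mark_abs: "i \<le> s + t \<Longrightarrow> \<bar>mark s t i\<bar> < 4"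
  using mark_bounds(1)[of i s t] mark_bounds(2)[of s i t] by (cases "i \<le> s") auto

lemma mark_less: "i < j \<Longrightarrow> j \<le> s + t \<Longrightarrow> mark s t i < mark s t j"
proof -
  assume ij: "i < j" "j \<le> s + t"
  show ?thesis
  proof (cases "i \<le> s \<and> s < j")
    case True
    then show ?thesis using mark_bounds(1)[of i s t] mark_bounds(2)[of s j t] ij by auto
  next
    case False
    then show ?thesis using ij by (auto simp: mark_def divide_strict_right_mono)
  qed
qed

lemma slot_less: "i < j \<Longrightarrow> slot r s low i < slot r s low j"
  by (simp add: slot_def)

lemma slot_range: "1 \<le> i \<Longrightarrow> i \<le> s + t \<Longrightarrow> 1 \<le> slot r s low i \<and> slot r s low i \<le> 2 * r + 1 + s + t"
  by (simp add: slot_def)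

lemma (in signs) block_group_disjoint:
  fixes r s t :: nat
  defines "n \<equiv> 2 * r + 1 + s + t" and "low \<equiv> h * \<epsilon> = 1"
  assumes k: "k \<in> {1..r + 1}" and i: "i \<in> {1..s + t}"
  shows "path_image (block_arc n r (if low then s else 0) k) \<inter> half (position n (slot r s low i)) (mark s t i) = {}"
proof (rule block_half_disjoint[where s = "if low \<and> i \<le> s then -1 else 1"])
  have n: "0 < n" by (simp add: n_def)
  have he: "h * \<epsilon> = (if low then 1 else -1)" using \<epsilon> h by (auto simp: low_def)
  show "0 < n" "k \<in> {1..r + 1}" using n k by auto
  show "(if low then s else 0) + (2 * r + 1) \<le> n" by (simp add: n_def)
  show "1/2 \<le> (if low \<and> i \<le> s then -1 else 1) * (mark s t i - h * \<epsilon>)"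
    using mark_bounds(1)[of i s t] mark_bounds(2)[of s i t] i unfolding he by (cases "i \<le> s") auto
  show "\<bar>mark s t i\<bar> < 4" using i mark_abs by simp
  show "\<bar>position n (slot r s low i)\<bar> < 4"
    using slot_range[of i s t r low] i by (intro position_bounds) (auto simp: n_def)
  have *: "position n (slot r s low i) < position n ((if low then s else 0) + j)" if "low \<and> i \<le> s" "1 \<le> j" for j
    using that by (intro position_less[OF n]) (simp add: slot_def)
  have **: "position n ((if low then s else 0) + j) < position n (slot r s low i)" if "\<not> (low \<and> i \<le> s)" "j \<le> 2 * r + 1" for j
    using that i by (intro position_less[OF n]) (auto simp: slot_def)
  show "0 < (if low \<and> i \<le> s then -1 else 1) * (position n (slot r s low i) - position n ((if low then s else 0) + 1))"
    using *[of 1] **[of 1] by auto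
  show "0 < (if low \<and> i \<le> s then -1 else 1) * (position n (slot r s low i) - position n ((if low then s else 0) + (2 * r + 1)))"
    using *[of "2 * r + 1"] **[of "2 * r + 1"] by auto
  show "(if low \<and> i \<le> s then -1 else 1) = 1 \<or> (if low \<and> i \<le> s then -1 else 1) = (-1 :: real)" by simp
qed

section \<open>The complete drawing in the rectangle\<close>

lemma off_ends:
  fixes P :: "(real \<times> real) set"
  assumes "\<And>v. v \<in> P \<Longrightarrow> \<bar>fst v\<bar> < 4 \<and> \<bar>snd v\<bar> \<le> 1/4 \<and> (\<bar>snd v\<bar> = 1/4 \<longrightarrow> v \<in> E)"
  shows "P - E \<subseteq> {-4<..<4} \<times> {- (1/4)<..<1/4::real}"
proof
  fix v assume v: "v \<in> P - E"
  then have "\<bar>fst v\<bar> < 4" "\<bar>snd v\<bar> < 1/4" using assms[of v] by auto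
  then have "- 4 < fst v" "fst v < 4" "- (1/4) < snd v" "snd v < 1/4" by linarith+
  then show "v \<in> {-4<..<4} \<times> {- (1/4)<..<1/4}" by (simp add: mem_Times_iff)
qed

lemma (in signs) block_arc_off_ends:
  assumes n: "0 < n" "o\<^sub>b + (2 * r + 1) \<le> n" and k: "k \<in> {1..r + 1}"
  defines "g \<equiv> block_arc n r o\<^sub>b k"
  shows "path_image g - {pathstart g, pathfinish g} \<subseteq> {-4<..<4} \<times> {- (1/4)<..<1/4}"
proof (rule off_ends)
  fix v assume "v \<in> path_image g"
  note p = block_arc_props(4)[OF n k this[unfolded g_def]]
  have "{(position n (o\<^sub>b + k), h/4), (position n (o\<^sub>b + (2 * r + 2 - k)), h/4)} \<subseteq> {pathstart g, pathfinish g}"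
  proof (cases "k \<le> r")
    case False
    then have "2 * r + 2 - k = k" using k by auto
    then show ?thesis using block_arc_props(2)[OF n k] by (simp add: g_def)
  qed (use block_arc_props(2,3)[OF n k] in \<open>simp add: g_def\<close>)
  then show "\<bar>fst v\<bar> < 4 \<and> \<bar>snd v\<bar> \<le> 1/4 \<and> (\<bar>snd v\<bar> = 1/4 \<longrightarrow> v \<in> {pathstart g, pathfinish g})"
    using p by blast
qed

lemma pairwise_UnI:
  assumes "pairwise R A" "pairwise R B" "\<And>x y. x \<in> A \<Longrightarrow> y \<in> B \<Longrightarrow> R x y \<and> R y x"
  shows "pairwise R (A \<union> B)"
  using assms unfolding pairwise_def by blast

lemma pairwise_imageI_nat:
  fixes f :: "nat \<Rightarrow> 'a"
  assumes "\<And>i j. i \<in> I \<Longrightarrow> j \<in> I \<Longrightarrow> i < j \<Longrightarrow> R (f i) (f j) \<and> R (f j) (f i)"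
  shows "pairwise R (f ` I)"
proof (rule pairwiseI)
  fix x y assume "x \<in> f ` I" "y \<in> f ` I" "x \<noteq> y"
  then obtain i j where "i \<in> I" "j \<in> I" "x = f i" "y = f j" "i \<noteq> j" by blast
  then show "R x y" using assms by (metis linorder_neqE_nat)
qed

text \<open>Pieces on different sides of the slanted line are separated by the sign of
  \<open>side\<close>. On the same side, two arcs of a block are separated by the gauge, and a group
  half from a block or another half by \<open>sep\<close>.\<close>

lemma rectangle_arcs_exist:
  assumes \<epsilon>: "\<epsilon> = 1 \<or> \<epsilon> = (-1 :: int)"
  shows "\<exists>A. rectangle_arcs r s t \<epsilon> (1/4) A"
proof -
  define e :: real where "e = of_int \<epsilon>"
  have e: "e = 1 \<or> e = -1" using \<epsilon> by (auto simp: e_def)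
  interpret F: signs e "-1" using e by unfold_locales auto
  interpret S: signs e 1 using e by unfold_locales auto
  define n where "n = 2 * r + 1 + s + t"
  have n: "0 < n" by (simp add: n_def)
  define aF where "aF = F.block_arc n r (if (-1) * e = 1 then s else 0)"
  define aS where "aS = S.block_arc n r (if 1 * e = 1 then s else 0)"
  define G where "G = (\<lambda>i. group_arc e (position n (slot r s ((-1) * e = 1) i)) (mark s t i)
    (position n (slot r s (1 * e = 1) i)))"
  have oF: "(if (-1) * e = 1 then s else 0) + (2 * r + 1) \<le> n"
    and oS: "(if 1 * e = 1 then s else 0) + (2 * r + 1) \<le> n" by (auto simp: n_def)
  note Fp = F.block_arc_props[OF n oF, folded aF_def]
  note Sp = S.block_arc_props[OF n oS, folded aS_def]
  have slot_bound: "\<bar>position n (slot r s low i)\<bar> < 4" if "i \<in> {1..s + t}" for low i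
    using slot_range[of i s t r low] that by (intro position_bounds) (auto simp: n_def)
  have Gb: "\<bar>position n (slot r s ((-1) * e = 1) i)\<bar> < 4" "\<bar>mark s t i\<bar> < 4"
    "\<bar>position n (slot r s (1 * e = 1) i)\<bar> < 4" if "i \<in> {1..s + t}" for i
    using slot_bound[OF that] mark_abs[of i s t] that by auto
  have Gp: "arc (G i)" "pathstart (G i) = (position n (slot r s ((-1) * e = 1) i), - (1/4))"
    "pathfinish (G i) = (position n (slot r s (1 * e = 1) i), 1/4)"
    "path_image (G i) - {pathstart (G i), pathfinish (G i)} \<subseteq> {-4<..<4} \<times> {- (1/4)<..<1/4}"
    if i: "i \<in> {1..s + t}" for i
  proof -
    have Gi: "G i = group_arc e (position n (slot r s ((-1) * e = 1) i)) (mark s t i)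
      (position n (slot r s (1 * e = 1) i))" by (simp add: G_def)
    note p = group_arc_props[OF e Gb[OF i], folded Gi]
    show "arc (G i)" "pathstart (G i) = (position n (slot r s ((-1) * e = 1) i), - (1/4))"
      "pathfinish (G i) = (position n (slot r s (1 * e = 1) i), 1/4)" by (rule p)+
    show "path_image (G i) - {pathstart (G i), pathfinish (G i)} \<subseteq> {-4<..<4} \<times> {- (1/4)<..<1/4}"
      unfolding p(2,3) by (rule off_ends) (rule p(4))
  qed
  have GI: "path_image (G i) = F.half (position n (slot r s ((-1) * e = 1) i)) (mark s t i) \<union>
    S.half (position n (slot r s (1 * e = 1) i)) (mark s t i)" for i
    unfolding G_def by (rule group_arc_image[OF e])
  define A where "A = aF ` {1..r + 1} \<union> aS ` {1..r + 1} \<union> G ` {1..s + t}"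
  have A: "A = aF ` {1..r + 1} \<union> aS ` {1..r + 1} \<union> G ` {1..s} \<union> (\<lambda>i. G (s + i)) ` {1..t}"
  proof -
    have "(+) s ` {1..t} = {s + 1..s + t}" by simp
    then have "{1..s + t} = {1..s} \<union> (+) s ` {1..t}" by auto
    then show ?thesis unfolding A_def by (simp only: image_Un image_image Un_assoc)
  qed
  have GF: "path_image (aF k) \<inter> path_image (G i) = {}" if k: "k \<in> {1..r + 1}" and i: "i \<in> {1..s + t}" for k i
  proof -
    have "v \<notin> S.half (position n (slot r s (1 * e = 1) i)) (mark s t i)" if v: "v \<in> path_image (aF k)" for v
    proof
      assume "v \<in> S.half (position n (slot r s (1 * e = 1) i)) (mark s t i)"
      then have "0 \<le> side e 1 v"
        by (rule S.half_side(1)[OF _ Gb(3)[OF i] Gb(2)[OF i]])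
      moreover have "0 < side e (-1) v" using Fp(4)[OF k v] by blast
      ultimately show False using side_minus[of e v] by simp
    qed
    then show ?thesis
      using F.block_group_disjoint[OF k i] unfolding GI aF_def n_def by blast
  qed
  have GS: "path_image (aS k) \<inter> path_image (G i) = {}" if k: "k \<in> {1..r + 1}" and i: "i \<in> {1..s + t}" for k i
  proof -
    have "v \<notin> F.half (position n (slot r s ((-1) * e = 1) i)) (mark s t i)" if v: "v \<in> path_image (aS k)" for v
    proof
      assume "v \<in> F.half (position n (slot r s ((-1) * e = 1) i)) (mark s t i)"
      then have "0 \<le> side e (-1) v"
        by (rule F.half_side(1)[OF _ Gb(1)[OF i] Gb(2)[OF i]])
      moreover have "0 < side e 1 v" using Sp(4)[OF k v] by blast
      ultimately show False using side_minus[of e v] by simp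
    qed
    then show ?thesis
      using S.block_group_disjoint[OF k i] unfolding GI aS_def n_def by blast
  qed
  have FS: "path_image (aF k) \<inter> path_image (aS m) = {}" if "k \<in> {1..r + 1}" "m \<in> {1..r + 1}" for k m
  proof (rule equals0I)
    fix v assume "v \<in> path_image (aF k) \<inter> path_image (aS m)"
    then have "0 < side e (-1) v" "0 < side e 1 v" using Fp(4)[OF that(1)] Sp(4)[OF that(2)] by blast+
    then show False using side_minus[of e v] by simp
  qed
  have FF: "path_image (aF k) \<inter> path_image (aF m) = {}" if "k \<in> {1..r + 1}" "m \<in> {1..r + 1}" "k < m" for k m
    unfolding aF_def using that by (intro F.block_disjoint[OF n oF]) auto
  have SS: "path_image (aS k) \<inter> path_image (aS m) = {}" if "k \<in> {1..r + 1}" "m \<in> {1..r + 1}" "k < m" for k m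
    unfolding aS_def using that by (intro S.block_disjoint[OF n oS]) auto
  have GG: "path_image (G i) \<inter> path_image (G j) = {}" if "i \<in> {1..s + t}" "j \<in> {1..s + t}" "i < j" for i j
    unfolding G_def using that Gb[OF that(1)] Gb[OF that(2)]
    by (intro group_arc_disjoint[OF e] position_less[OF n] slot_less mark_less) auto
  have pw: "pairwise (\<lambda>g h. disjnt (path_image g) (path_image h)) A"
    unfolding A_def
  proof (rule pairwise_UnI[OF pairwise_UnI[OF pairwise_imageI_nat pairwise_imageI_nat] pairwise_imageI_nat])
    fix g h assume "g \<in> aF ` {1..r + 1}" "h \<in> aS ` {1..r + 1}"
    then show "disjnt (path_image g) (path_image h) \<and> disjnt (path_image h) (path_image g)"
      using FS unfolding disjnt_def by blast
  next
    fix g h assume "g \<in> aF ` {1..r + 1} \<union> aS ` {1..r + 1}" "h \<in> G ` {1..s + t}"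
    then show "disjnt (path_image g) (path_image h) \<and> disjnt (path_image h) (path_image g)"
      using GF GS unfolding disjnt_def by blast
  next
    fix i j assume "i \<in> {1..r + 1}" "j \<in> {1..r + 1}" "i < j"
    then show "disjnt (path_image (aF i)) (path_image (aF j)) \<and> disjnt (path_image (aF j)) (path_image (aF i))"
      using FF unfolding disjnt_def by blast
  next
    fix i j assume "i \<in> {1..r + 1}" "j \<in> {1..r + 1}" "i < j"
    then show "disjnt (path_image (aS i)) (path_image (aS j)) \<and> disjnt (path_image (aS j)) (path_image (aS i))"
      using SS unfolding disjnt_def by blast
  next
    fix i j assume "i \<in> {1..s + t}" "j \<in> {1..s + t}" "i < j"
    then show "disjnt (path_image (G i)) (path_image (G j)) \<and> disjnt (path_image (G j)) (path_image (G i))"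
      using GG unfolding disjnt_def by blast
  qed
  have arcs: "arc g \<and> path_image g - {pathstart g, pathfinish g} \<subseteq> {-4<..<4} \<times> {- (1/4)<..<1/4}"
    if g: "g \<in> A" for g
  proof -
    consider k where "k \<in> {1..r + 1}" "g = aF k" | k where "k \<in> {1..r + 1}" "g = aS k"
      | i where "i \<in> {1..s + t}" "g = G i" using g unfolding A_def by blast
    then show ?thesis
    proof cases
      case (1 k)
      show ?thesis unfolding 1
        using Fp(1)[OF 1(1)] F.block_arc_off_ends[OF n oF 1(1), folded aF_def] by blast
    next
      case (2 k)
      show ?thesis unfolding 2
        using Sp(1)[OF 2(1)] S.block_arc_off_ends[OF n oS 2(1), folded aS_def] by blast
    next
      case (3 i)
      show ?thesis unfolding 3
        using Gp[OF 3(1)] by blast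
    qed
  qed
  have slots: "slot r s True i = i" "slot r s False i = 2 * r + 1 + i" if "i \<in> {1..s}" for i
    using that by (auto simp: slot_def)
  have slots': "slot r s low (s + i) = 2 * r + 1 + s + i" if "i \<in> {1..t}" for i low
    using that by (auto simp: slot_def)
  have Ge: "pathstart (G i) = (position n (slot r s ((-1) * e = 1) i), - (1/4))"
    "pathfinish (G i) = (position n (slot r s (1 * e = 1) i), 1/4)" if "i \<in> {1..s + t}" for i
    by (rule Gp[OF that])+
  have "group_arcs n t (2 * r + 1 + s) (2 * r + 1 + s) (1/4) (\<lambda>i. G (s + i))"
    unfolding group_arcs_def using Ge slots' by simp
  moreover have "if \<epsilon> = 1
         then block_arcs n r 0 (- (1/4)) (-1, 0) (1, 0) aF \<and> block_arcs n r s (1/4) (1, 0) (-1, 0) aS \<and>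
              group_arcs n s (2*r + 1) 0 (1/4) G
         else block_arcs n r s (- (1/4)) (1, 0) (-1, 0) aF \<and> block_arcs n r 0 (1/4) (-1, 0) (1, 0) aS \<and>
              group_arcs n s 0 (2*r + 1) (1/4) G"
  proof -
    have B: "block_arcs n r (if (-1) * e = 1 then s else 0) ((-1)/4) ((-1) * e, 0) (- ((-1) * e), 0) aF"
      "block_arcs n r (if 1 * e = 1 then s else 0) (1/4) (1 * e, 0) (- (1 * e), 0) aS"
      unfolding aF_def aS_def by (rule F.block_arcs_block_arc[OF n oF] S.block_arcs_block_arc[OF n oS])+
    have P: "pathstart (G i) = (position n (slot r s ((-1) * e = 1) i), - (1/4))"
      "pathfinish (G i) = (position n (slot r s (1 * e = 1) i), 1/4)" if "i \<in> {1..s}" for i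
      using Ge[of i] that by simp_all
    show ?thesis
    proof (cases "\<epsilon> = 1")
      case True
      then have "e = 1" by (simp add: e_def)
      then show ?thesis using B P slots True by (simp add: group_arcs_def)
    next
      case False
      then have "e = -1" using \<epsilon> by (simp add: e_def)
      then show ?thesis using B P slots False by (simp add: group_arcs_def)
    qed
  qed
  ultimately show ?thesis
    unfolding rectangle_arcs_def Let_def n_def[symmetric]
    by (intro exI[of _ A] exI[of _ aF] exI[of _ aS] exI[of _ G] exI[of _ "\<lambda>i. G (s + i)"] conjI ballI A arcs pw) simp_all
qed

section \<open>Assembling the curve\<close>

text \<open>\<open>R v\<close> and \<open>T v\<close> are the rectangle piece and the annulus piece
  at \<open>v\<close>. Along the walk they alternate and form a chain. By \<open>RT\<close> pieces
  of different kinds meet only at shared ends, and by injectivity of \<open>w\<close> only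
  consecutive pieces share one. \<open>M\<close> is odd because the walk begins and ends with an
  annulus step.\<close>

lemma walk_simple_arc:
  fixes R T :: "'v \<Rightarrow> 'p set" and q :: "'v \<Rightarrow> 'p" and w :: "nat \<Rightarrow> 'v"
  assumes M: "odd M" and inj: "inj_on w {..M}" and V: "\<And>i. i \<le> M \<Longrightarrow> w i \<in> V"
    and A: "\<And>m. even m \<Longrightarrow> m < M \<Longrightarrow> A (w m) = w (Suc m)"
    and P: "\<And>m. odd m \<Longrightarrow> m < M \<Longrightarrow> P (w m) = w (Suc m)"
    and P_ends: "P (w 0) = w 0" "P (w M) = w M"
    and P_inv: "\<And>v. v \<in> V \<Longrightarrow> P (P v) = v" and A_inv: "\<And>v. v \<in> V \<Longrightarrow> A (A v) = v"
    and R_arc: "\<And>v. v \<in> V \<Longrightarrow> P v \<noteq> v \<Longrightarrow> simple_arc_in X (R v) (q v) (q (P v))"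
    and T_arc: "\<And>v. v \<in> V \<Longrightarrow> simple_arc_in X (T v) (q v) (q (A v))"
    and ends: "simple_arc_in X (R (w 0)) x (q (w 0))" "simple_arc_in X (R (w M)) (q (w M)) y"
    and RR: "\<And>v u. v \<in> V \<Longrightarrow> u \<in> V \<Longrightarrow> u \<noteq> v \<Longrightarrow> u \<noteq> P v \<Longrightarrow> R v \<inter> R u = {}"
    and TT: "\<And>v u. v \<in> V \<Longrightarrow> u \<in> V \<Longrightarrow> u \<noteq> v \<Longrightarrow> u \<noteq> A v \<Longrightarrow> T v \<inter> T u = {}"
    and RT: "\<And>v u. v \<in> V \<Longrightarrow> u \<in> V \<Longrightarrow> R v \<inter> T u \<subseteq> q ` ({v, P v} \<inter> {u, A u})"
    and RP: "\<And>v. v \<in> V \<Longrightarrow> R (P v) = R v" and TA: "\<And>v. v \<in> V \<Longrightarrow> T (A v) = T v"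
  shows "simple_arc_in X (\<Union>v\<in>w ` {..M}. R v \<union> T v) x y"
proof -
  \<comment> \<open>Piece \<open>m\<close> runs from \<open>p m\<close> to \<open>p (Suc m)\<close>.
    The truncated subtraction makes \<open>E 0\<close> the rectangle piece at \<open>w 0\<close>,
    which comes from \<open>x\<close>; the last piece \<open>E (Suc M)\<close> leads from
    \<open>w M\<close> to \<open>y\<close>.\<close>
  define E where "E m = (if even m then R (w (m - 1)) else T (w (m - 1)))" for m
  define p where "p m = (if m = 0 then x else if m \<le> Suc M then q (w (m - 1)) else y)" for m
  have eq: "w i = w j \<longleftrightarrow> i = j" if "i \<le> M" "j \<le> M" for i j
    using inj_on_eq_iff[OF inj] that by simp
  have Pw: "P (w m) = (if odd m then if m = M then w M else w (Suc m) else if m = 0 then w 0 else w (m - 1))"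
    if "m \<le> M" for m
  proof (cases "odd m")
    case False
    have "P (w m) = w (m - 1)" if "m \<noteq> 0"
      using P[of "m - 1"] P_inv[OF V, of "m - 1"] \<open>m \<le> M\<close> that False by simp
    then show ?thesis using False P_ends by auto
  qed (use P P_ends that in auto)
  have Aw: "A (w m) = (if even m then w (Suc m) else w (m - 1))" if "m \<le> M" for m
  proof (cases "even m")
    case True
    then show ?thesis using A[of m] M that by (metis le_neq_implies_less)
  next
    case False
    then show ?thesis using A[of "m - 1"] A_inv[OF V, of "m - 1"] that by (cases m) auto
  qed
  have Ew: "E m = R (w m)" if "even m" "m \<le> M" for m
  proof (cases m)
    case (Suc k)
    then show ?thesis using that P[of k] RP[OF V, of k] by (simp add: E_def)
  qed (simp add: E_def)
  have "simple_arc_in X (\<Union>m\<le>Suc M. E m) (p 0) (p (Suc (Suc M)))"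
  proof (rule simple_arc_in_chain)
    show "simple_arc_in X (E m) (p m) (p (Suc m))" if "m \<le> Suc M" for m
    proof (cases "m = 0 \<or> m = Suc M")
      case True
      then show ?thesis using ends M by (auto simp: E_def p_def)
    next
      case False
      then have m: "0 < m" "m \<le> M" "m - 1 < M" "Suc (m - 1) = m" using that by auto
      have pm: "p m = q (w (m - 1))" "p (Suc m) = q (w m)" using m(1,2) by (auto simp: p_def)
      show ?thesis
      proof (cases "even m")
        case True
        have "P (w (m - 1)) = w m" using P[of "m - 1"] m True by simp
        moreover have "w m \<noteq> w (m - 1)" using eq[of m "m - 1"] m by simp
        ultimately show ?thesis
          using R_arc[OF V, of "m - 1"] m True pm by (simp add: E_def)
      next
        case odd: False
        have "A (w (m - 1)) = w m" using A[of "m - 1"] m odd by simp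
        then show ?thesis using T_arc[OF V, of "m - 1"] m odd pm by (simp add: E_def)
      qed
    qed
    have cross: "E i \<inter> E j \<subseteq> (if j = Suc i then {p j} else {})" if ij: "i < j" "j \<le> Suc M" for i j
    proof -
      have j: "1 \<le> j" "j - 1 \<le> M" "i \<le> M" "i \<le> j - 1" using ij by auto
      consider "even i" "even j" | "odd i" "odd j" | "even i" "odd j" | "odd i" "even j" by blast
      then show ?thesis
      proof cases
        case 1
        have ne: "i < j - 1" using 1 ij by (metis Suc_lessI Suc_diff_1 even_Suc j(1) less_Suc_eq_le not_less_eq le_eq_less_or_eq not_one_le_zero gr0I)
        have "R (w i) \<inter> R (w (j - 1)) = {}"
          by (rule RR) (use V j eq ne 1 Pw[of i] in \<open>auto split: if_splits\<close>)
        then show ?thesis using Ew[of i] 1 j by (simp add: E_def)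
      next
        case 2
        then have i: "1 \<le> i" "even (i - 1)" by (auto simp: odd_pos Suc_leI)
        have "i < j - 1" using 2 ij j by (metis One_nat_def Suc_lessI Suc_pred even_Suc le_neq_implies_less less_Suc_eq_le not_less odd_pos)
        then have "T (w (i - 1)) \<inter> T (w (j - 1)) = {}"
          by (intro TT) (use V j eq 2 i Aw[of "i - 1"] in auto)
        then show ?thesis using 2 by (simp add: E_def)
      next
        case 3
        have "R (w i) \<inter> T (w (j - 1)) \<subseteq> q ` ({w i, P (w i)} \<inter> {w (j - 1), A (w (j - 1))})"
          by (rule RT) (use V j in auto)
        also have "{w i, P (w i)} = w ` {i - 1, i}" using Pw[of i] 3 j by auto
        also have "{w (j - 1), A (w (j - 1))} = w ` {j - 1, j}" using Aw[of "j - 1"] 3 j by auto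
        also have "w ` {i - 1, i} \<inter> w ` {j - 1, j} = w ` ({i - 1, i} \<inter> {j - 1, j})"
        proof (rule inj_on_image_Int[OF inj, symmetric])
          have "j \<noteq> Suc M" using M 3 by auto
          then show "{j - 1, j} \<subseteq> {..M}" using ij by auto
        qed (use j in auto)
        also have "{i - 1, i} \<inter> {j - 1, j} = (if j = Suc i then {i} else {})" using ij by auto
        finally have "R (w i) \<inter> T (w (j - 1)) \<subseteq> (if j = Suc i then {p j} else {})"
          using ij by (auto simp: p_def)
        then show ?thesis using Ew[of i] 3 j by (simp add: E_def)
      next
        case 4
        then have i: "1 \<le> i" "even (i - 1)" by (auto simp: odd_pos Suc_leI)
        have "R (w (j - 1)) \<inter> T (w (i - 1)) \<subseteq> q ` ({w (j - 1), P (w (j - 1))} \<inter> {w (i - 1), A (w (i - 1))})"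
          by (rule RT) (use V j in auto)
        \<comment> \<open>Here \<open>j\<close> may be \<open>Suc M\<close>, where \<open>P\<close>
          fixes \<open>w M\<close>; the minimum keeps the index in the range on which
          \<open>w\<close> is injective.\<close>
        also have "{w (j - 1), P (w (j - 1))} = w ` {j - 1, min j M}" using Pw[of "j - 1"] 4 ij j by auto
        also have "{w (i - 1), A (w (i - 1))} = w ` {i - 1, i}" using Aw[of "i - 1"] i j by auto
        also have "w ` {j - 1, min j M} \<inter> w ` {i - 1, i} = w ` ({j - 1, min j M} \<inter> {i - 1, i})"
          by (rule inj_on_image_Int[OF inj, symmetric]) (use j in auto)
        also have "{j - 1, min j M} \<inter> {i - 1, i} = (if j = Suc i then {i} else {})"
          using ij j by auto
        finally have "R (w (j - 1)) \<inter> T (w (i - 1)) \<subseteq> (if j = Suc i then {p j} else {})"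
          using ij by (auto simp: p_def)
        then show ?thesis using 4 by (auto simp: E_def)
      qed
    qed
    show "E i \<inter> E (Suc i) \<subseteq> {p (Suc i)}" if "i < Suc M" for i
      using cross[of i "Suc i"] that by simp
    show "E i \<inter> E j = {}" if "j \<le> Suc M" "Suc i < j" for i j
      using cross[of i j] that by simp
  qed
  moreover have "(\<Union>m\<le>Suc M. E m) = (\<Union>v\<in>w ` {..M}. R v \<union> T v)"
  proof
    have "E m \<subseteq> R (w (m - 1)) \<union> T (w (m - 1))" for m by (simp add: E_def)
    moreover have "w (m - 1) \<in> w ` {..M}" if "m \<le> Suc M" for m using that by auto
    ultimately show "(\<Union>m\<le>Suc M. E m) \<subseteq> (\<Union>v\<in>w ` {..M}. R v \<union> T v)" by blast
    have "R (w m) \<subseteq> (\<Union>m\<le>Suc M. E m) \<and> T (w m) \<subseteq> (\<Union>m\<le>Suc M. E m)" if m: "m \<le> M" for m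
    proof (cases "even m")
      case True
      then have "E m = R (w m)" "E (Suc m) = T (w m)" using Ew m by (auto simp: E_def)
      then show ?thesis using m by (metis UN_upper atMost_iff Suc_le_mono le_SucI)
    next
      case False
      then have "E (Suc m) = R (w m)" "E m = T (w m)"
        using TA[OF V, of m] Aw[OF m] m by (auto simp: E_def)
      then show ?thesis using m by (metis UN_upper atMost_iff Suc_le_mono le_SucI)
    qed
    then show "(\<Union>v\<in>w ` {..M}. R v \<union> T v) \<subseteq> (\<Union>m\<le>Suc M. E m)" by blast
  qed
  ultimately show ?thesis by (simp add: p_def)
qed

section \<open>Rectangle arcs labelled by their ends\<close>

definition vertex :: "nat \<Rightarrow> int \<Rightarrow> real \<Rightarrow> int \<times> bool \<Rightarrow> real \<times> real" where
  "vertex n \<epsilon> \<eta> = (\<lambda>(k, b). (position n (nat k), if b \<longleftrightarrow> \<epsilon> = 1 then \<eta> else - \<eta>))"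

lemma vertex_int: "vertex n \<epsilon> \<eta> (int k, b) = (position n k, if b \<longleftrightarrow> \<epsilon> = 1 then \<eta> else - \<eta>)"
  by (simp add: vertex_def)

lemma vertex_cases:
  fixes r s t :: nat
  assumes "v \<in> {1..int (2 * r + 1 + s + t)} \<times> (UNIV :: bool set)"
  obtains (block0) i where "i \<in> {1..2 * r + 1}" "v = (int i, False)"
  | (block1) i where "i \<in> {1..2 * r + 1}" "v = (int (s + i), True)"
  | (s0) i where "i \<in> {1..s}" "v = (int (2 * r + 1 + i), False)"
  | (s1) i where "i \<in> {1..s}" "v = (int i, True)"
  | (t0) i where "i \<in> {1..t}" "v = (int (2 * r + 1 + s + i), False)"
  | (t1) i where "i \<in> {1..t}" "v = (int (2 * r + 1 + s + i), True)"
proof -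
  obtain k b where v: "v = (int k, b)" "1 \<le> k" "k \<le> 2 * r + 1 + s + t"
  proof -
    obtain k' b where "v = (k', b)" "1 \<le> k'" "k' \<le> int (2 * r + 1 + s + t)"
      using assms by (metis SigmaE atLeastAtMost_iff)
    then show ?thesis using that[of "nat k'" b] by simp
  qed
  show ?thesis
  proof (cases b)
    case True
    consider "k \<le> s" | "s < k" "k \<le> s + (2 * r + 1)" | "s + (2 * r + 1) < k" by linarith
    then show ?thesis
    proof cases
      case 1
      then show ?thesis using v True by (intro s1[of k]) auto
    next
      case 2
      then show ?thesis using v True by (intro block1[of "k - s"]) auto
    next
      case 3
      then show ?thesis using v True by (intro t1[of "k - (2 * r + 1 + s)"]) auto
    qed
  next
    case False
    consider "k \<le> 2 * r + 1" | "2 * r + 1 < k" "k \<le> 2 * r + 1 + s" | "2 * r + 1 + s < k" by linarith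
    then show ?thesis
    proof cases
      case 1
      then show ?thesis using v False by (intro block0[of k]) auto
    next
      case 2
      then show ?thesis using v False by (intro s0[of "k - (2 * r + 1)"]) auto
    next
      case 3
      then show ?thesis using v False by (intro t0[of "k - (2 * r + 1 + s)"]) auto
    qed
  qed
qed

lemma rect_map_values:
  fixes r s i :: nat
  defines "P \<equiv> rect_map (2 * int r + 1) (int s)"
  shows "i \<in> {1..2 * r + 1} \<Longrightarrow> P (int i, False) = (int (2 * r + 2 - i), False)"
    and "i \<in> {1..2 * r + 1} \<Longrightarrow> P (int (s + i), True) = (int (s + (2 * r + 2 - i)), True)"
    and "i \<in> {1..s} \<Longrightarrow> P (int (2 * r + 1 + i), False) = (int i, True)"
    and "i \<in> {1..s} \<Longrightarrow> P (int i, True) = (int (2 * r + 1 + i), False)"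
    and "1 \<le> i \<Longrightarrow> P (int (2 * r + 1 + s + i), False) = (int (2 * r + 1 + s + i), True)"
    and "1 \<le> i \<Longrightarrow> P (int (2 * r + 1 + s + i), True) = (int (2 * r + 1 + s + i), False)"
  by (auto simp: P_def rect_map_def of_nat_diff)

text \<open>Passes from the list of arcs by kind to a labelling by vertices: an arc between two
  positions carries both as labels, a middle arc only one, its other end being \<open>x\<close> or
  \<open>y\<close>. Naming the families \<open>a0\<close>, \<open>a1\<close> by circle order instead
  of by height absorbs the sign \<epsilon>.\<close>

lemma rectangle_arcs_by_vertex:
  fixes r s t :: nat and \<epsilon> :: int
  defines "n \<equiv> 2 * r + 1 + s + t" and "P \<equiv> rect_map (2 * int r + 1) (int s)"
  defines "V \<equiv> {1..int n} \<times> (UNIV :: bool set)"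
  assumes A: "rectangle_arcs r s t \<epsilon> \<eta> A" and \<epsilon>: "\<epsilon> = 1 \<or> \<epsilon> = -1"
  obtains R where "R ` V = A" "\<And>v. v \<in> V \<Longrightarrow> R (P v) = R v"
    "\<And>v. v \<in> V \<Longrightarrow> P v \<noteq> v \<Longrightarrow>
      {pathstart (R v), pathfinish (R v)} = {vertex n \<epsilon> \<eta> v, vertex n \<epsilon> \<eta> (P v)}"
    "pathstart (R (int (s + (r + 1)), True)) = vertex n \<epsilon> \<eta> (int (s + (r + 1)), True)"
    "pathfinish (R (int (s + (r + 1)), True)) = (1, 0)"
    "pathstart (R (int (r + 1), False)) = vertex n \<epsilon> \<eta> (int (r + 1), False)"
    "pathfinish (R (int (r + 1), False)) = (- 1, 0)"
proof -
  obtain aF aS b c where Aeq: "A = aF ` {1..r + 1} \<union> aS ` {1..r + 1} \<union> b ` {1..s} \<union> c ` {1..t}"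
    and bl: "if \<epsilon> = 1
         then block_arcs n r 0 (-\<eta>) (-1, 0) (1, 0) aF \<and> block_arcs n r s \<eta> (1, 0) (-1, 0) aS \<and>
              group_arcs n s (2*r + 1) 0 \<eta> b
         else block_arcs n r s (-\<eta>) (1, 0) (-1, 0) aF \<and> block_arcs n r 0 \<eta> (-1, 0) (1, 0) aS \<and>
              group_arcs n s 0 (2*r + 1) \<eta> b"
    and gc: "group_arcs n t (2*r + 1 + s) (2*r + 1 + s) \<eta> c"
    using A unfolding rectangle_arcs_def Let_def n_def by blast
  define a0 where "a0 = (if \<epsilon> = 1 then aF else aS)"
  define a1 where "a1 = (if \<epsilon> = 1 then aS else aF)"
  let ?x = "vertex n \<epsilon> \<eta>"
  have Aeq': "A = a0 ` {1..r + 1} \<union> a1 ` {1..r + 1} \<union> b ` {1..s} \<union> c ` {1..t}"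
    unfolding Aeq a0_def a1_def by (simp add: Un_ac)
  have B0: "block_arcs n r 0 (if False \<longleftrightarrow> \<epsilon> = 1 then \<eta> else - \<eta>) (-1, 0) (1, 0) a0"
    and B1: "block_arcs n r s (if True \<longleftrightarrow> \<epsilon> = 1 then \<eta> else - \<eta>) (1, 0) (-1, 0) a1"
    using bl by (cases "\<epsilon> = 1"; simp add: a0_def a1_def)+
  have a0: "pathstart (a0 i) = ?x (int i, False)" "pathfinish (a0 i) = ?x (int (2 * r + 2 - i), False)"
    if "i \<in> {1..r}" for i
    using B0 that unfolding block_arcs_def vertex_int add_0_left by blast+
  have a1: "pathstart (a1 i) = ?x (int (s + i), True)" "pathfinish (a1 i) = ?x (int (s + (2 * r + 2 - i)), True)"
    if "i \<in> {1..r}" for i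
    using B1 that unfolding block_arcs_def vertex_int by blast+
  have m0: "pathstart (a0 (r + 1)) = ?x (int (r + 1), False)" "pathfinish (a0 (r + 1)) = (- 1, 0)"
    using B0 unfolding block_arcs_def vertex_int add_0_left by blast+
  have m1: "pathstart (a1 (r + 1)) = ?x (int (s + (r + 1)), True)" "pathfinish (a1 (r + 1)) = (1, 0)"
    using B1 unfolding block_arcs_def vertex_int by blast+
  have bb: "{pathstart (b i), pathfinish (b i)} = {?x (int (2 * r + 1 + i), False), ?x (int i, True)}"
    if "i \<in> {1..s}" for i
    using bl that unfolding group_arcs_def vertex_int by (cases "\<epsilon> = 1") auto
  have cc: "{pathstart (c i), pathfinish (c i)}
      = {?x (int (2 * r + 1 + s + i), False), ?x (int (2 * r + 1 + s + i), True)}"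
    if "i \<in> {1..t}" for i
    using gc that unfolding group_arcs_def vertex_int by (cases "\<epsilon> = 1") auto
  \<comment> \<open>The arc at position \<open>k\<close> of a block is numbered by the smaller of
    \<open>k\<close> and its partner \<open>2 * r + 2 - k\<close>.\<close>
  define fold where "fold k = (if k \<le> r + 1 then k else 2 * r + 2 - k)" for k
  define R where "R = (\<lambda>(k', d). let k = nat k' in if d
     then (if k \<le> s then b k else if k \<le> s + (2 * r + 1) then a1 (fold (k - s))
       else c (k - (2 * r + 1 + s)))
     else (if k \<le> 2 * r + 1 then a0 (fold k) else if k \<le> 2 * r + 1 + s then b (k - (2 * r + 1))
       else c (k - (2 * r + 1 + s))))"
  have Rv: "i \<in> {1..2 * r + 1} \<Longrightarrow> R (int i, False) = a0 (fold i)"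
    "i \<in> {1..2 * r + 1} \<Longrightarrow> R (int (s + i), True) = a1 (fold i)"
    "i \<in> {1..s} \<Longrightarrow> R (int (2 * r + 1 + i), False) = b i"
    "i \<in> {1..s} \<Longrightarrow> R (int i, True) = b i"
    "1 \<le> i \<Longrightarrow> R (int (2 * r + 1 + s + i), False) = c i"
    "1 \<le> i \<Longrightarrow> R (int (2 * r + 1 + s + i), True) = c i" for i
    unfolding R_def prod.case Let_def nat_int by simp_all
  note Pv = rect_map_values[where r = r and s = s, folded P_def]
  have fold_range: "fold k \<in> {1..r + 1}" if "k \<in> {1..2 * r + 1}" for k
    using that by (auto simp: fold_def)
  have fold_flip: "fold (2 * r + 2 - k) = fold k" if "k \<in> {1..2 * r + 1}" for k
    using that by (auto simp: fold_def)
  show ?thesis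
  proof (rule that[of R])
    show "R (P v) = R v" if "v \<in> V" for v
      using that[unfolded V_def n_def]
    proof (cases rule: vertex_cases)
      case (block0 i)
      then have "2 * r + 2 - i \<in> {1..2 * r + 1}" by auto
      then show ?thesis using block0 fold_flip[of i] by (simp only: Pv Rv)
    next
      case (block1 i)
      then have "2 * r + 2 - i \<in> {1..2 * r + 1}" by auto
      then show ?thesis using block1 fold_flip[of i] by (simp only: Pv Rv)
    next
      case (s0 i)
      then show ?thesis by (simp only: Pv Rv)
    next
      case (s1 i)
      then show ?thesis by (simp only: Pv Rv)
    next
      case (t0 i)
      then show ?thesis by (simp only: Pv Rv atLeastAtMost_iff)
    next
      case (t1 i)
      then show ?thesis by (simp only: Pv Rv atLeastAtMost_iff)
    qed
    show "{pathstart (R v), pathfinish (R v)} = {?x v, ?x (P v)}" if v: "v \<in> V" "P v \<noteq> v" for v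
      using v(1)[unfolded V_def n_def]
    proof (cases rule: vertex_cases)
      case (block0 i)
      then have "2 * r + 2 - i \<noteq> i" using v(2) Pv(1)[of i] by auto
      then consider "i \<in> {1..r}" | "2 * r + 2 - i \<in> {1..r}" "r + 1 < i" using block0(1) by fastforce
      then show ?thesis
      proof cases
        case 1
        then show ?thesis using block0 a0[of i] by (simp only: Pv Rv fold_def) simp
      next
        case 2
        then have "fold i = 2 * r + 2 - i" "2 * r + 2 - (2 * r + 2 - i) = i" using block0 by (auto simp: fold_def)
        then show ?thesis using block0 a0[OF 2(1)] by (simp only: Pv Rv insert_commute)
      qed
    next
      case (block1 i)
      then have "2 * r + 2 - i \<noteq> i" using v(2) Pv(2)[of i] by auto
      then consider "i \<in> {1..r}" | "2 * r + 2 - i \<in> {1..r}" "r + 1 < i" using block1(1) by fastforce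
      then show ?thesis
      proof cases
        case 1
        then show ?thesis using block1 a1[of i] by (simp only: Pv Rv fold_def) simp
      next
        case 2
        then have "fold i = 2 * r + 2 - i" "2 * r + 2 - (2 * r + 2 - i) = i" using block1 by (auto simp: fold_def)
        then show ?thesis using block1 a1[OF 2(1)] by (simp only: Pv Rv insert_commute)
      qed
    next
      case (s0 i)
      then show ?thesis using bb[of i] by (simp only: Pv Rv)
    next
      case (s1 i)
      then show ?thesis using bb[of i] by (simp only: Pv Rv insert_commute)
    next
      case (t0 i)
      then show ?thesis using cc[of i] by (simp only: Pv Rv atLeastAtMost_iff)
    next
      case (t1 i)
      then show ?thesis using cc[of i] by (simp only: Pv Rv atLeastAtMost_iff insert_commute)
    qed
    show "R ` V = A"
    proof
      show "R ` V \<subseteq> A"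
      proof
        fix g assume "g \<in> R ` V"
        then obtain v where v: "v \<in> V" "g = R v" by blast
        from v(1)[unfolded V_def n_def] show "g \<in> A"
        proof (cases rule: vertex_cases)
          case (block0 i)
          then show ?thesis unfolding Aeq' v(2) using fold_range[of i] Rv(1)[of i] by simp
        next
          case (block1 i)
          then show ?thesis unfolding Aeq' v(2) using fold_range[of i] Rv(2)[of i] by simp
        next
          case (s0 i)
          then show ?thesis unfolding Aeq' v(2) using Rv(3)[of i] by simp
        next
          case (s1 i)
          then show ?thesis unfolding Aeq' v(2) using Rv(4)[of i] by simp
        next
          case (t0 i)
          then show ?thesis unfolding Aeq' v(2) using Rv(5)[of i] by simp
        next
          case (t1 i)
          then show ?thesis unfolding Aeq' v(2) using Rv(6)[of i] by simp
        qed
      qed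
      have inV: "(int k, d) \<in> V" if "1 \<le> k" "k \<le> n" for k d using that by (simp add: V_def)
      have "a0 i \<in> R ` V \<and> a1 i \<in> R ` V" if "i \<in> {1..r + 1}" for i
      proof -
        have "a0 i = R (int i, False)" "a1 i = R (int (s + i), True)"
          using that Rv(1,2)[of i] by (simp_all add: fold_def)
        then show ?thesis using inV[of i False] inV[of "s + i" True] that by (auto simp: n_def)
      qed
      moreover have "b i \<in> R ` V" if "i \<in> {1..s}" for i
        using Rv(4)[of i] inV[of i True] that by (metis (no_types, lifting) atLeastAtMost_iff imageI n_def trans_le_add1 trans_le_add2)
      moreover have "c i \<in> R ` V" if "i \<in> {1..t}" for i
        using Rv(5)[of i] inV[of "2 * r + 1 + s + i" False] that by (metis atLeastAtMost_iff imageI n_def add_left_mono trans_le_add2)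
      ultimately show "A \<subseteq> R ` V" unfolding Aeq' by blast
    qed
    have "R (int (s + (r + 1)), True) = a1 (r + 1)" "R (int (r + 1), False) = a0 (r + 1)"
      using Rv(1,2)[of "r + 1"] by (simp_all add: fold_def)
    then show "pathstart (R (int (s + (r + 1)), True)) = ?x (int (s + (r + 1)), True)"
      "pathfinish (R (int (s + (r + 1)), True)) = (1, 0)"
      "pathstart (R (int (r + 1), False)) = ?x (int (r + 1), False)"
      "pathfinish (R (int (r + 1), False)) = (- 1, 0)"
      using m0 m1 by (simp_all only:)
  qed
qed

section \<open>Rectangle and annulus on the torus\<close>

lemma torus_pt_annulus: "0 \<le> z \<Longrightarrow> z < 1 \<Longrightarrow> torus_pt (w, z) = (circ_pt w, z)"
  by (simp add: torus_pt_def frac_eq)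

lemma torus_pt_rectangle:
  assumes "- 4 < w" "w < 4" "- (1/2) < z" "z < 1/2"
  shows "torus_pt (w, z) = (w, if z < 0 then z + 1 else z)"
proof -
  have "frac z = (if z < 0 then z + 1 else z)"
  proof (cases "z < 0")
    case True
    then have "\<lfloor>z\<rfloor> = -1" using assms by (simp add: floor_eq_iff)
    then show ?thesis using True by (simp add: frac_def)
  qed (use assms in \<open>simp add: frac_eq\<close>)
  then show ?thesis using assms by (simp add: torus_pt_def circ_pt_id)
qed

lemma inj_on_torus_pt_rectangle:
  assumes "\<eta> < 1/2"
  shows "inj_on torus_pt ({-4<..<4} \<times> {-\<eta>..\<eta>})"
proof (rule inj_onI)
  fix u v assume uv: "u \<in> {-4<..<4} \<times> {-\<eta>..\<eta>}" "v \<in> {-4<..<4} \<times> {-\<eta>..\<eta>}" "torus_pt u = torus_pt v"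
  have t: "torus_pt u = (fst u, if snd u < 0 then snd u + 1 else snd u)"
    "torus_pt v = (fst v, if snd v < 0 then snd v + 1 else snd v)"
    using torus_pt_rectangle[of "fst u" "snd u"] torus_pt_rectangle[of "fst v" "snd v"] uv(1,2) assms
    by (auto simp: mem_Times_iff)
  have "- \<eta> \<le> snd u" "snd u \<le> \<eta>" "- \<eta> \<le> snd v" "snd v \<le> \<eta>" using uv(1,2) by (auto simp: mem_Times_iff)
  then have "fst u = fst v \<and> snd u = snd v" using uv(3) assms unfolding t by (auto split: if_splits)
  then show "u = v" by (simp add: prod_eq_iff)
qed

lemma position_shift_inj:
  assumes "j \<in> {1..n}" "k \<in> {1..n}" "circ_pt (position n j - x) = circ_pt (position n k - x)"
  shows "j = k"
proof -
  have n: "0 < n" using assms by auto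
  obtain m where "(position n j - x) - (position n k - x) = 8 * of_int m"
    using assms(3) unfolding circ_pt_eq_iff by blast
  then have "real j - real k = real n * of_int m" using n by (simp add: position_def field_simps)
  then have "real_of_int (int j - int k) = real_of_int (int n * m)" by simp
  then have e: "int j - int k = int n * m" by (simp only: of_int_eq_iff)
  have "\<bar>int j - int k\<bar> < int n" using assms by auto
  then have "\<bar>int n * m\<bar> < int n * 1" unfolding e by simp
  then have "\<bar>m\<bar> < 1" using n by (simp add: abs_mult)
  then show ?thesis using e by simp
qed

lemma annulus_arcE:
  assumes "v \<in> annulus_arc n \<rho> \<eta> j" "0 < \<eta>" "\<eta> < 1/2"
  obtains x where "0 \<le> x" "x \<le> 1" "torus_pt v = (circ_pt (position n j - x * (8 * of_int \<rho> / real n)), \<eta> + x * (1 - 2 * \<eta>))"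
    "v = (position n j - x * (8 * of_int \<rho> / real n), \<eta> + x * (1 - 2 * \<eta>))"
proof -
  obtain x where x: "0 \<le> x" "x \<le> 1"
    "v = (1 - x) *\<^sub>R (position n j, \<eta>) + x *\<^sub>R (position n j - 8 * of_int \<rho> / real n, 1 - \<eta>)"
    using assms(1) by (auto simp: annulus_arc_def closed_segment_def)
  have v: "v = (position n j - x * (8 * of_int \<rho> / real n), \<eta> + x * (1 - 2 * \<eta>))"
    unfolding x(3) by (simp add: algebra_simps)
  have "x * (1 - 2 * \<eta>) \<le> 1 - 2 * \<eta>" using x assms by (intro mult_left_le_one_le) auto
  moreover have "0 \<le> x * (1 - 2 * \<eta>)" using x assms by simp
  ultimately have "0 \<le> \<eta> + x * (1 - 2 * \<eta>)" "\<eta> + x * (1 - 2 * \<eta>) < 1" using assms by argo+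
  from torus_pt_annulus[OF this]
  have "torus_pt v = (circ_pt (position n j - x * (8 * of_int \<rho> / real n)), \<eta> + x * (1 - 2 * \<eta>))"
    unfolding v .
  then show ?thesis by (rule that[OF x(1,2) _ v])
qed

text \<open>The height determines the parameter, so two strands could meet only at equal parameters;
  there both are rotated by the same amount, and their distinct positions remain distinct modulo
  8.\<close>

lemma annulus_arc_disjoint:
  assumes "0 < \<eta>" "\<eta> < 1/2" "j \<in> {1..n}" "k \<in> {1..n}" "j \<noteq> k"
  shows "torus_pt ` annulus_arc n \<rho> \<eta> j \<inter> torus_pt ` annulus_arc n \<rho> \<eta> k = {}"
proof (rule equals0I)
  fix p assume "p \<in> torus_pt ` annulus_arc n \<rho> \<eta> j \<inter> torus_pt ` annulus_arc n \<rho> \<eta> k"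
  then obtain u v where u: "u \<in> annulus_arc n \<rho> \<eta> j" "p = torus_pt u"
    and v: "v \<in> annulus_arc n \<rho> \<eta> k" "p = torus_pt v" by blast
  obtain x where x: "torus_pt u = (circ_pt (position n j - x * (8 * of_int \<rho> / real n)), \<eta> + x * (1 - 2 * \<eta>))"
    using annulus_arcE[OF u(1) assms(1,2)] by blast
  obtain y where y: "torus_pt v = (circ_pt (position n k - y * (8 * of_int \<rho> / real n)), \<eta> + y * (1 - 2 * \<eta>))"
    using annulus_arcE[OF v(1) assms(1,2)] by blast
  have "x = y" using u(2) v(2) x y assms by simp
  then have "circ_pt (position n j - x * (8 * of_int \<rho> / real n)) = circ_pt (position n k - x * (8 * of_int \<rho> / real n))"
    using u(2) v(2) x y by simp
  then show False using position_shift_inj[OF assms(3,4)] assms(5) by blast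
qed

lemma annulus_arc_simple:
  assumes \<eta>: "0 < \<eta>" "\<eta> < 1/2"
  shows "simple_arc_in torus (torus_pt ` annulus_arc n \<rho> \<eta> j) (torus_pt (position n j, \<eta>))
    (torus_pt (position n j - 8 * of_int \<rho> / real n, 1 - \<eta>))"
proof -
  let ?g = "linepath (position n j, \<eta>) (position n j - 8 * of_int \<rho> / real n, 1 - \<eta>)"
  have im: "path_image ?g = annulus_arc n \<rho> \<eta> j" by (simp add: annulus_arc_def)
  have "arc ?g" using \<eta> by (intro arc_linepath) auto
  moreover have "path_image ?g \<subseteq> UNIV \<times> {-1..1}"
  proof
    fix v assume "v \<in> path_image ?g"
    then obtain x where x: "0 \<le> x" "x \<le> 1" "snd v = \<eta> + x * (1 - 2 * \<eta>)"
      unfolding im using annulus_arcE[OF _ \<eta>] by (metis snd_conv)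
    moreover have "x * (1 - 2 * \<eta>) \<le> 1 - 2 * \<eta>" using x \<eta> by (intro mult_left_le_one_le) auto
    moreover have "0 \<le> x * (1 - 2 * \<eta>)" using x \<eta> by simp
    ultimately have "-1 \<le> snd v" "snd v \<le> 1" using \<eta> by argo+
    then show "v \<in> UNIV \<times> {-1..1}" by (simp add: mem_Times_iff)
  qed
  moreover have "inj_on torus_pt (path_image ?g)"
  proof (rule inj_onI)
    fix u v assume uv: "u \<in> path_image ?g" "v \<in> path_image ?g" "torus_pt u = torus_pt v"
    obtain x where x: "torus_pt u = (circ_pt (position n j - x * (8 * of_int \<rho> / real n)), \<eta> + x * (1 - 2 * \<eta>))"
      "u = (position n j - x * (8 * of_int \<rho> / real n), \<eta> + x * (1 - 2 * \<eta>))"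
      using annulus_arcE[OF uv(1)[unfolded im] \<eta>] by blast
    obtain y where y: "torus_pt v = (circ_pt (position n j - y * (8 * of_int \<rho> / real n)), \<eta> + y * (1 - 2 * \<eta>))"
      "v = (position n j - y * (8 * of_int \<rho> / real n), \<eta> + y * (1 - 2 * \<eta>))"
      using annulus_arcE[OF uv(2)[unfolded im] \<eta>] by blast
    have "x = y" using uv(3) x(1) y(1) \<eta> by simp
    then show "u = v" using x(2) y(2) by simp
  qed
  ultimately have "simple_arc_in torus (torus_pt ` path_image ?g) (torus_pt (pathstart ?g)) (torus_pt (pathfinish ?g))"
    by (rule simple_arc_in_torus)
  then show ?thesis unfolding im pathstart_linepath pathfinish_linepath .
qed

lemma annulus_arc_end:
  assumes \<eta>: "0 < \<eta>" "\<eta> < 1/2" and n: "0 < n" and jk: "int n dvd int j - \<rho> - int k"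
  shows "torus_pt (position n j - 8 * of_int \<rho> / real n, 1 - \<eta>) = torus_pt (position n k, - \<eta>)"
proof -
  obtain m where m: "int j - \<rho> - int k = int n * m" using jk by blast
  then have "real_of_int (int j - \<rho> - int k) = real_of_int (int n * m)" by (simp only:)
  then have "real j - of_int \<rho> - real k = real n * of_int m" by simp
  then have "(position n j - 8 * of_int \<rho> / real n) - position n k = 8 * of_int m"
    using n by (simp add: position_def field_simps)
  then have "circ_pt (position n j - 8 * of_int \<rho> / real n) = circ_pt (position n k)"
    unfolding circ_pt_eq_iff by blast
  moreover have "frac (1 - \<eta>) = frac (- \<eta>)"
  proof -
    have "frac (- \<eta> + 1) = frac (- \<eta>)" by (rule frac_1_eq)
    then show ?thesis by simp
  qed
  ultimately show ?thesis by (simp add: torus_pt_def)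
qed

text \<open>The number on the circle \<open>S\<close> of the annulus arc with end point \<open>v\<close>.\<close>

definition strand :: "int \<Rightarrow> int \<Rightarrow> int \<Rightarrow> int \<times> bool \<Rightarrow> int" where
  "strand n \<rho> \<epsilon> = (\<lambda>(k, b). if b \<longleftrightarrow> \<epsilon> = 1 then k else wrap n (k + \<rho>))"

text \<open>For \<open>\<epsilon> = -1\<close> the two circles exchange their labels, which inverts
  the direction of the rotation; this is the reason for passing from \<open>\<rho>\<close> to
  \<open>\<epsilon> * \<rho>\<close>.\<close>

lemma annulus_map_eq:
  assumes "\<epsilon> = 1 \<or> \<epsilon> = -1" "[\<rho>' = \<epsilon> * \<rho>] (mod n)"
  shows "annulus_map n \<rho>' (k, b) = (wrap n (if b \<longleftrightarrow> \<epsilon> = 1 then k - \<rho> else k + \<rho>), \<not> b)"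
proof -
  have d: "n dvd \<rho>' - \<epsilon> * \<rho>" using assms(2) by (simp add: cong_iff_dvd_diff)
  then have "n dvd \<epsilon> * \<rho> - \<rho>'" by (simp add: dvd_diff_commute)
  with d show ?thesis using assms(1) by (auto simp: annulus_map_def wrap_eq_iff algebra_simps)
qed

lemma strand_pair:
  assumes \<epsilon>: "\<epsilon> = 1 \<or> \<epsilon> = -1" "[\<rho>' = \<epsilon> * \<rho>] (mod n)" and v: "v \<in> {1..n} \<times> UNIV"
  shows "{v, annulus_map n \<rho>' v} =
    {(strand n \<rho> \<epsilon> v, \<epsilon> = 1), (wrap n (strand n \<rho> \<epsilon> v - \<rho>), \<epsilon> \<noteq> 1)}"
    and "strand n \<rho> \<epsilon> v \<in> {1..n}"
proof -
  obtain k b where kb: "v = (k, b)" "1 \<le> k" "k \<le> n" using v by (metis SigmaE atLeastAtMost_iff)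
  have n: "0 < n" using kb by simp
  have [simp]: "wrap n k = k" using kb by (simp add: wrap_id)
  show "{v, annulus_map n \<rho>' v} =
    {(strand n \<rho> \<epsilon> v, \<epsilon> = 1), (wrap n (strand n \<rho> \<epsilon> v - \<rho>), \<epsilon> \<noteq> 1)}"
    unfolding kb annulus_map_eq[OF \<epsilon>]
    by (cases "b \<longleftrightarrow> \<epsilon> = 1") (auto simp: strand_def wrap_wrap)
  show "strand n \<rho> \<epsilon> v \<in> {1..n}" using kb wrap_range[OF n, of "k + \<rho>"] by (auto simp: strand_def)
qed

lemma determined_curve_simple_arc:
  fixes r s t n l :: nat and \<rho> \<rho>' \<epsilon> :: int
  defines "P \<equiv> rect_map (2 * int r + 1) (int s)" and "F \<equiv> annulus_map (int n) \<rho>'"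
  defines "u \<equiv> walk F P (int s + int r + 1, True)"
  assumes \<epsilon>: "\<epsilon> = 1 \<or> \<epsilon> = -1" and n: "n = 2 * r + 1 + s + t"
    and \<rho>: "[\<rho>' = \<epsilon> * \<rho>] (mod int n)"
    and \<eta>: "0 < \<eta>" "\<eta> < 1/2" and A: "rectangle_arcs r s t \<epsilon> \<eta> A"
    and ul: "F (u l) = (int r + 1, False)" "inj_on u {..l}"
      "\<And>i j. i \<le> l \<Longrightarrow> j \<le> l \<Longrightarrow> u i \<noteq> F (u j)"
      "{1..int n} \<times> UNIV = u ` {..l} \<union> (F \<circ> u) ` {..l}"
  shows "simple_arc_in torus (torus_pt ` ((\<Union>g\<in>A. path_image g) \<union> (\<Union>j\<in>{1..n}. annulus_arc n \<rho> \<eta> j)))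
    (torus_pt (1, 0)) (torus_pt (-1, 0))"
proof -
  define V where "V = {1..int n} \<times> (UNIV :: bool set)"
  have n0: "0 < n" by (simp add: n)
  let ?x = "vertex n \<epsilon> \<eta>"
  obtain R where RV: "R ` V = A" and RP: "\<And>v. v \<in> V \<Longrightarrow> R (P v) = R v"
    and R_ends: "\<And>v. v \<in> V \<Longrightarrow> P v \<noteq> v \<Longrightarrow> {pathstart (R v), pathfinish (R v)} = {?x v, ?x (P v)}"
    and R1: "pathstart (R (int (s + (r + 1)), True)) = ?x (int (s + (r + 1)), True)"
      "pathfinish (R (int (s + (r + 1)), True)) = (1, 0)"
    and R0: "pathstart (R (int (r + 1), False)) = ?x (int (r + 1), False)"
      "pathfinish (R (int (r + 1), False)) = (- 1, 0)"
    using rectangle_arcs_by_vertex[OF A \<epsilon>] unfolding V_def P_def n by metis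
  have A_arc: "arc g" "path_image g - {pathstart g, pathfinish g} \<subseteq> {-4<..<4} \<times> {-\<eta><..<\<eta>}" if "g \<in> A" for g
    using A that unfolding rectangle_arcs_def Let_def by blast+
  have A_disj: "path_image g \<inter> path_image h = {}" if "g \<in> A" "h \<in> A" "g \<noteq> h" for g h
    using A that unfolding rectangle_arcs_def Let_def pairwise_def disjnt_def by blast
  have v1: "(int (s + (r + 1)), True) = (int s + int r + 1, True)" and v0: "(int (r + 1), False) = (int r + 1, False)"
    by simp_all
  have nonneg: "0 \<le> int r" "0 \<le> int s" "0 \<le> int t" by simp_all
  have nn: "int n = 2 * int r + 1 + int s + int t" by (simp add: n)
  have PV: "P v \<in> V" "P (P v) = v" "P v = v \<longleftrightarrow> v = (int s + int r + 1, True) \<or> v = (int r + 1, False)"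
    if "v \<in> V" for v
    using rect_map_props[of "int r" "int s" "int t" v] that by (simp_all add: P_def V_def nn)
  have FV: "F v \<in> V" "F (F v) = v" if "v \<in> V" for v
    using annulus_map_props[of "int n" v \<rho>'] that n0 by (simp_all add: F_def V_def)
  have x_rect: "?x v \<in> {-4<..<4} \<times> {-\<eta>..\<eta>}" "\<bar>snd (?x v)\<bar> = \<eta>" if v: "v \<in> V" for v
  proof -
    obtain k b where kb: "v = (k, b)" "1 \<le> k" "k \<le> int n" using v unfolding V_def by (metis SigmaE atLeastAtMost_iff)
    then have "\<bar>position n (nat k)\<bar> < 4" by (intro position_bounds) auto
    then show "?x v \<in> {-4<..<4} \<times> {-\<eta>..\<eta>}" "\<bar>snd (?x v)\<bar> = \<eta>"
      using kb \<eta> by (auto simp: vertex_def abs_less_iff)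
  qed
  have x_inj: "inj_on ?x V"
  proof (rule inj_onI)
    fix v w assume vw: "v \<in> V" "w \<in> V" "?x v = ?x w"
    obtain k b where kb: "v = (k, b)" "1 \<le> k" "k \<le> int n" using vw(1) unfolding V_def by (metis SigmaE atLeastAtMost_iff)
    obtain m d where md: "w = (m, d)" "1 \<le> m" "m \<le> int n" using vw(2) unfolding V_def by (metis SigmaE atLeastAtMost_iff)
    have "position n (nat k) = position n (nat m)" "b = d"
      using vw(3) \<eta> unfolding kb md vertex_def by (auto split: if_splits)
    then have "nat k = nat m"
      using position_less[OF n0, of "nat k" "nat m"] position_less[OF n0, of "nat m" "nat k"]
      by (metis less_irrefl linorder_neqE_nat)
    then show "v = w" using kb md \<open>b = d\<close> by simp
  qed
  define q where "q v = torus_pt (?x v)" for v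
  have q_inj: "inj_on q V"
    unfolding q_def using x_inj x_rect(1) inj_on_torus_pt_rectangle[OF \<eta>(2)]
    by (intro inj_onI) (metis inj_on_eq_iff)
  have ends_sub: "{pathstart (R v), pathfinish (R v)} \<subseteq> {?x v, ?x (P v), (1, 0), (-1, 0)}"
    and x_end: "?x v \<in> {pathstart (R v), pathfinish (R v)}" if v: "v \<in> V" for v
  proof -
    have "{pathstart (R v), pathfinish (R v)} \<subseteq> {?x v, ?x (P v), (1, 0), (-1, 0)} \<and>
      ?x v \<in> {pathstart (R v), pathfinish (R v)}"
    proof (cases "P v = v")
      case True
      then have "v = (int (s + (r + 1)), True) \<or> v = (int (r + 1), False)" unfolding v1 v0 using PV(3)[OF v] by blast
      then show ?thesis using R0 R1 by auto
    next
      case False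
      then show ?thesis using R_ends[OF v] by auto
    qed
    then show "{pathstart (R v), pathfinish (R v)} \<subseteq> {?x v, ?x (P v), (1, 0), (-1, 0)}"
      "?x v \<in> {pathstart (R v), pathfinish (R v)}" by blast+
  qed
  have R_rect: "path_image (R v) \<subseteq> {-4<..<4} \<times> {-\<eta>..\<eta>}" if v: "v \<in> V" for v
  proof -
    have "R v \<in> A" using v RV by blast
    note a = A_arc(2)[OF this]
    have "{pathstart (R v), pathfinish (R v)} \<subseteq> {-4<..<4} \<times> {-\<eta>..\<eta>}"
      using ends_sub[OF v] x_rect(1)[OF v] x_rect(1)[OF PV(1)[OF v]] \<eta> by auto
    moreover have "{-4<..<4} \<times> {-\<eta><..<\<eta>} \<subseteq> {-4<..<4::real} \<times> {-\<eta>..\<eta>}" by auto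
    ultimately show ?thesis using a by blast
  qed
  define Q where "Q v = torus_pt ` path_image (R v)" for v
  define T where "T v = torus_pt ` annulus_arc n \<rho> \<eta> (nat (strand (int n) \<rho> \<epsilon> v))" for v
  have Q_arc: "simple_arc_in torus (Q v) (torus_pt (pathstart (R v))) (torus_pt (pathfinish (R v)))" if v: "v \<in> V" for v
    unfolding Q_def
  proof (rule simple_arc_in_torus)
    show "arc (R v)" using A_arc(1) v RV by blast
    show "inj_on torus_pt (path_image (R v))"
      by (rule inj_on_subset[OF inj_on_torus_pt_rectangle[OF \<eta>(2)] R_rect[OF v]])
    have "{-4<..<4::real} \<times> {-\<eta>..\<eta>} \<subseteq> UNIV \<times> {-1..1}" using \<eta> by auto
    then show "path_image (R v) \<subseteq> UNIV \<times> {-1..1}" using R_rect[OF v] by blast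
  qed
  note strand = strand_pair[OF \<epsilon> \<rho>, folded F_def V_def]
  have T_pair: "T v = torus_pt ` annulus_arc n \<rho> \<eta> j" "{v, F v} = {(int j, \<epsilon> = 1), (wrap (int n) (int j - \<rho>), \<epsilon> \<noteq> 1)}"
    "q (int j, \<epsilon> = 1) = torus_pt (position n j, \<eta>)"
    "q (wrap (int n) (int j - \<rho>), \<epsilon> \<noteq> 1) = torus_pt (position n j - 8 * of_int \<rho> / real n, 1 - \<eta>)" "j \<in> {1..n}"
    if v: "v \<in> V" and j: "j = nat (strand (int n) \<rho> \<epsilon> v)" for v j
  proof -
    have jj: "int j = strand (int n) \<rho> \<epsilon> v" using strand(2)[OF v] j by auto
    show "T v = torus_pt ` annulus_arc n \<rho> \<eta> j" by (simp add: T_def j)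
    show "{v, F v} = {(int j, \<epsilon> = 1), (wrap (int n) (int j - \<rho>), \<epsilon> \<noteq> 1)}" using strand(1)[OF v] jj by simp
    show "q (int j, \<epsilon> = 1) = torus_pt (position n j, \<eta>)" by (simp add: q_def vertex_def)
    show "j \<in> {1..n}" using strand(2)[OF v] jj by auto
    have w: "1 \<le> wrap (int n) (int j - \<rho>)" using wrap_range[of "int n"] n0 by simp
    have "int n dvd int j - \<rho> - int (nat (wrap (int n) (int j - \<rho>)))"
      using wrap_dvd[of "int n" "int j - \<rho>"] w by (simp add: dvd_diff_commute)
    from annulus_arc_end[OF \<eta> n0 this]
    show "q (wrap (int n) (int j - \<rho>), \<epsilon> \<noteq> 1) = torus_pt (position n j - 8 * of_int \<rho> / real n, 1 - \<eta>)"
      by (simp add: q_def vertex_def)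
  qed
  have T_arc: "simple_arc_in torus (T v) (q v) (q (F v))" if v: "v \<in> V" for v
  proof -
    define j where "j = nat (strand (int n) \<rho> \<epsilon> v)"
    note p = T_pair[OF v j_def]
    have arc: "simple_arc_in torus (T v) (q (int j, \<epsilon> = 1)) (q (wrap (int n) (int j - \<rho>), \<epsilon> \<noteq> 1))"
      unfolding p(1,3,4) by (rule annulus_arc_simple[OF \<eta>])
    from p(2) consider "v = (int j, \<epsilon> = 1)" "F v = (wrap (int n) (int j - \<rho>), \<epsilon> \<noteq> 1)"
      | "F v = (int j, \<epsilon> = 1)" "v = (wrap (int n) (int j - \<rho>), \<epsilon> \<noteq> 1)"
      unfolding doubleton_eq_iff by blast
    then show ?thesis using arc simple_arc_in_sym[OF arc] by cases simp_all
  qed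
  \<comment> \<open>The walk \<open>u\<close> records only vertices reached through the rectangle;
    \<open>w\<close> inserts the vertices reached through the annulus at the odd indices.\<close>
  define w where "w m = (if even m then u (m div 2) else F (u (m div 2)))" for m
  have uV: "u i \<in> V" if "i \<le> l" for i using ul(4) that unfolding V_def by blast
  have wV: "w m \<in> V" if "m \<le> 2 * l + 1" for m
    using uV[of "m div 2"] FV(1)[OF uV, of "m div 2"] that by (auto simp: w_def)
  have u0: "u 0 = (int s + int r + 1, True)" by (simp add: u_def)
  have "simple_arc_in torus (\<Union>v\<in>w ` {..2 * l + 1}. Q v \<union> T v) (torus_pt (1, 0)) (torus_pt (-1, 0))"
  proof (rule walk_simple_arc[where V = V and A = F and P = P and q = q])
    show "odd (2 * l + 1)" by simp
    show "inj_on w {..2 * l + 1}"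
    proof (rule inj_onI)
      fix a b assume ab: "a \<in> {..2 * l + 1}" "b \<in> {..2 * l + 1}" "w a = w b"
      then have d: "a div 2 \<le> l" "b div 2 \<le> l" by auto
      have Fu: "F (u i) = F (u j) \<longleftrightarrow> u i = u j" if "i \<le> l" "j \<le> l" for i j
        using FV(2)[OF uV] that by metis
      have par: "even a \<longleftrightarrow> even b" using ab(3) ul(3)[OF d] ul(3)[OF d(2,1)] unfolding w_def by (metis (full_types))
      then have "u (a div 2) = u (b div 2)" using ab(3) Fu[OF d] by (auto simp: w_def split: if_splits)
      then have "a div 2 = b div 2" using inj_onD[OF ul(2)] d by simp
      then show "a = b" using par by (metis even_two_times_div_two odd_two_times_div_two_succ)
    qed
    show "w i \<in> V" if "i \<le> 2 * l + 1" for i by (rule wV[OF that])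
    show "F (w m) = w (Suc m)" if "even m" "m < 2 * l + 1" for m
      using that by (simp add: w_def)
    show "P (w m) = w (Suc m)" if "odd m" "m < 2 * l + 1" for m
    proof -
      have "Suc m div 2 = Suc (m div 2)" using that by presburger
      then show ?thesis using that by (simp add: w_def u_def)
    qed
    have w0: "w 0 = (int (s + (r + 1)), True)" by (simp add: w_def u0)
    have wl: "w (2 * l + 1) = (int (r + 1), False)" by (simp add: w_def ul(1))
    show "P (w 0) = w 0" "P (w (2 * l + 1)) = w (2 * l + 1)"
      using PV(3)[OF wV, of 0] PV(3)[OF wV, of "2 * l + 1"] w0 wl by auto
    show "P (P v) = v" "F (F v) = v" if "v \<in> V" for v using PV(2) FV(2) that by auto
    show "simple_arc_in torus (Q v) (q v) (q (P v))" if v: "v \<in> V" "P v \<noteq> v" for v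
      using R_ends[OF v] Q_arc[OF v(1)] simple_arc_in_sym[OF Q_arc[OF v(1)]]
      unfolding doubleton_eq_iff q_def by auto
    show "simple_arc_in torus (T v) (q v) (q (F v))" if v: "v \<in> V" for v by (rule T_arc[OF v])
    show "simple_arc_in torus (Q (w 0)) (torus_pt (1, 0)) (q (w 0))"
      using simple_arc_in_sym[OF Q_arc[OF wV[of 0]]] unfolding w0 R1 q_def by simp
    show "simple_arc_in torus (Q (w (2 * l + 1))) (q (w (2 * l + 1))) (torus_pt (-1, 0))"
      using Q_arc[OF wV[of "2 * l + 1"]] unfolding wl R0 q_def by simp
    show "Q v \<inter> Q v' = {}" if v: "v \<in> V" "v' \<in> V" "v' \<noteq> v" "v' \<noteq> P v" for v v'
    proof -
      \<comment> \<open>An arc determines its labels: its ends at height \<eta> or -\<eta> are the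
        points of the vertices, while \<open>x\<close> and \<open>y\<close> have height 0.\<close>
      have "R v \<noteq> R v'"
      proof
        assume "R v = R v'"
        then have "?x v' \<in> {?x v, ?x (P v), (1, 0), (-1, 0)}" using ends_sub[OF v(1)] x_end[OF v(2)] by auto
        moreover have "?x v' \<noteq> (1, 0)" "?x v' \<noteq> (-1, 0)" using x_rect(2)[OF v(2)] \<eta> by auto
        ultimately show False using inj_on_eq_iff[OF x_inj] v PV(1)[OF v(1)] by auto
      qed
      then have "path_image (R v) \<inter> path_image (R v') = {}" using A_disj RV v(1,2) by blast
      then show ?thesis
        unfolding Q_def using inj_on_image_Int[OF inj_on_torus_pt_rectangle[OF \<eta>(2)] R_rect[OF v(1)] R_rect[OF v(2)]]
        by simp
    qed
    show "T v \<inter> T v' = {}" if v: "v \<in> V" "v' \<in> V" "v' \<noteq> v" "v' \<noteq> F v" for v v'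
    proof -
      have "nat (strand (int n) \<rho> \<epsilon> v) \<noteq> nat (strand (int n) \<rho> \<epsilon> v')"
      proof
        assume "nat (strand (int n) \<rho> \<epsilon> v) = nat (strand (int n) \<rho> \<epsilon> v')"
        then have "{v, F v} = {v', F v'}" using T_pair(2)[OF v(1) refl] T_pair(2)[OF v(2) refl] by simp
        then show False using v by blast
      qed
      then show ?thesis
        unfolding T_def using T_pair(5)[OF v(1) refl] T_pair(5)[OF v(2) refl] by (intro annulus_arc_disjoint[OF \<eta>])
    qed
    show "Q (P v) = Q v" if "v \<in> V" for v using RP that by (simp add: Q_def)
    show "T (F v) = T v" if v: "v \<in> V" for v
    proof -
      have "{F v, F (F v)} = {v, F v}" using FV(2)[OF v] by auto
      then have "{(strand (int n) \<rho> \<epsilon> (F v), \<epsilon> = 1), (wrap (int n) (strand (int n) \<rho> \<epsilon> (F v) - \<rho>), \<epsilon> \<noteq> 1)} =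
        {(strand (int n) \<rho> \<epsilon> v, \<epsilon> = 1), (wrap (int n) (strand (int n) \<rho> \<epsilon> v - \<rho>), \<epsilon> \<noteq> 1)}"
        using strand(1)[OF v] strand(1)[OF FV(1)[OF v]] by simp
      then have "strand (int n) \<rho> \<epsilon> (F v) = strand (int n) \<rho> \<epsilon> v" unfolding doubleton_eq_iff by auto
      then show ?thesis by (simp add: T_def)
    qed
    show "Q v \<inter> T v' \<subseteq> q ` ({v, P v} \<inter> {v', F v'})" if v: "v \<in> V" "v' \<in> V" for v v'
    proof -
      define j where "j = nat (strand (int n) \<rho> \<epsilon> v')"
      note p = T_pair[OF v(2) j_def]
      have "Q v \<inter> T v' \<subseteq> q ` {v, P v} \<inter> q ` {v', F v'}"
      proof
        fix z assume z: "z \<in> Q v \<inter> T v'"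
        then obtain a where a: "a \<in> path_image (R v)" "z = torus_pt a" by (auto simp: Q_def)
        from z p(1) obtain b where b: "b \<in> annulus_arc n \<rho> \<eta> j" "z = torus_pt b" by auto
        from annulus_arcE[OF b(1) \<eta>] obtain y where y: "0 \<le> y" "y \<le> 1"
          "z = (circ_pt (position n j - y * (8 * of_int \<rho> / real n)), \<eta> + y * (1 - 2 * \<eta>))"
          "b = (position n j - y * (8 * of_int \<rho> / real n), \<eta> + y * (1 - 2 * \<eta>))" unfolding b(2) by blast
        have ar: "- 4 < fst a" "fst a < 4" "- \<eta> \<le> snd a" "snd a \<le> \<eta>" using R_rect[OF v(1)] a(1) by (auto simp: mem_Times_iff)
        have za: "snd z = (if snd a < 0 then snd a + 1 else snd a)"
          using torus_pt_rectangle[of "fst a" "snd a"] ar \<eta> by (simp add: a(2))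
        have zy: "snd z = \<eta> + y * (1 - 2 * \<eta>)" by (simp add: y(3))
        \<comment> \<open>Modulo 1 the rectangle has heights within \<eta> of 0 and the annulus
          heights from \<eta> to 1 - \<eta>. They meet only on the circles \<open>S\<close> and
          \<open>F\<close>, where both arcs have their ends.\<close>
        have e: "\<bar>snd a\<bar> = \<eta> \<and> (y = 0 \<or> y = 1)"
        proof (cases "snd a < 0")
          case True
          then have "1 - \<eta> \<le> \<eta> + y * (1 - 2 * \<eta>)" using za zy ar by simp
          then have "1 * (1 - 2 * \<eta>) \<le> y * (1 - 2 * \<eta>)" by argo
          then have "1 \<le> y" using \<eta> by (simp only: mult_le_cancel_right)
          then have "y = 1" using y(2) by simp
          then show ?thesis using True za zy by simp
        next
          case False
          then have "\<eta> + y * (1 - 2 * \<eta>) \<le> \<eta>" using za zy ar by simp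
          then have "y * (1 - 2 * \<eta>) \<le> 0 * (1 - 2 * \<eta>)" by simp
          then have "y \<le> 0" using \<eta> by (simp only: mult_le_cancel_right)
          then have "y = 0" using y(1) by simp
          then show ?thesis using False za zy by simp
        qed
        have "a \<notin> {-4<..<4} \<times> {-\<eta><..<\<eta>}" using e by (auto simp: mem_Times_iff)
        then have "a \<in> {pathstart (R v), pathfinish (R v)}" using A_arc(2)[of "R v"] RV v(1) a(1) by blast
        then have "a \<in> {?x v, ?x (P v)}" using ends_sub[OF v(1)] e \<eta> by fastforce
        then have "z \<in> q ` {v, P v}" unfolding a(2) q_def by blast
        moreover have "z \<in> {q (int j, \<epsilon> = 1), q (wrap (int n) (int j - \<rho>), \<epsilon> \<noteq> 1)}"
          unfolding p(3,4) b(2) y(4) using e by auto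
        then have "z \<in> q ` {v', F v'}" unfolding p(2) by simp
        ultimately show "z \<in> q ` {v, P v} \<inter> q ` {v', F v'}" by blast
      qed
      also have "q ` {v, P v} \<inter> q ` {v', F v'} = q ` ({v, P v} \<inter> {v', F v'})"
        by (rule inj_on_image_Int[OF q_inj, symmetric]) (use v PV(1) FV(1) in auto)
      finally show ?thesis .
    qed
  qed
  moreover have "(\<Union>v\<in>w ` {..2 * l + 1}. Q v \<union> T v) =
    torus_pt ` ((\<Union>g\<in>A. path_image g) \<union> (\<Union>j\<in>{1..n}. annulus_arc n \<rho> \<eta> j))"
  proof -
    have "w ` {..2 * l + 1} = V"
    proof
      show "w ` {..2 * l + 1} \<subseteq> V" using wV by auto
      have "u i \<in> w ` {..2 * l + 1}" "F (u i) \<in> w ` {..2 * l + 1}" if "i \<le> l" for i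
      proof -
        have "w (2 * i) = u i" "w (2 * i + 1) = F (u i)" by (simp_all add: w_def)
        moreover have "w (2 * i) \<in> w ` {..2 * l + 1}" "w (2 * i + 1) \<in> w ` {..2 * l + 1}" using that by auto
        ultimately show "u i \<in> w ` {..2 * l + 1}" "F (u i) \<in> w ` {..2 * l + 1}" by (simp_all only:)
      qed
      then show "V \<subseteq> w ` {..2 * l + 1}" unfolding V_def ul(4) by (auto simp only: Un_iff image_iff atMost_iff comp_apply)
    qed
    moreover have "(\<Union>v\<in>V. Q v) = torus_pt ` (\<Union>g\<in>A. path_image g)"
      unfolding Q_def RV[symmetric] by blast
    moreover have "(\<Union>v\<in>V. T v) = torus_pt ` (\<Union>j\<in>{1..n}. annulus_arc n \<rho> \<eta> j)"
    proof
      have "T v \<subseteq> torus_pt ` (\<Union>j\<in>{1..n}. annulus_arc n \<rho> \<eta> j)" if v: "v \<in> V" for v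
        unfolding T_pair(1)[OF v refl] using T_pair(5)[OF v refl] by blast
      then show "(\<Union>v\<in>V. T v) \<subseteq> torus_pt ` (\<Union>j\<in>{1..n}. annulus_arc n \<rho> \<eta> j)" by blast
      have "torus_pt ` annulus_arc n \<rho> \<eta> j \<subseteq> (\<Union>v\<in>V. T v)" if j: "j \<in> {1..n}" for j
      proof -
        have "(int j, \<epsilon> = 1) \<in> V" using j by (auto simp: V_def)
        moreover have "T (int j, \<epsilon> = 1) = torus_pt ` annulus_arc n \<rho> \<eta> j" by (simp add: T_def strand_def)
        ultimately show ?thesis by blast
      qed
      then show "torus_pt ` (\<Union>j\<in>{1..n}. annulus_arc n \<rho> \<eta> j) \<subseteq> (\<Union>v\<in>V. T v)" by blast
    qed
    ultimately show ?thesis by (simp only: UN_Un_distrib image_Un)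
  qed
  ultimately show ?thesis by simp
qed

theorem theorem2p6:
  fixes r s t n :: nat and \<rho> \<epsilon> \<rho>' \<alpha> \<beta> \<gamma> \<delta> :: int
  assumes "\<epsilon> = 1 \<or> \<epsilon> = -1"
    and "n = 2*r + 1 + s + t"
    and "[\<rho>' = \<epsilon> * \<rho>] (mod int n)" and "0 \<le> \<rho>'" and "\<rho>' < int n"
    and "\<rho>' < int n - int t \<Longrightarrow>
           \<beta> = int t mod \<rho>' \<and> \<alpha> = \<rho>' - \<beta> \<and> \<gamma> = int n - \<rho>' - int t \<and> \<delta> = int s"
    and "int n - int t \<le> \<rho>' \<Longrightarrow>
           \<beta> = int t mod (int n - \<rho>') \<and> \<alpha> = \<rho>' - int t \<and> \<gamma> = int n - \<rho>' - \<beta> \<and> \<delta> = int s"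
    and "component_count \<alpha> \<beta> \<gamma> \<delta> 1"
  shows "\<exists>C. simple_arc_in torus C (torus_pt (1, 0)) (torus_pt (-1, 0)) \<and>
             determined_curve r s t \<rho> \<epsilon> C"
proof -
  have nn: "2 * int r + 1 + int s + int t = int n" using assms(2) by simp
  obtain A where A: "rectangle_arcs r s t \<epsilon> (1/4) A"
    using rectangle_arcs_exist[OF assms(1)] by blast
  define C where "C = torus_pt ` ((\<Union>g\<in>A. path_image g) \<union> (\<Union>j\<in>{1..n}. annulus_arc n \<rho> (1/4) j))"
  let ?F = "annulus_map (int n) \<rho>'"
  let ?u = "walk ?F (rect_map (2 * int r + 1) (int s)) (int s + int r + 1, True)"
  obtain l where l: "?F (?u l) = (int r + 1, False)" "inj_on ?u {..l}"
      "\<And>i j. i \<le> l \<Longrightarrow> j \<le> l \<Longrightarrow> ?u i \<noteq> ?F (?u j)"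
      "{1..int n} \<times> UNIV = ?u ` {..l} \<union> (?F \<circ> ?u) ` {..l}"
    by (rule curve_walk[of "int r" "int s" "int t" \<rho>' \<beta> \<alpha> \<gamma> \<delta>, unfolded nn, OF _ _ _ assms(4-8)]) auto
  have "simple_arc_in torus C (torus_pt (1, 0)) (torus_pt (-1, 0))"
    unfolding C_def by (rule determined_curve_simple_arc[OF assms(1-3) _ _ A l]) auto
  moreover have "determined_curve r s t \<rho> \<epsilon> C"
    unfolding determined_curve_def C_def assms(2)
    using A by (intro exI[of _ "1/4"] exI[of _ A]) auto
  ultimately show ?thesis by blast
qed

end
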